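(* Let $f$ be a real $C^1$ function on $(a,b)$ where $-\infty<a<b<\infty$. For each $n\in\mathbb{N}$ consider the following conditions: $(\alpha)_n$ $f$ is $n$-monotone on $(a,b)$; $(\beta)_n$ $\limsup_{t\nearrow b}(b-t)f(t)<+\infty$, $\limsup_{t\nearrow b}f(t)>-\infty$, and $L_{(b-t)^2f(t)}(t_1,\dots,t_n)$ is conditionally positive definite for all $t_1,\dots,t_n\in(a,b)$; $(\gamma)_n$ $\liminf_{t\searrow a}(t-a)f(t)\le0$, $\limsup_{t\nearrow b}f(t)>-\infty$, and $L_{(t-a)(b-t)f(t)}(t_1,\dots,t_n)$ is conditionally negative definite for all $t_1,\dots,t_n\in(a,b)$; $(\delta)_n$ $\liminf_{t\searrow a}(t-a)f(t)\le0$, $\limsup_{t\searrow a}(t-a)^2f(t)\ge0$, and $L_{(t-a)^2f(t)}(t_1,\dots,t_n)$ is conditionally positive definite for all $t_1,\dots,t_n\in(a,b)$. Then for every $n\in\mathbb{N}$ the following implications hold: $$ (\alpha)_n\Longrightarrow(\beta)_n\ \mbox{if $n\ge2$},\quad (\beta)_{4n+1}\Longrightarrow(\alpha)_n,\quad (\alpha)_{2n+2}\Longrightarrow(\gamma)_n,\quad (\gamma)_{2n+1}\Longrightarrow(\alpha)_n, $$ $$ (\alpha)_n\Longrightarrow(\delta)_n\ \mbox{if $n\ge2$},\quad (\gamma)_{2n+1}\Longrightarrow(\delta)_n,\quad (\delta)_{2n+1}\Longrightarrow(\gamma)_n. $$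
   Context: $\mathbb{N}=\{1,2,\dots\}$; $\mathbb{M}_n$ is the set of $n\times n$ complex matrices. A continuous real function $f$ on an interval $J$ is $n$-monotone (matrix monotone of order $n$) on $J$ if $A\ge B$ implies $f(A)\ge f(B)$ for all Hermitian $A,B\in\mathbb{M}_n$ with spectra in $J$ (functional calculus, positive semidefinite order). A Hermitian $A\in\mathbb{M}_n$ is conditionally positive definite if $\langle x,Ax\rangle\ge0$ for all $x=(x_1,\dots,x_n)^t\in\mathbb{C}^n$ with $\sum_{i=1}^nx_i=0$, and conditionally negative definite if $-A$ is conditionally positive definite. For a real $C^1$ function $g$ on an open interval, $g^{[1]}(s,t):=\frac{g(s)-g(t)}{s-t}$ if $s\ne t$ and $g^{[1]}(s,s):=g'(s)$; the Loewner matrix is $L_g(t_1,\dots,t_n):=[g^{[1]}(t_i,t_j)]_{i,j=1}^n$ (the points $t_i$ need not be distinct). A subscript such as $(b-t)^2f(t)$ denotes the function $t\mapsto(b-t)^2f(t)$, and similarly for the others. *)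

theory Defs
  imports "HOL-Analysis.Analysis" "Jordan_Normal_Form.Spectral_Radius"
    "Jordan_Normal_Form.Schur_Decomposition"
begin

definition hermitian :: "complex mat \<Rightarrow> bool" where
  "hermitian A \<longleftrightarrow> mat_adjoint A = A"

(* \<open>v \<bullet>c w\<close> is linear in v and conjugate-linear in w, so \<open>(A *\<^sub>v x) \<bullet>c x\<close> is the form
   \<langle>x, A x\<rangle> of an inner product that is linear in its second argument.  The order on complex is
   that of HOL-Library.Complex_Order: 0 \<le> z means that z is real and nonnegative. *)
definition pos_semidef :: "complex mat \<Rightarrow> bool" where
  "pos_semidef A \<longleftrightarrow> hermitian A \<and> (\<forall>x\<in>carrier_vec (dim_row A). 0 \<le> (A *\<^sub>v x) \<bullet>c x)"

definition cond_pos_def :: "complex mat \<Rightarrow> bool" where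
  "cond_pos_def A \<longleftrightarrow> hermitian A \<and>
     (\<forall>x\<in>carrier_vec (dim_row A). (\<Sum>i<dim_row A. vec_index x i) = 0 \<longrightarrow> 0 \<le> (A *\<^sub>v x) \<bullet>c x)"

definition cond_neg_def :: "complex mat \<Rightarrow> bool" where
  "cond_neg_def A \<longleftrightarrow> cond_pos_def (- A)"

definition is_fun_calc :: "(real \<Rightarrow> real) \<Rightarrow> complex mat \<Rightarrow> complex mat \<Rightarrow> bool" where
  "is_fun_calc f A B \<longleftrightarrow> (\<exists>U d.
     U \<in> carrier_mat (dim_row A) (dim_row A) \<and>
     mat_adjoint U * U = 1\<^sub>m (dim_row A) \<and>
     A = U * mat_diag (dim_row A) (\<lambda>i. complex_of_real (d i)) * mat_adjoint U \<and>
     B = U * mat_diag (dim_row A) (\<lambda>i. complex_of_real (f (d i))) * mat_adjoint U)"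

(* The functional calculus f(A) for Hermitian A.  By the spectral theorem every Hermitian A has a
   unitary diagonalization; by \<open>is_fun_calc_unique\<close> below, f(A) does not depend on the choice. *)
definition fun_calc :: "(real \<Rightarrow> real) \<Rightarrow> complex mat \<Rightarrow> complex mat" where
  "fun_calc f A = (THE B. is_fun_calc f A B)"

definition n_monotone_on :: "nat \<Rightarrow> real set \<Rightarrow> (real \<Rightarrow> real) \<Rightarrow> bool" where
  "n_monotone_on n J f \<longleftrightarrow> continuous_on J f \<and>
     (\<forall>A\<in>carrier_mat n n. \<forall>B\<in>carrier_mat n n.
        hermitian A \<and> hermitian B \<and>
        spectrum A \<subseteq> complex_of_real ` J \<and> spectrum B \<subseteq> complex_of_real ` J \<and>
        pos_semidef (A - B) \<longrightarrow> pos_semidef (fun_calc f A - fun_calc f B))"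

definition divided_diff :: "(real \<Rightarrow> real) \<Rightarrow> real \<Rightarrow> real \<Rightarrow> real" where
  "divided_diff g s t = (if s = t then deriv g s else (g s - g t) / (s - t))"

definition loewner_mat :: "(real \<Rightarrow> real) \<Rightarrow> real list \<Rightarrow> complex mat" where
  "loewner_mat g ts = mat (length ts) (length ts)
     (\<lambda>(i, j). complex_of_real (divided_diff g (ts ! i) (ts ! j)))"

definition cond_alpha :: "(real \<Rightarrow> real) \<Rightarrow> real \<Rightarrow> real \<Rightarrow> nat \<Rightarrow> bool" where
  "cond_alpha f a b n \<longleftrightarrow> n_monotone_on n {a<..<b} f"

definition cond_beta :: "(real \<Rightarrow> real) \<Rightarrow> real \<Rightarrow> real \<Rightarrow> nat \<Rightarrow> bool" where
  "cond_beta f a b n \<longleftrightarrow>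
     Limsup (at_left b) (\<lambda>t. ereal ((b - t) * f t)) < \<infinity> \<and>
     Limsup (at_left b) (\<lambda>t. ereal (f t)) > - \<infinity> \<and>
     (\<forall>ts. length ts = n \<and> set ts \<subseteq> {a<..<b} \<longrightarrow>
        cond_pos_def (loewner_mat (\<lambda>t. (b - t)\<^sup>2 * f t) ts))"

definition cond_gamma :: "(real \<Rightarrow> real) \<Rightarrow> real \<Rightarrow> real \<Rightarrow> nat \<Rightarrow> bool" where
  "cond_gamma f a b n \<longleftrightarrow>
     Liminf (at_right a) (\<lambda>t. ereal ((t - a) * f t)) \<le> 0 \<and>
     Limsup (at_left b) (\<lambda>t. ereal (f t)) > - \<infinity> \<and>
     (\<forall>ts. length ts = n \<and> set ts \<subseteq> {a<..<b} \<longrightarrow>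
        cond_neg_def (loewner_mat (\<lambda>t. (t - a) * (b - t) * f t) ts))"

definition cond_delta :: "(real \<Rightarrow> real) \<Rightarrow> real \<Rightarrow> real \<Rightarrow> nat \<Rightarrow> bool" where
  "cond_delta f a b n \<longleftrightarrow>
     Liminf (at_right a) (\<lambda>t. ereal ((t - a) * f t)) \<le> 0 \<and>
     Limsup (at_right a) (\<lambda>t. ereal ((t - a)\<^sup>2 * f t)) \<ge> 0 \<and>
     (\<forall>ts. length ts = n \<and> set ts \<subseteq> {a<..<b} \<longrightarrow>
        cond_pos_def (loewner_mat (\<lambda>t. (t - a)\<^sup>2 * f t) ts))"

lemma is_fun_calc_unique:
  assumes "is_fun_calc f A B" and "is_fun_calc f A C"
  shows "B = C"
proof -
  define n where "n = dim_row A"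
  obtain U d where U: "U \<in> carrier_mat n n" and UU: "mat_adjoint U * U = 1\<^sub>m n"
    and A1: "A = U * mat_diag n (\<lambda>i. complex_of_real (d i)) * mat_adjoint U"
    and B: "B = U * mat_diag n (\<lambda>i. complex_of_real (f (d i))) * mat_adjoint U"
    using assms(1) unfolding is_fun_calc_def n_def by blast
  obtain V e where V: "V \<in> carrier_mat n n" and VV: "mat_adjoint V * V = 1\<^sub>m n"
    and A2: "A = V * mat_diag n (\<lambda>i. complex_of_real (e i)) * mat_adjoint V"
    and C: "C = V * mat_diag n (\<lambda>i. complex_of_real (f (e i))) * mat_adjoint V"
    using assms(2) unfolding is_fun_calc_def n_def by blast
  define U' where "U' = mat_adjoint U"
  define V' where "V' = mat_adjoint V"
  define W where "W = V' * U"
  have U': "U' \<in> carrier_mat n n" and V': "V' \<in> carrier_mat n n"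
    using U V unfolding U'_def V'_def mat_adjoint_def by auto
  have W: "W \<in> carrier_mat n n" using U V' unfolding W_def by simp
  have UU1: "U' * U = 1\<^sub>m n" and VV1: "V' * V = 1\<^sub>m n" using UU VV by (simp_all add: U'_def V'_def)
  have UU2: "U * U' = 1\<^sub>m n" and VV2: "V * V' = 1\<^sub>m n"
    using mat_mult_left_right_inverse[OF U' U UU1] mat_mult_left_right_inverse[OF V' V VV1] by auto
  have dg[simp]: "mat_diag n h \<in> carrier_mat n n" for h :: "nat \<Rightarrow> complex" by simp
  have left: "V' * (U * D * U') * U = W * D" if D: "D \<in> carrier_mat n n" for D
  proof -
    have "V' * (U * D * U') * U = V' * (U * D * (U' * U))"
      using U U' V' D by (simp add: assoc_mult_mat[of _ n n _ n _ n])
    also have "\<dots> = W * D"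
      unfolding UU1 W_def using U V' D by (simp add: assoc_mult_mat[of _ n n _ n _ n])
    finally show ?thesis .
  qed
  have right: "V' * (V * D * V') * U = D * W" if D: "D \<in> carrier_mat n n" for D
  proof -
    have "V' * (V * D * V') * U = (V' * V) * D * (V' * U)"
      using U V V' D by (simp add: assoc_mult_mat[of _ n n _ n _ n])
    also have "\<dots> = D * W" unfolding VV1 W_def using D by simp
    finally show ?thesis .
  qed
  have eq: "W * mat_diag n (\<lambda>i. complex_of_real (d i)) = mat_diag n (\<lambda>i. complex_of_real (e i)) * W"
    using left[OF dg] right[OF dg] A1 A2 unfolding U'_def V'_def by metis
  have ent: "W $$ (i,j) * complex_of_real (d j) = complex_of_real (e i) * W $$ (i,j)"
    if "i < n" "j < n" for i j
    using arg_cong[OF eq, of "\<lambda>M. M $$ (i,j)"] that W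
    by (simp add: mat_diag_mult_left[of _ n n] mat_diag_mult_right[of _ n n])
  have eqf: "W * mat_diag n (\<lambda>i. complex_of_real (f (d i)))
      = mat_diag n (\<lambda>i. complex_of_real (f (e i))) * W"
  proof (rule eq_matI)
    fix i j assume "i < dim_row (mat_diag n (\<lambda>i. complex_of_real (f (e i))) * W)"
      and "j < dim_col (mat_diag n (\<lambda>i. complex_of_real (f (e i))) * W)"
    hence ij: "i < n" "j < n" using W by (auto simp: mat_diag_def)
    have "W $$ (i,j) = 0 \<or> d j = e i"
      using ent[OF ij] by (auto simp: mult.commute)
    thus "(W * mat_diag n (\<lambda>i. complex_of_real (f (d i)))) $$ (i,j) =
      (mat_diag n (\<lambda>i. complex_of_real (f (e i))) * W) $$ (i,j)"
      using ij W by (auto simp: mat_diag_mult_left[of _ n n] mat_diag_mult_right[of _ n n])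
  qed (use W in \<open>auto simp: mat_diag_def\<close>)
  have BC: "V' * B * U = V' * C * U"
    using left[OF dg] right[OF dg] eqf B C unfolding U'_def V'_def by metis
  have Bc: "B \<in> carrier_mat n n" unfolding B U'_def[symmetric]
    by (rule mult_carrier_mat[OF mult_carrier_mat[OF U dg] U'])
  have Cc: "C \<in> carrier_mat n n" unfolding C V'_def[symmetric]
    by (rule mult_carrier_mat[OF mult_carrier_mat[OF V dg] V'])
  have *: "V * (V' * X * U) * U' = X" if X: "X \<in> carrier_mat n n" for X
  proof -
    have "V * (V' * X * U) * U' = (V * V') * X * (U * U')"
      using U U' V V' X by (simp add: assoc_mult_mat[of _ n n _ n _ n])
    also have "\<dots> = X" unfolding UU2 VV2 left_mult_one_mat[OF X] by (rule right_mult_one_mat[OF X])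
    finally show ?thesis .
  qed
  show ?thesis by (rule trans[OF *[OF Bc, symmetric], unfolded BC, OF *[OF Cc]])
qed

lemma fun_calc_eqI: "is_fun_calc f A B \<Longrightarrow> fun_calc f A = B"
  unfolding fun_calc_def by (rule the_equality, assumption, rule is_fun_calc_unique)

end

theory Submission
  imports Defs
begin

text \<open>By Loewner's theorem, \<open>f\<close> is \<open>n\<close>-monotone iff its Loewner matrices of order \<open>n\<close> are positive
  semidefinite. Multiplying \<open>f\<close> by \<open>(b-t)\<^sup>2\<close> or \<open>(t-a)\<^sup>2\<close> turns the Loewner form of \<open>f\<close> into a form that
  agrees with the new Loewner form on vectors with sum zero. Hence \<open>(\<alpha>)\<^sub>n\<close> gives the matrix parts of
  \<open>(\<beta>)\<^sub>n\<close> and \<open>(\<delta>)\<^sub>n\<close>; conversely one adds a further point \<open>s\<close>, chooses its weight so that the sum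
  vanishes, and lets \<open>s\<close> tend to the end point. For \<open>(\<gamma>)\<^sub>n\<close> a further point \<open>s\<close> is moved through the
  whole interval: if \<open>L\<^sub>H\<close> is conditionally positive definite of order \<open>n+1\<close>, then
  \<open>\<Phi>(s) = \<Sum> y\<^sub>i y\<^sub>j H[t\<^sub>i,t\<^sub>j,s]\<close> has the form of \<open>L\<^sub>H\<close> at \<open>t\<^sub>1,\<dots>,t\<^sub>n,s\<close> as its derivative and so is nondecreasing.
  Comparing \<open>\<Phi>\<close> at \<open>a\<close> and at \<open>b\<close> for \<open>H = -(t-a)(b-t)f\<close> and for \<open>H = (t-a)\<^sup>2 f\<close> relates \<open>(\<alpha>)\<close> and \<open>(\<gamma>)\<close>
  in both directions. Each step costs one point only, so \<open>(\<beta>)\<close>, \<open>(\<gamma>)\<close> and \<open>(\<delta>)\<close> of order \<open>n+1\<close> all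
  imply \<open>(\<alpha>)\<^sub>n\<close>.\<close>

section \<open>Loewner kernels\<close>

text \<open>Three obstacles shape the argument. The function \<Phi> has no value at the points
  \<open>t_i\<close> that \<open>s\<close> has to cross, and since \<open>f\<close> is only of class
  C1, second derivatives of \<open>H\<close> may not exist there. The kernel inequality on two
  points makes \<open>deriv H\<close> convex, and the slope of a supporting line replaces the
  missing second derivative.

  The conditions at the end points are one-sided, and several hold only along some sequence. In
  \<Phi>(s) the value \<open>H s\<close> carries the coefficient
  \<open>(\<Sum> y_i / (t_i - s))^2\<close>, which is nonnegative, so one-sided bounds are enough;
  as \<Phi> is nondecreasing, one sequence at each end suffices. Putting 0 in place of
  \<open>H e\<close> at an end point \<open>e\<close> turns \<open>H[t,u,e]\<close> into the divided
  difference of \<open>H t / (t - e)\<close>; this is how a factor of the multiplier disappears.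

  For matrices, the eigenvectors of a perturbed matrix need not depend continuously on the
  parameter. The derivative of the functional calculus is therefore taken from an exact difference
  formula in two eigenbases.\<close>

definition C1_on :: "real set \<Rightarrow> (real \<Rightarrow> real) \<Rightarrow> bool" where
  "C1_on J f \<longleftrightarrow> (\<forall>t\<in>J. (f has_real_derivative deriv f t) (at t)) \<and> continuous_on J (deriv f)"

lemma C1_onI:
  assumes "open J" and d: "\<And>t. t \<in> J \<Longrightarrow> (f has_real_derivative f' t) (at t)" and c: "continuous_on J f'"
  shows "C1_on J f"
proof -
  have "deriv f t = f' t" if "t \<in> J" for t using DERIV_imp_deriv[OF d[OF that]] .
  then show ?thesis unfolding C1_on_def using d c by (auto cong: continuous_on_cong)
qed

lemma C1_onD: "C1_on J f \<Longrightarrow> t \<in> J \<Longrightarrow> (f has_real_derivative deriv f t) (at t)"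
  by (simp add: C1_on_def)

lemma C1_on_mult:
  assumes J: "open J" and f: "C1_on J f" and p: "\<And>t. (p has_real_derivative p' t) (at t)"
    and p': "continuous_on J p'"
  shows "C1_on J (\<lambda>t. p t * f t)"
proof (rule C1_onI[OF J])
  show "((\<lambda>t. p t * f t) has_real_derivative (p t * deriv f t + p' t * f t)) (at t)" if "t \<in> J" for t
    using DERIV_mult[OF p[of t] C1_onD[OF f that]] by (simp add: algebra_simps)
  have "continuous_on J f" using f DERIV_continuous_on[of J f "deriv f"]
    by (auto simp: C1_on_def intro: has_field_derivative_at_within)
  moreover have "continuous_on J p" using p by (meson DERIV_isCont continuous_at_imp_continuous_on)
  ultimately show "continuous_on J (\<lambda>t. p t * deriv f t + p' t * f t)"
    using f p' unfolding C1_on_def by (auto intro!: continuous_intros)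
qed

lemma C1_on_continuous: "C1_on J f \<Longrightarrow> continuous_on J f"
  by (meson C1_onD DERIV_isCont continuous_at_imp_continuous_on)

section \<open>Divided differences of first order\<close>

lemma divided_diff_commute: "divided_diff f s t = divided_diff f t s"
  unfolding divided_diff_def by (simp add: divide_simps) (simp add: algebra_simps)

lemma divided_diff_mult: "divided_diff f s t * (s - t) = f s - f t"
  by (simp add: divided_diff_def)

text \<open>The product rule \<open>(p f)[s,t] = p(s) f[s,t] + p[s,t] f(t)\<close>, where
  \<open>p[s,t] = c1 + c2 (s + t)\<close>. All multipliers used later are polynomials of degree at
  most two. Differentiability of \<open>f\<close> serves the diagonal \<open>s = t\<close>.\<close>

lemma divided_diff_mult_quadratic:
  assumes "f field_differentiable (at s)" and p: "\<And>t. p t = c0 + c1 * t + c2 * t\<^sup>2"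
  shows "divided_diff (\<lambda>t. p t * f t) s t = p s * divided_diff f s t + (c1 + c2 * (s + t)) * f t"
proof (cases "s = t")
  case True
  have d: "(f has_real_derivative deriv f s) (at s)" using assms(1) by (simp add: field_differentiable_derivI)
  have "((\<lambda>t. p t * f t) has_real_derivative p s * deriv f s + (c1 + c2 * (s + s)) * f s) (at s)"
    unfolding p by (auto intro!: derivative_eq_intros d simp: algebra_simps)
  then show ?thesis using True by (simp add: divided_diff_def DERIV_imp_deriv)
next
  case False
  then show ?thesis unfolding divided_diff_def p
    by (simp add: divide_simps) (simp add: algebra_simps power2_eq_square)
qed

lemma isCont_divided_diff:
  assumes "open J" "C1_on J f" "t \<in> J" "s \<in> J"
  shows "isCont (divided_diff f t) s"
proof (cases "s = t")
  case True
  have "(f has_real_derivative deriv f t) (at t)" using assms by (simp add: C1_on_def)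
  then have "(\<lambda>x. (f x - f t) / (x - t)) \<midarrow>t\<rightarrow> deriv f t" by (simp add: has_field_derivative_iff)
  moreover have "divided_diff f t x = (f x - f t) / (x - t)" if "x \<noteq> t" for x
    using that unfolding divided_diff_def by (simp add: divide_simps) (simp add: algebra_simps)
  ultimately have "divided_diff f t \<midarrow>t\<rightarrow> deriv f t"
    using LIM_cong[of t t "divided_diff f t" "\<lambda>x. (f x - f t) / (x - t)"] by simp
  then show ?thesis using True by (simp add: isCont_def divided_diff_def)
next
  case False
  have "isCont (\<lambda>x. (f t - f x) / (t - x)) s"
    using False DERIV_isCont[OF C1_onD[OF assms(2,4)]] by (intro continuous_intros) auto
  moreover have "\<forall>\<^sub>F x in nhds s. divided_diff f t x = (f t - f x) / (t - x)"
    using t1_space_nhds[OF False] by eventually_elim (auto simp: divided_diff_def)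
  ultimately show ?thesis using isCont_cong[of "divided_diff f t" "\<lambda>x. (f t - f x) / (t - x)" s] by blast
qed

section \<open>Quadratic forms of kernels on finite point sets\<close>

definition kform :: "(real \<Rightarrow> real \<Rightarrow> real) \<Rightarrow> real set \<Rightarrow> (real \<Rightarrow> real) \<Rightarrow> real" where
  "kform K S w = (\<Sum>s\<in>S. \<Sum>t\<in>S. w s * w t * K s t)"

text \<open>Distinct points and real weights lose nothing: weights of repeated points add up, and
  for a real symmetric kernel the real and imaginary parts of a complex vector separate. With
  \<open>card S \<le> n\<close> in place of equality the condition is visibly monotone in
  \<open>n\<close>.\<close>

definition psd_on :: "real set \<Rightarrow> nat \<Rightarrow> (real \<Rightarrow> real) \<Rightarrow> bool" where
  "psd_on J n f \<longleftrightarrow> (\<forall>S w. finite S \<and> S \<subseteq> J \<and> card S \<le> n \<longrightarrow> 0 \<le> kform (divided_diff f) S w)"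

definition cpd_on :: "real set \<Rightarrow> nat \<Rightarrow> (real \<Rightarrow> real) \<Rightarrow> bool" where
  "cpd_on J n f \<longleftrightarrow>
     (\<forall>S w. finite S \<and> S \<subseteq> J \<and> card S \<le> n \<and> sum w S = 0 \<longrightarrow> 0 \<le> kform (divided_diff f) S w)"

lemma psd_on_mono: "psd_on J n f \<Longrightarrow> m \<le> n \<Longrightarrow> psd_on J m f"
  unfolding psd_on_def by (meson order_trans)

lemma cpd_on_mono: "cpd_on J n f \<Longrightarrow> m \<le> n \<Longrightarrow> cpd_on J m f"
  unfolding cpd_on_def by (meson order_trans)

text \<open>Solving the zero-sum condition for the weight of \<open>s\<close> turns a form on
  \<open>insert s S\<close> into an unrestricted form on \<open>S\<close>. The new kernel is
  Schoenberg's normalisation of \<open>K\<close> at the base point \<open>s\<close>.\<close>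

lemma kform_insert:
  assumes S: "finite S" "s \<notin> S" and K: "\<And>t u. K t u = K u t" and X: "X s = - sum X S"
  shows "kform K (insert s S) X = (\<Sum>t\<in>S. \<Sum>u\<in>S. X t * X u * (K t u - K t s - K u s + K s s))"
proof -
  define P where "P = (\<Sum>t\<in>S. X t * K t s)"
  define Q where "Q = (\<Sum>t\<in>S. \<Sum>u\<in>S. X t * X u * K t u)"
  define r where "r = sum X S"
  have 1: "(\<Sum>t\<in>S. \<Sum>u\<in>S. X t * X u * K t s) = P * r"
    unfolding P_def r_def sum_product by (intro sum.cong refl) (simp add: mult_ac)
  have 2: "(\<Sum>t\<in>S. \<Sum>u\<in>S. X t * X u * K u s) = r * P"
    unfolding P_def r_def sum_product by (intro sum.cong refl) (simp add: mult_ac)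
  have 3: "(\<Sum>t\<in>S. \<Sum>u\<in>S. X t * X u * K s s) = r * r * K s s"
    by (simp add: r_def sum_product sum_distrib_left sum_distrib_right mult_ac)
  have "kform K (insert s S) X = X s * X s * K s s + (\<Sum>u\<in>S. X s * X u * K s u)
      + (\<Sum>t\<in>S. X t * X s * K t s + (\<Sum>u\<in>S. X t * X u * K t u))"
    unfolding kform_def using S by (simp add: sum.insert)
  also have "(\<Sum>u\<in>S. X s * X u * K s u) = X s * P"
    by (simp add: P_def sum_distrib_left K[of s] mult_ac)
  also have "(\<Sum>t\<in>S. X t * X s * K t s + (\<Sum>u\<in>S. X t * X u * K t u)) = X s * P + Q"
    by (simp add: P_def Q_def sum.distrib sum_distrib_left mult_ac)
  finally have L: "kform K (insert s S) X = r * r * K s s - 2 * r * P + Q"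
    unfolding X r_def[symmetric] by (simp add: algebra_simps)
  have "(\<Sum>t\<in>S. \<Sum>u\<in>S. X t * X u * (K t u - K t s - K u s + K s s))
     = Q - P * r - r * P + r * r * K s s"
    unfolding 1[symmetric] 2[symmetric] 3[symmetric] Q_def
    by (simp add: sum.distrib sum_subtractf algebra_simps)
  with L show ?thesis by (simp add: algebra_simps)
qed

text \<open>This is where the one extra point is spent: conditional positivity of order
  \<open>n + 1\<close> becomes positivity of order \<open>n\<close> for the kernel based at
  \<open>s\<close>. Later \<open>s\<close> is either the moving argument of \<Phi> or a point close
  to \<open>b\<close>.\<close>

lemma cpd_on_insert:
  assumes "cpd_on J (Suc n) f" "finite S" "S \<subseteq> J" "card S \<le> n" "s \<in> J" "s \<notin> S"
  shows "0 \<le> (\<Sum>t\<in>S. \<Sum>u\<in>S. X t * X u *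
      (divided_diff f t u - divided_diff f t s - divided_diff f u s + deriv f s))"
proof -
  define Y where "Y = (\<lambda>t. if t = s then - sum X S else X t)"
  have Y: "Y t = X t" if "t \<in> S" for t using that assms(6) by (auto simp: Y_def)
  have "sum Y S = sum X S" by (rule sum.cong) (auto simp: Y)
  then have Ys: "Y s = - sum Y S" by (simp add: Y_def)
  have "0 \<le> kform (divided_diff f) (insert s S) Y"
    using assms Ys unfolding cpd_on_def by (auto simp: card_insert_if)
  also have "\<dots> = (\<Sum>t\<in>S. \<Sum>u\<in>S. Y t * Y u *
      (divided_diff f t u - divided_diff f t s - divided_diff f u s + divided_diff f s s))"
    by (rule kform_insert[where K = "divided_diff f", OF assms(2,6) divided_diff_commute Ys])
  also have "\<dots> = (\<Sum>t\<in>S. \<Sum>u\<in>S. X t * X u *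
      (divided_diff f t u - divided_diff f t s - divided_diff f u s + deriv f s))"
    by (intro sum.cong) (auto simp: Y divided_diff_def)
  finally show ?thesis .
qed

text \<open>The kernel inequality on two points bounds the mean of the derivative over a subinterval by the
  mean of its values at the end points. Applied on a maximal subinterval where the derivative exceeds
  its chord, this is absurd.\<close>
lemma cpd_on_imp_convex_deriv:
  assumes C1: "C1_on {a<..<b} g" and cpd: "cpd_on {a<..<b} 2 g"
  shows "convex_on {a<..<b} (deriv g)"
proof (rule convex_onI)
  show "convex {a<..<b}" by simp
  have main: "deriv g m \<le> \<alpha> * m + \<beta>"
    if um: "u < m" and mv: "m < v" and au: "a < u" and vb: "v < b"
      and hu: "deriv g u = \<alpha> * u + \<beta>" and hv: "deriv g v = \<alpha> * v + \<beta>" for u m v \<alpha> \<beta>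
  proof (rule ccontr)
    assume "\<not> deriv g m \<le> \<alpha> * m + \<beta>"
    define k where "k = (\<lambda>x. deriv g x - (\<alpha> * x + \<beta>))"
    define h where "h = (\<lambda>x. g x - (\<alpha> * x\<^sup>2 / 2 + \<beta> * x))"
    have km: "k m > 0" and ku: "k u = 0" and kv: "k v = 0"
      using hu hv \<open>\<not> _\<close> by (auto simp: k_def)
    have ck: "continuous_on {u..v} k" unfolding k_def
      using C1 au vb by (auto simp: C1_on_def intro!: continuous_intros elim: continuous_on_subset)
    have dh: "(h has_real_derivative k x) (at x)" if "x \<in> {u..v}" for x
      unfolding h_def k_def using that au vb
      by (auto intro!: derivative_eq_intros C1_onD[OF C1])
    \<comment> \<open>The points \<open>s\<close> and \<open>t\<close> chosen below are the last one
      up to \<open>m\<close> and the first one from \<open>m\<close> on at which \<open>k\<close> is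
      nonpositive, so \<open>k\<close> is positive strictly between them.\<close>
    define L where "L = {u..m} \<inter> k -` {..0}"
    have "closed ({u..m} \<inter> k -` {..0})"
      by (rule continuous_closed_preimage) (use ck mv in \<open>auto intro: continuous_on_subset\<close>)
    then have "compact L" unfolding L_def compact_eq_bounded_closed
      by (auto intro: bounded_subset[OF bounded_closed_interval])
    moreover have "u \<in> L" using um ku by (auto simp: L_def)
    ultimately obtain s where s: "s \<in> L" "\<And>x. x \<in> L \<Longrightarrow> x \<le> s"
      using compact_attains_sup[of L] by auto
    define R where "R = {m..v} \<inter> k -` {..0}"
    have "closed ({m..v} \<inter> k -` {..0})"
      by (rule continuous_closed_preimage) (use ck um in \<open>auto intro: continuous_on_subset\<close>)
    then have "compact R" unfolding R_def compact_eq_bounded_closed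
      by (auto intro: bounded_subset[OF bounded_closed_interval])
    moreover have "v \<in> R" using mv kv by (auto simp: R_def)
    ultimately obtain t where t: "t \<in> R" "\<And>x. x \<in> R \<Longrightarrow> t \<le> x"
      using compact_attains_inf[of R] by auto
    have st: "u \<le> s" "s < m" "m < t" "t \<le> v" "k s \<le> 0" "k t \<le> 0"
      using s(1) t(1) km by (auto simp: L_def R_def less_le)
    have pos: "k x > 0" if "s < x" "x < t" for x
    proof (rule ccontr)
      assume "\<not> 0 < k x"
      with that st have "x \<in> L \<or> x \<in> R" by (auto simp: L_def R_def)
      with s(2) t(2) that show False by force
    qed
    have "h s < h t"
    proof (rule DERIV_pos_imp_increasing_open[of s t h])
      show "s < t" using st by simp
      show "\<exists>y. (h has_real_derivative y) (at x) \<and> 0 < y" if "s < x" "x < t" for x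
        using dh[of x] pos[of x] that st by auto
      have "continuous_on {u..v} h" using dh
        by (meson DERIV_isCont continuous_at_imp_continuous_on)
      then show "continuous_on {s..t} h" using st by (auto elim: continuous_on_subset)
    qed
    moreover have "2 * (h t - h s) \<le> (k s + k t) * (t - s)"
    proof -
      \<comment> \<open>On two points the weights \<open>-1\<close> and \<open>1\<close> give the
        trapezoidal bound for \<open>g\<close>. The trapezoidal rule is exact for affine functions,
        so the bound passes on to \<open>h\<close> and its derivative \<open>k\<close>.\<close>
      define w where "w = (\<lambda>x. if x = s then -1 else 1::real)"
      have "0 \<le> kform (divided_diff g) {s,t} w"
        using cpd st au vb unfolding cpd_on_def by (auto simp: w_def card_insert_if)
      also have "\<dots> = deriv g s + deriv g t - 2 * divided_diff g t s"
        using st unfolding kform_def w_def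
        by (simp add: divided_diff_commute[of g s t]) (simp add: divided_diff_def)
      finally have "2 * divided_diff g t s * (t - s) \<le> (deriv g s + deriv g t) * (t - s)"
        using st by (intro mult_right_mono) auto
      then have "2 * (g t - g s) \<le> (deriv g s + deriv g t) * (t - s)"
        using divided_diff_mult[of g t s] by simp
      then show ?thesis unfolding h_def k_def by (simp add: algebra_simps power2_eq_square)
    qed
    moreover have "(k s + k t) * (t - s) \<le> 0" using st by (simp add: mult_nonpos_nonneg)
    ultimately show False by simp
  qed
  fix t x y :: real
  assume t: "0 < t" "t < 1" and x: "x \<in> {a<..<b}" and y: "y \<in> {a<..<b}"
  define \<alpha> where "\<alpha> = (deriv g y - deriv g x) / (y - x)"
  have key: "deriv g ((1 - t) * x + t * y) \<le> (1 - t) * deriv g x + t * deriv g y"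
    if "x \<noteq> y"
  proof -
    define \<beta> where "\<beta> = deriv g x - \<alpha> * x"
    define m where "m = (1 - t) * x + t * y"
    have 1: "deriv g x = \<alpha> * x + \<beta>" by (simp add: \<beta>_def)
    have "\<alpha> * (y - x) = deriv g y - deriv g x" using that by (simp add: \<alpha>_def)
    then have 2: "deriv g y = \<alpha> * y + \<beta>" by (simp add: \<beta>_def algebra_simps)
    have e: "m - x = t * (y - x)" "y - m = (1 - t) * (y - x)" by (simp_all add: m_def algebra_simps)
    have "x < m \<and> m < y \<or> y < m \<and> m < x"
    proof (cases "x < y")
      case True
      then have "0 < m - x" "0 < y - m" unfolding e using t by (auto intro!: mult_pos_pos)
      then show ?thesis by simp
    next
      case False
      then have "m - x < 0" "y - m < 0" unfolding e using t that by (auto intro!: mult_pos_neg)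
      then show ?thesis by simp
    qed
    then have "deriv g m \<le> \<alpha> * m + \<beta>" using main[OF _ _ _ _ 1 2] main[OF _ _ _ _ 2 1] x y by auto
    also have "\<dots> = (1 - t) * (\<alpha> * x + \<beta>) + t * (\<alpha> * y + \<beta>)" by (simp add: m_def algebra_simps)
    finally show ?thesis unfolding 1 2 m_def .
  qed
  show "deriv g ((1 - t) *\<^sub>R x + t *\<^sub>R y) \<le> (1 - t) * deriv g x + t * deriv g y"
    using key by (cases "x = y") (auto simp: algebra_simps)
qed

section \<open>Second order divided differences\<close>

text \<open>\<open>phi_term H t u s\<close> is the divided difference \<open>H[t,u,s]\<close> of second order, written so that its
  dependence on \<open>s\<close> is explicit; \<open>s\<close> has to differ from \<open>t\<close> and \<open>u\<close>.\<close>
definition phi_term :: "(real \<Rightarrow> real) \<Rightarrow> real \<Rightarrow> real \<Rightarrow> real \<Rightarrow> real" where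
  "phi_term H t u s = (H s - H t) / ((t - s) * (u - s)) + divided_diff H t u / (u - s)"

definition phi :: "(real \<Rightarrow> real) \<Rightarrow> real set \<Rightarrow> (real \<Rightarrow> real) \<Rightarrow> real \<Rightarrow> real" where
  "phi H S y s = (\<Sum>t\<in>S. \<Sum>u\<in>S. y t * y u * phi_term H t u s)"

lemma phi_term_eq:
  assumes "t \<noteq> s"
  shows "phi_term H t u s = (divided_diff H t u - divided_diff H t s) / (u - s)"
proof -
  have "divided_diff H t s = - ((H s - H t) / (t - s))"
    using assms by (simp add: divided_diff_def minus_divide_left)
  then show ?thesis unfolding phi_term_def by (simp add: add_divide_distrib)
qed

lemma phi_term_commute:
  assumes "t \<noteq> s" "u \<noteq> s"
  shows "phi_term H t u s = phi_term H u t s"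
proof -
  have *: "(u - s) * ((t - s) * phi_term H t u s) = H s - H t + divided_diff H t u * (t - s)"
    if "t \<noteq> s" "u \<noteq> s" for t u
    using that unfolding phi_term_def by (simp add: distrib_left)
  have "H s - H t + divided_diff H t u * (t - s) = H s - H u + divided_diff H u t * (u - s)"
    using divided_diff_mult[of H t u] divided_diff_commute[of H t u] by (simp add: algebra_simps)
  then have "(u - s) * ((t - s) * phi_term H t u s) = (t - s) * ((u - s) * phi_term H u t s)"
    using * assms by metis
  then show ?thesis using assms by simp
qed

lemma phi_eq:
  "phi H S y s = H s * (\<Sum>t\<in>S. y t / (t - s))\<^sup>2 - (\<Sum>t\<in>S. y t / (t - s)) * (\<Sum>t\<in>S. y t * H t / (t - s))
     + (\<Sum>t\<in>S. \<Sum>u\<in>S. y t * y u * divided_diff H t u / (u - s))"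
proof -
  have 1: "H s * (\<Sum>t\<in>S. y t / (t - s))\<^sup>2 = (\<Sum>t\<in>S. \<Sum>u\<in>S. H s * ((y t / (t - s)) * (y u / (u - s))))"
    by (simp only: power2_eq_square sum_product) (simp only: sum_distrib_left)
  have 2: "(\<Sum>t\<in>S. y t / (t - s)) * (\<Sum>t\<in>S. y t * H t / (t - s))
     = (\<Sum>t\<in>S. \<Sum>u\<in>S. (y t * H t / (t - s)) * (y u / (u - s)))"
    by (subst mult.commute, subst sum_product) (rule refl)
  show ?thesis unfolding 1 2 phi_def sum.distrib[symmetric] sum_subtractf[symmetric]
    by (intro sum.cong refl) (simp add: phi_term_def diff_divide_distrib algebra_simps)
qed

text \<open>Differentiating \<open>H[t,u,s]\<close> in \<open>s\<close> doubles the argument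
  \<open>s\<close>, and \<open>H[t,u,s,s]\<close> is \<open>1 / ((t - s) (u - s))\<close> times the
  kernel of \<open>H\<close> normalised at \<open>s\<close>. So the derivative is the form treated
  by \<open>cpd_on_insert\<close>, with the weights \<open>y t / (t - s)\<close>.\<close>

lemma phi_has_derivative:
  assumes H: "(H has_real_derivative deriv H s) (at s)" and s: "s \<notin> S" and S: "finite S"
  shows "(phi H S y has_real_derivative
     (\<Sum>t\<in>S. \<Sum>u\<in>S. (y t / (t - s)) * (y u / (u - s)) *
       (divided_diff H t u - divided_diff H t s - divided_diff H u s + deriv H s))) (at s)"
proof -
  have T: "(phi_term H t u has_real_derivative
      1 / ((t - s) * (u - s)) * (divided_diff H t u - divided_diff H t s - divided_diff H u s + deriv H s)) (at s)"
    if "t \<in> S" "u \<in> S" for t u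
  proof -
    define p q where "p = t - s" and "q = u - s"
    have p: "p \<noteq> 0" and q: "q \<noteq> 0" using that s by (auto simp: p_def q_def)
    have D: "(phi_term H t u has_real_derivative
       (deriv H s * (p * q) - (H s - H t) * (- q - p)) / ((p * q) * (p * q)) + divided_diff H t u / (q * q)) (at s)"
      unfolding phi_term_def
      using p q
      by (auto intro!: derivative_eq_intros H simp: p_def q_def)
    define M where "M = divided_diff H t u"
    have pq: "M * (p - q) = H t - H u" using divided_diff_mult[of H t u] by (simp add: p_def q_def M_def)
    have a: "divided_diff H t s = (H t - H s) / p" "divided_diff H u s = (H u - H s) / q"
      using p q by (auto simp: divided_diff_def p_def q_def)
    \<comment> \<open>Expressing \<open>H u\<close> through the divided difference \<open>M\<close>
      leaves a rational identity in independent quantities, which also covers the case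
      \<open>t = u\<close>.\<close>
    have Hu: "H u = H t - M * (p - q)" using pq by simp
    have "(deriv H s * (p * q) - (H s - H t) * (- q - p)) / ((p * q) * (p * q)) + M / (q * q)
      = 1 / (p * q) * (M - (H t - H s) / p - (H u - H s) / q + deriv H s)"
      unfolding Hu using p q by (simp add: divide_simps) (simp add: algebra_simps)
    with D show ?thesis unfolding a M_def p_def q_def by simp
  qed
  have "((\<lambda>s. phi H S y s) has_real_derivative (\<Sum>t\<in>S. \<Sum>u\<in>S. y t * y u * (1 / ((t - s) * (u - s)) *
       (divided_diff H t u - divided_diff H t s - divided_diff H u s + deriv H s)))) (at s)"
    unfolding phi_def by (intro DERIV_sum DERIV_cmult T)
  then show ?thesis by (simp add: mult.assoc)
qed

lemma phi_mono_interval: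
  assumes "C1_on {a<..<b} H" "cpd_on {a<..<b} (Suc n) H" "finite S" "S \<subseteq> {a<..<b}" "card S \<le> n"
    and "r \<le> R" "a < r" "R < b" "S \<inter> {r..R} = {}"
  shows "phi H S y r \<le> phi H S y R"
proof (rule DERIV_nonneg_imp_nondecreasing[of r R "phi H S y"])
  show "r \<le> R" by fact
next
  fix s assume s: "r \<le> s" "s \<le> R"
  then have sS: "s \<in> {a<..<b}" "s \<notin> S" using assms by auto
  show "\<exists>d. (phi H S y has_real_derivative d) (at s) \<and> 0 \<le> d"
    by (rule exI, rule conjI, rule phi_has_derivative[OF C1_onD[OF assms(1) sS(1)] sS(2) assms(3), of y],
        rule cpd_on_insert[OF assms(2-5) sS, of "\<lambda>t. y t / (t - s)"])
qed

text \<open>Subtracting from \<open>H\<close> the linear and quadratic terms built from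
  \<open>deriv H k\<close> and the supporting slope \<open>m\<close> leaves a nondecreasing
  \<open>g\<close>, and \<open>H[k,k,s] = m / 2 + (g s - g k) / (k - s)^2\<close>. Thus
  \<open>m / 2\<close> separates the values left and right of \<open>k\<close>, in the role of half
  a second derivative.\<close>

lemma taylor_deriv_slope:
  fixes H :: "real \<Rightarrow> real"
  assumes C1: "C1_on {a<..<b} H" and k: "k \<in> {a<..<b}"
    and m: "\<And>x. x \<in> {a<..<b} \<Longrightarrow> deriv H k + m * (x - k) \<le> deriv H x"
    and s: "s \<in> {a<..<b}"
  shows "s < k \<Longrightarrow> phi_term H k k s \<le> m / 2" and "k < s \<Longrightarrow> m / 2 \<le> phi_term H k k s"
proof -
  define g where "g = (\<lambda>x. H x - deriv H k * (x - k) - m * (x - k)\<^sup>2 / 2)"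
  have d: "\<exists>d. (g has_real_derivative d) (at x) \<and> 0 \<le> d" if "x \<in> {a<..<b}" for x
  proof (intro exI conjI)
    show "(g has_real_derivative (deriv H x - deriv H k - m * (x - k))) (at x)"
      unfolding g_def by (auto intro!: derivative_eq_intros C1_onD[OF C1 that])
    show "0 \<le> deriv H x - deriv H k - m * (x - k)" using m[OF that] by simp
  qed
  have gk: "g k = H k" by (simp add: g_def)
  have e: "phi_term H k k s = m / 2 + (g s - g k) / (k - s)\<^sup>2" if "s \<noteq> k"
  proof -
    define p where "p = k - s"
    have "p \<noteq> 0" using that by (simp add: p_def)
    moreover have "g s = H s + deriv H k * p - m * p\<^sup>2 / 2"
      by (simp add: g_def p_def power2_commute algebra_simps)
    ultimately show ?thesis unfolding phi_term_def gk p_def[symmetric]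
      by (simp add: divided_diff_def power2_eq_square field_simps)
  qed
  show "phi_term H k k s \<le> m / 2" if "s < k"
  proof -
    have "g s \<le> g k"
      by (rule DERIV_nonneg_imp_nondecreasing[of s k g]) (use that d s k in auto)
    then show ?thesis using e that by (simp add: divide_nonpos_nonneg)
  qed
  show "m / 2 \<le> phi_term H k k s" if "k < s"
  proof -
    have "g k \<le> g s"
      by (rule DERIV_nonneg_imp_nondecreasing[of k s g]) (use that d s k in auto)
    then show ?thesis using e that by simp
  qed
qed

text \<open>At a point of \<open>S\<close> the function \<open>phi\<close> may jump, but only upwards: the sole discontinuous
  summand is the second order difference quotient of \<open>H\<close> at that point, and \<open>deriv H\<close> is convex.\<close>
lemma phi_jump:
  assumes C1: "C1_on {a<..<b} H" and cpd: "cpd_on {a<..<b} 2 H"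
    and S: "finite S" "S \<subseteq> {a<..<b}" and k: "k \<in> S"
  obtains c where "\<And>e. e > 0 \<Longrightarrow> \<exists>d>0. \<forall>s. \<bar>s - k\<bar> < d \<and> s \<noteq> k \<longrightarrow>
     s \<in> {a<..<b} \<and> s \<notin> S \<and> (s < k \<longrightarrow> phi H S y s \<le> c + e) \<and> (k < s \<longrightarrow> c - e \<le> phi H S y s)"
proof -
  have kJ: "k \<in> {a<..<b}" using k S by auto
  have cv: "convex_on {a<..<b} (deriv H)" by (rule cpd_on_imp_convex_deriv[OF C1 cpd])
  obtain m where m: "\<And>x. x \<in> {a<..<b} \<Longrightarrow> deriv H k + m * (x - k) \<le> deriv H x"
    using convex_le_Inf_differential[OF cv, of k] kJ unfolding interior_greaterThanLessThan_real by blast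
  \<comment> \<open>This is \<open>phi_term\<close> written with a denominator that does not vanish
    at \<open>s = k\<close>, hence continuous there. Only the pair \<open>(k, k)\<close> admits no
    such form; it is set to 0 here and treated separately.\<close>
  define g where "g = (\<lambda>t u s. if u \<noteq> k then (divided_diff H t u - divided_diff H t s) / (u - s)
     else if t \<noteq> k then (divided_diff H u t - divided_diff H u s) / (t - s) else 0)"
  define G where "G = (\<lambda>s. \<Sum>t\<in>S. \<Sum>u\<in>S. y t * y u * g t u s)"
  have "isCont (g t u) k" if "t \<in> S" "u \<in> S" for t u
  proof -
    have 1: "isCont (divided_diff H v) k" if "v \<in> S" for v
      by (rule isCont_divided_diff[OF _ C1]) (use that S kJ in auto)
    consider "u \<noteq> k" | "u = k" "t \<noteq> k" | "u = k" "t = k" by blast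
    then show ?thesis
      by cases (use 1 that in \<open>auto simp: g_def intro!: continuous_intros\<close>)
  qed
  then have cG: "isCont G k" unfolding G_def by (intro continuous_intros) auto
  have phiG: "phi H S y s = G s + (y k)\<^sup>2 * phi_term H k k s" if "s \<notin> S" for s
  proof -
    have "phi H S y s = (\<Sum>t\<in>S. \<Sum>u\<in>S. y t * y u * g t u s
        + (if t = k then if u = k then (y k)\<^sup>2 * phi_term H k k s else 0 else 0))"
      unfolding phi_def
    proof (intro sum.cong refl)
      fix t u assume tu: "t \<in> S" "u \<in> S"
      then have "t \<noteq> s" "u \<noteq> s" using that by auto
      then show "y t * y u * phi_term H t u s = y t * y u * g t u s
        + (if t = k then if u = k then (y k)\<^sup>2 * phi_term H k k s else 0 else 0)"
        using phi_term_eq[of t s H u] phi_term_eq[of k s H t] phi_term_commute[of t s k H]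
        by (cases "u = k"; cases "t = k") (simp_all add: g_def power2_eq_square del: times_divide_eq_right)
    qed
    also have "\<dots> = G s + (y k)\<^sup>2 * phi_term H k k s"
    proof -
      have "(\<Sum>u\<in>S. if t = k then if u = k then X else 0 else 0) = (if t = k then X else 0)" for t and X :: real
        using S(1) k by (cases "t = k") simp_all
      then show ?thesis unfolding sum.distrib G_def using S(1) k by simp
    qed
    finally show ?thesis .
  qed
  \<comment> \<open>The separating value: the continuous part at \<open>k\<close> plus the bound
    \<open>m / 2\<close> for the singular summand, which holds from above on the left and from below
    on the right.\<close>
  define c where "c = G k + (y k)\<^sup>2 * (m / 2)"
  show thesis
  proof (rule that[of c])
    fix e :: real assume e: "e > 0"
    have "\<forall>\<^sub>F s in at k. \<bar>G s - G k\<bar> < e"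
      using cG e unfolding isCont_def tendsto_iff dist_real_def by blast
    moreover have "\<forall>\<^sub>F s in at k. s \<in> {a<..<b}"
      using kJ by (intro eventually_at_in_open') auto
    moreover have "\<forall>\<^sub>F s in at k. s \<notin> S"
    proof -
      have "open (- (S - {k}))" using S(1) by (intro open_Compl finite_imp_closed) auto
      then have "\<forall>\<^sub>F s in at k. s \<in> - (S - {k}) - {k}" by (intro eventually_at_in_open) auto
      then show ?thesis by eventually_elim auto
    qed
    ultimately have "\<forall>\<^sub>F s in at k. s \<in> {a<..<b} \<and> s \<notin> S \<and>
        (s < k \<longrightarrow> phi H S y s \<le> c + e) \<and> (k < s \<longrightarrow> c - e \<le> phi H S y s)"
    proof eventually_elim
      case (elim s)
      have "(y k)\<^sup>2 * phi_term H k k s \<le> (y k)\<^sup>2 * (m / 2)" if "s < k"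
        by (rule mult_left_mono) (use taylor_deriv_slope(1)[OF C1 kJ m elim(2) that] in auto)
      moreover have "(y k)\<^sup>2 * (m / 2) \<le> (y k)\<^sup>2 * phi_term H k k s" if "k < s"
        by (rule mult_left_mono) (use taylor_deriv_slope(2)[OF C1 kJ m elim(2) that] in auto)
      ultimately show ?case using elim phiG[of s] unfolding c_def by auto
    qed
    then show "\<exists>d>0. \<forall>s. \<bar>s - k\<bar> < d \<and> s \<noteq> k \<longrightarrow>
      s \<in> {a<..<b} \<and> s \<notin> S \<and> (s < k \<longrightarrow> phi H S y s \<le> c + e) \<and> (k < s \<longrightarrow> c - e \<le> phi H S y s)"
      unfolding eventually_at dist_real_def by auto
  qed
qed

text \<open>Induction on the number of points of \<open>S\<close> between \<open>r\<close> and
  \<open>R\<close>. At such a point \<open>k\<close> the interval is cut: the induction hypothesis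
  applies up to some \<open>p < k\<close> and from some \<open>q > k\<close>, both close to
  \<open>k\<close>, and the separating value from \<open>phi_jump\<close> bridges the gap up to an
  arbitrary error.\<close>

lemma phi_mono:
  assumes C1: "C1_on {a<..<b} H" and cpd: "cpd_on {a<..<b} (Suc n) H" and n: "n \<ge> 1"
    and S: "finite S" "S \<subseteq> {a<..<b}" "card S \<le> n"
    and "r \<le> R" "a < r" "R < b" "r \<notin> S" "R \<notin> S"
  shows "phi H S y r \<le> phi H S y R"
  using assms(7-)
proof (induction "card (S \<inter> {r..R})" arbitrary: r R rule: less_induct)
  case less
  show ?case
  proof (cases "S \<inter> {r..R} = {}")
    case True
    then show ?thesis using phi_mono_interval[OF C1 cpd S] less.prems by auto
  next
    case False
    then obtain k where k: "k \<in> S" "r < k" "k < R" using less.prems by fastforce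
    have cpd2: "cpd_on {a<..<b} 2 H" using cpd_on_mono[OF cpd] n by simp
    obtain c where c: "\<And>e. e > 0 \<Longrightarrow> \<exists>d>0. \<forall>s. \<bar>s - k\<bar> < d \<and> s \<noteq> k \<longrightarrow>
       s \<in> {a<..<b} \<and> s \<notin> S \<and> (s < k \<longrightarrow> phi H S y s \<le> c + e) \<and> (k < s \<longrightarrow> c - e \<le> phi H S y s)"
      using phi_jump[OF C1 cpd2 S(1,2) k(1)] by metis
    have "phi H S y r \<le> c + e \<and> c - e \<le> phi H S y R" if e: "e > 0" for e
    proof -
      obtain d where d: "d > 0" "\<And>s. \<bar>s - k\<bar> < d \<Longrightarrow> s \<noteq> k \<Longrightarrow> s \<in> {a<..<b} \<and> s \<notin> S \<and>
          (s < k \<longrightarrow> phi H S y s \<le> c + e) \<and> (k < s \<longrightarrow> c - e \<le> phi H S y s)"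
        using c[OF e] by blast
      define p where "p = max ((r + k) / 2) (k - d / 2)"
      define q where "q = min ((R + k) / 2) (k + d / 2)"
      have p: "r \<le> p" "p < k" "\<bar>p - k\<bar> < d" and q: "q \<le> R" "k < q" "\<bar>q - k\<bar> < d"
        using k(2,3) d(1) unfolding p_def q_def by (simp_all add: max_def min_def abs_if field_simps)
      have "phi H S y r \<le> phi H S y p"
      proof (rule less.hyps)
        have "k \<in> S \<inter> {r..R}" "k \<notin> S \<inter> {r..p}" "S \<inter> {r..p} \<subseteq> S \<inter> {r..R}" using k p by auto
        then show "card (S \<inter> {r..p}) < card (S \<inter> {r..R})"
          using S(1) by (intro psubset_card_mono) auto
      qed (use p d(2)[of p] less.prems in auto)
      moreover have "phi H S y q \<le> phi H S y R"
      proof (rule less.hyps)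
        have "k \<in> S \<inter> {r..R}" "k \<notin> S \<inter> {q..R}" "S \<inter> {q..R} \<subseteq> S \<inter> {r..R}" using k q by auto
        then show "card (S \<inter> {q..R}) < card (S \<inter> {r..R})"
          using S(1) by (intro psubset_card_mono) auto
      qed (use q d(2)[of q] less.prems in auto)
      ultimately show ?thesis using d(2)[of p] d(2)[of q] p q by force
    qed
    note * = this
    have "phi H S y r \<le> c" by (rule field_le_epsilon) (use * in blast)
    moreover have "c \<le> phi H S y R" by (rule field_le_epsilon) (use * in \<open>force simp: algebra_simps\<close>)
    ultimately show ?thesis by simp
  qed
qed

section \<open>Behaviour at the end points\<close>

lemma frequently_at_left_iff:
  "(\<exists>\<^sub>F s in at_left b. P s) \<longleftrightarrow> (\<forall>m<b. \<exists>s>m. s < b \<and> P s)" for b :: real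
  unfolding frequently_def eventually_at_left_field by blast

text \<open>The part of \<open>phi\<close> that extends continuously to the end points of the interval, where \<open>H\<close> itself may
  be undefined or unbounded.\<close>
definition phi0 :: "(real \<Rightarrow> real) \<Rightarrow> real set \<Rightarrow> (real \<Rightarrow> real) \<Rightarrow> real \<Rightarrow> real" where
  "phi0 H S y s = (\<Sum>t\<in>S. \<Sum>u\<in>S. y t * y u * (divided_diff H t u / (u - s) - H t / ((t - s) * (u - s))))"

text \<open>The value \<open>H s\<close> enters through a nonnegative factor only. So near an end
  point a one-sided estimate of \<open>H s\<close> is all that a comparison of \<Phi>
  requires.\<close>

lemma phi_eq_phi0: "phi H S y s = H s * (\<Sum>t\<in>S. y t / (t - s))\<^sup>2 + phi0 H S y s"
proof -
  have 1: "(\<Sum>t\<in>S. y t / (t - s)) * (\<Sum>t\<in>S. y t * H t / (t - s))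
     = (\<Sum>t\<in>S. \<Sum>u\<in>S. (y t * H t / (t - s)) * (y u / (u - s)))"
    by (subst mult.commute, subst sum_product) (rule refl)
  have "(\<Sum>t\<in>S. \<Sum>u\<in>S. y t * y u * divided_diff H t u / (u - s))
      - (\<Sum>t\<in>S. y t / (t - s)) * (\<Sum>t\<in>S. y t * H t / (t - s)) = phi0 H S y s"
    unfolding 1 phi0_def sum_subtractf[symmetric]
    by (intro sum.cong refl) (simp add: algebra_simps)
  then show ?thesis using phi_eq[of H S y s] by simp
qed

lemma tendsto_phi0:
  assumes "finite S" "e \<notin> S"
  shows "(phi0 H S y \<longlongrightarrow> phi0 H S y e) (at e within A)"
proof -
  have "continuous (at e within A) (phi0 H S y)"
    unfolding phi0_def using assms by (intro continuous_intros) auto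
  then show ?thesis by (simp add: continuous_within)
qed

text \<open>Frequent bounds are enough because \<open>phi\<close> is compared at just one point
  \<open>r\<close> near \<open>a\<close> and one point \<open>R\<close> near \<open>b\<close>. Since
  \<open>phi r \<le> phi R\<close>, the singular term has to be bounded from below at
  \<open>a\<close> and from above at \<open>b\<close>.\<close>

lemma phi0_le:
  assumes C1: "C1_on {a<..<b} H" and cpd: "cpd_on {a<..<b} (Suc n) H" and n: "n \<ge> 1"
    and S: "finite S" "S \<subseteq> {a<..<b}" "card S \<le> n" and ab: "a < b"
    and fa: "\<And>e. e > 0 \<Longrightarrow> \<exists>\<^sub>F s in at_right a. - e < H s * (\<Sum>t\<in>S. y t / (t - s))\<^sup>2"
    and fb: "\<And>e. e > 0 \<Longrightarrow> \<exists>\<^sub>F s in at_left b. H s * (\<Sum>t\<in>S. y t / (t - s))\<^sup>2 < e"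
  shows "phi0 H S y a \<le> phi0 H S y b"
proof (rule field_le_epsilon)
  fix e :: real assume "e > 0"
  then have e: "e / 4 > 0" by simp
  have aS: "a \<notin> S" and bS: "b \<notin> S" using S by auto
  have nS: "\<forall>\<^sub>F s in at x. s \<notin> S" for x
  proof -
    have "open (- (S - {x}))" using S(1) by (intro open_Compl finite_imp_closed) auto
    then have "\<forall>\<^sub>F s in at x. s \<in> - (S - {x}) - {x}" by (intro eventually_at_in_open) auto
    then show ?thesis by eventually_elim auto
  qed
  have nS': "\<forall>\<^sub>F s in at x within A. s \<notin> S" for x A
    using nS[of x] filter_leD[OF at_le[of A UNIV]] by blast
  have "\<forall>\<^sub>F s in at_right a. a < s \<and> s < (a + b) / 2"
    using ab by (intro eventually_at_rightI[of a "(a + b) / 2"]) auto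
  moreover have "\<forall>\<^sub>F s in at_right a. \<bar>phi0 H S y s - phi0 H S y a\<bar> < e / 4"
    using tendsto_phi0[OF S(1) aS, of H y "{a<..}"] e unfolding tendsto_iff dist_real_def by blast
  ultimately have "\<forall>\<^sub>F s in at_right a. s \<notin> S \<and> a < s \<and> s < (a + b) / 2 \<and>
      \<bar>phi0 H S y s - phi0 H S y a\<bar> < e / 4"
    using nS'[of a "{a<..}"] by eventually_elim blast
  from frequently_eventually_frequently[OF fa[OF e] this]
  obtain r where r: "r \<notin> S" "a < r" "r < (a + b) / 2" "\<bar>phi0 H S y r - phi0 H S y a\<bar> < e / 4"
     "- (e / 4) < H r * (\<Sum>t\<in>S. y t / (t - r))\<^sup>2"
    by (auto dest: frequently_ex)
  have "\<forall>\<^sub>F s in at_left b. (a + b) / 2 < s \<and> s < b"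
    using ab by (intro eventually_at_leftI[of "(a + b) / 2" b]) auto
  moreover have "\<forall>\<^sub>F s in at_left b. \<bar>phi0 H S y s - phi0 H S y b\<bar> < e / 4"
    using tendsto_phi0[OF S(1) bS, of H y "{..<b}"] e unfolding tendsto_iff dist_real_def by blast
  ultimately have "\<forall>\<^sub>F s in at_left b. s \<notin> S \<and> (a + b) / 2 < s \<and> s < b \<and>
      \<bar>phi0 H S y s - phi0 H S y b\<bar> < e / 4"
    using nS'[of b "{..<b}"] by eventually_elim blast
  from frequently_eventually_frequently[OF fb[OF e] this]
  obtain R where R: "R \<notin> S" "(a + b) / 2 < R" "R < b" "\<bar>phi0 H S y R - phi0 H S y b\<bar> < e / 4"
     "H R * (\<Sum>t\<in>S. y t / (t - R))\<^sup>2 < e / 4"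
    by (auto dest: frequently_ex)
  have "phi H S y r \<le> phi H S y R"
    by (rule phi_mono[OF C1 cpd n S]) (use r R in auto)
  then show "phi0 H S y a \<le> phi0 H S y b + e"
    unfolding phi_eq_phi0 using r(4,5) R(4,5) by linarith
qed

section \<open>From the mixed multiplier back to the function itself\<close>

lemma C1_on_imp_differentiable: "C1_on J f \<Longrightarrow> t \<in> J \<Longrightarrow> f field_differentiable (at t)"
  by (meson C1_onD field_differentiable_def)

lemma divided_diff_minus:
  assumes "C1_on J g" "s \<in> J"
  shows "divided_diff (\<lambda>t. - g t) s t = - divided_diff g s t"
  using DERIV_imp_deriv[OF DERIV_minus[OF C1_onD[OF assms]]]
  by (auto simp: divided_diff_def minus_divide_left)

lemma tendsto_weight_sum:
  assumes "finite S" "e \<notin> S"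
  shows "((\<lambda>s. \<Sum>t\<in>S. y t / (t - s :: real)) \<longlongrightarrow> (\<Sum>t\<in>S. y t / (t - e))) (at e within A)"
  using assms by (intro tendsto_intros) auto

text \<open>Evaluated at the two end points, \<open>phi0\<close> for \<open>H t = -(t-a)(b-t) f t\<close> is the form of \<open>-(b-t) f t\<close>
  and of \<open>(t-a) f t\<close> respectively; these differ by \<open>b - a\<close> times the form of \<open>f\<close>.\<close>
lemma psd_on_from_mixed:
  assumes ab: "a < b" and C1: "C1_on {a<..<b} f" and n: "n \<ge> 1"
    and cpd: "cpd_on {a<..<b} (Suc n) (\<lambda>t. - ((t - a) * (b - t) * f t))"
    and fa: "\<And>e. e > 0 \<Longrightarrow> \<exists>\<^sub>F t in at_right a. (t - a) * f t < e"
    and fb: "\<exists>M. \<exists>\<^sub>F t in at_left b. M < f t"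
  shows "psd_on {a<..<b} n f"
  unfolding psd_on_def
proof (intro allI impI, elim conjE)
  fix S w assume S: "finite S" "S \<subseteq> {a<..<b}" "card S \<le> n"
  define H where "H = (\<lambda>t. - ((t - a) * (b - t) * f t))"
  define p where "p = (\<lambda>t. (t - a) * (t - b))"
  have Hp: "H = (\<lambda>t. p t * f t)" by (auto simp: H_def p_def algebra_simps)
  have p: "p t = a * b + (- (a + b)) * t + 1 * t\<^sup>2" for t
    by (simp add: p_def algebra_simps power2_eq_square)
  have C1H: "C1_on {a<..<b} H" unfolding Hp
  proof (rule C1_on_mult[OF _ C1])
    show "(p has_real_derivative (t - a) + (t - b)) (at t)" for t
      unfolding p_def by (auto intro!: derivative_eq_intros)
  qed (auto intro!: continuous_intros)
  have aS: "a \<notin> S" and bS: "b \<notin> S" using S by auto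
  let ?A = "\<lambda>s. (\<Sum>t\<in>S. w t / (t - s))\<^sup>2"
  have "phi0 H S w a \<le> phi0 H S w b"
  proof (rule phi0_le[OF C1H _ n S ab])
    show "cpd_on {a<..<b} (Suc n) H" using cpd by (simp add: H_def)
    fix e :: real assume e: "e > 0"
    have "((\<lambda>s. (b - s) * ?A s) \<longlongrightarrow> (b - a) * ?A a) (at_right a)"
      by (intro tendsto_intros tendsto_weight_sum S aS)
    then have "\<forall>\<^sub>F s in at_right a. (b - s) * ?A s < (b - a) * ?A a + 1"
      by (rule order_tendstoD) simp
    moreover have "\<forall>\<^sub>F s in at_right a. a < s \<and> s < b"
      using ab by (intro eventually_at_rightI[of a b]) auto
    ultimately have ev: "\<forall>\<^sub>F s in at_right a. 0 \<le> (b - s) * ?A s \<and> (b - s) * ?A s < (b - a) * ?A a + 1"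
      by eventually_elim auto
    \<comment> \<open>A bound near \<open>a\<close> for the factor that multiplies
      \<open>(s - a) * f s\<close> in \<open>- H s * ?A s\<close>; adding 1 makes it positive, so
      that \<open>e / K\<close> is an admissible tolerance.\<close>
    define K where "K = (b - a) * ?A a + 1"
    have K: "K > 0" unfolding K_def using ab by (intro add_nonneg_pos) auto
    then have eK: "e / K > 0" using e by simp
    from frequently_eventually_frequently[OF fa[OF eK] ev]
    show "\<exists>\<^sub>F s in at_right a. - e < H s * ?A s"
    proof (rule frequently_elim1)
      fix s assume s: "(s - a) * f s < e / K \<and> 0 \<le> (b - s) * ?A s \<and> (b - s) * ?A s < (b - a) * ?A a + 1"
      have "((s - a) * f s) * ((b - s) * ?A s) < e"
      proof (cases "(s - a) * f s \<le> 0")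
        case True
        then show ?thesis using s e by (meson mult_nonpos_nonneg order_le_less_trans)
      next
        case False
        then have "((s - a) * f s) * ((b - s) * ?A s) \<le> (s - a) * f s * K"
          using s by (intro mult_left_mono) (auto simp: K_def)
        also have "\<dots> < e" using s K by (simp add: pos_less_divide_eq)
        finally show ?thesis .
      qed
      then show "- e < H s * ?A s" by (simp add: H_def algebra_simps)
    qed
  next
    fix e :: real assume e: "e > 0"
    \<comment> \<open>At \<open>b\<close> the factor \<open>(s - a) * (b - s) * ?A s\<close> tends
      to 0, so a lower bound for \<open>f\<close> along one sequence is sufficient.\<close>
    obtain M where M: "\<exists>\<^sub>F t in at_left b. M < f t" using fb by blast
    have "((\<lambda>s. - M * ((s - a) * (b - s) * ?A s)) \<longlongrightarrow> - M * ((b - a) * (b - b) * ?A b)) (at_left b)"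
      by (intro tendsto_intros tendsto_weight_sum S bS)
    then have "\<forall>\<^sub>F s in at_left b. - M * ((s - a) * (b - s) * ?A s) < e"
      by (rule order_tendstoD) (use e in simp)
    moreover have "\<forall>\<^sub>F s in at_left b. a < s \<and> s < b"
      using ab by (intro eventually_at_leftI[of a b]) auto
    ultimately have "\<forall>\<^sub>F s in at_left b. - M * ((s - a) * (b - s) * ?A s) < e \<and> a < s \<and> s < b"
      by eventually_elim auto
    from frequently_eventually_frequently[OF M this]
    show "\<exists>\<^sub>F s in at_left b. H s * ?A s < e"
    proof (rule frequently_elim1)
      fix s assume s: "M < f s \<and> - M * ((s - a) * (b - s) * ?A s) < e \<and> a < s \<and> s < b"
      have "M * ((s - a) * (b - s) * ?A s) \<le> f s * ((s - a) * (b - s) * ?A s)"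
        using s by (intro mult_right_mono) auto
      then show "H s * ?A s < e" using s by (simp add: H_def algebra_simps)
    qed
  qed
  \<comment> \<open>With the value 0 assigned at \<open>e\<close>, \<open>H[t,u,e]\<close> is the
    divided difference of \<open>H t / (t - e)\<close>. For \<open>H t = (t - a) (t - b) f t\<close>
    this quotient is \<open>(t - a) f t\<close> at \<open>e = b\<close> and
    \<open>(t - b) f t\<close> at \<open>e = a\<close>; their difference is
    \<open>(b - a) f t\<close>.\<close>
  also have "phi0 H S w b = phi0 H S w a + (b - a) * kform (divided_diff f) S w"
    unfolding phi0_def kform_def sum_distrib_left sum.distrib[symmetric]
  proof (intro sum.cong refl)
    fix t u assume tu: "t \<in> S" "u \<in> S"
    have nz: "t - a \<noteq> 0" "t - b \<noteq> 0" "u - a \<noteq> 0" "u - b \<noteq> 0" using tu S by auto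
    define K where "K = divided_diff f t u"
    have ft: "f t = f u + K * (t - u)" using divided_diff_mult[of f t u] by (simp add: K_def)
    have Ht: "H t = p t * f t" by (simp add: Hp)
    have X: "divided_diff H t u = p t * K + (- (a + b) + 1 * (t + u)) * f u"
      unfolding Hp K_def
      by (rule divided_diff_mult_quadratic[OF C1_on_imp_differentiable[OF C1] p]) (use tu S in auto)
    have "divided_diff H t u / (u - b) - H t / ((t - b) * (u - b))
      = divided_diff H t u / (u - a) - H t / ((t - a) * (u - a)) + (b - a) * K"
      unfolding X Ht ft unfolding p_def using nz
      by (simp add: divide_simps) (simp add: algebra_simps)
    note this[unfolded K_def]
    moreover have "c * (x + d * k) = c * x + d * (c * k)" for c d x k :: real by (simp add: algebra_simps)
    ultimately show "w t * w u * (divided_diff H t u / (u - b) - H t / ((t - b) * (u - b)))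
      = w t * w u * (divided_diff H t u / (u - a) - H t / ((t - a) * (u - a)))
        + (b - a) * (w t * w u * divided_diff f t u)"
      by (simp only:)
  qed
  finally have "0 \<le> (b - a) * kform (divided_diff f) S w" by simp
  then show "0 \<le> kform (divided_diff f) S w" using ab by (simp add: zero_le_mult_iff)
qed

section \<open>Linear and quadratic multipliers\<close>

lemma divided_diff_shift_sq:
  assumes "C1_on J f" "s \<in> J"
  shows "divided_diff (\<lambda>t. (c - t)\<^sup>2 * f t) s t
    = (c - s) * (c - t) * divided_diff f s t - (c - s) * f s - (c - t) * f t"
proof -
  have "divided_diff (\<lambda>t. (c - t)\<^sup>2 * f t) s t
    = (c - s)\<^sup>2 * divided_diff f s t + (- 2 * c + 1 * (s + t)) * f t"
    by (rule divided_diff_mult_quadratic[where ?c0.0 = "c\<^sup>2" and ?c1.0 = "- 2 * c" and ?c2.0 = 1,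
          OF C1_on_imp_differentiable[OF assms]])
      (simp add: power2_eq_square algebra_simps)
  moreover have fs: "f s = f t + divided_diff f s t * (s - t)" using divided_diff_mult[of f s t] by simp
  ultimately show ?thesis unfolding fs by (simp only:) (simp add: power2_eq_square algebra_simps)
qed

lemma divided_diff_shift:
  assumes "C1_on J f" "s \<in> J"
  shows "divided_diff (\<lambda>t. (c - t) * f t) s t = (c - t) * divided_diff f s t - f s"
proof -
  have "divided_diff (\<lambda>t. (c - t) * f t) s t
    = (c - s) * divided_diff f s t + (- 1 + 0 * (s + t)) * f t"
    by (rule divided_diff_mult_quadratic[where ?c0.0 = c and ?c1.0 = "- 1" and ?c2.0 = 0,
          OF C1_on_imp_differentiable[OF assms]]) simp
  moreover have fs: "f s = f t + divided_diff f s t * (s - t)" using divided_diff_mult[of f s t] by simp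
  ultimately show ?thesis unfolding fs by (simp only:) (simp add: algebra_simps)
qed

lemma C1_on_poly_mult:
  assumes "open J" "C1_on J f"
  shows "C1_on J (\<lambda>t. (c - t) * f t)" "C1_on J (\<lambda>t. (t - c) * f t)"
    "C1_on J (\<lambda>t. (c - t)\<^sup>2 * f t)" "C1_on J (\<lambda>t. (t - c)\<^sup>2 * f t)"
proof -
  show "C1_on J (\<lambda>t. (c - t) * f t)"
    by (rule C1_on_mult[OF assms, where p' = "\<lambda>t. - 1"]) (auto intro!: derivative_eq_intros)
  show "C1_on J (\<lambda>t. (t - c) * f t)"
    by (rule C1_on_mult[OF assms, where p' = "\<lambda>t. 1"]) (auto intro!: derivative_eq_intros)
  show "C1_on J (\<lambda>t. (c - t)\<^sup>2 * f t)"
    by (rule C1_on_mult[OF assms, where p' = "\<lambda>t. - 2 * (c - t)"])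
      (auto intro!: derivative_eq_intros continuous_intros)
  then show "C1_on J (\<lambda>t. (t - c)\<^sup>2 * f t)" by (simp add: power2_commute)
qed

text \<open>In \<open>divided_diff_shift_sq\<close> the terms besides
  \<open>(c - s) (c - t) f[s,t]\<close> depend on one variable each, so weights with sum zero
  annihilate them. The point \<open>c\<close> is arbitrary, so \<open>c = b\<close> serves
  \<open>cond_beta\<close> and \<open>c = a\<close> serves \<open>cond_delta\<close>.\<close>

lemma cpd_on_shift_sq:
  assumes C1: "C1_on J f" and psd: "psd_on J n f"
  shows "cpd_on J n (\<lambda>t. (c - t)\<^sup>2 * f t)"
  unfolding cpd_on_def
proof (intro allI impI, elim conjE)
  fix S w assume S: "finite S" "S \<subseteq> J" "card S \<le> n" and w: "sum w S = (0::real)"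
  have "kform (divided_diff (\<lambda>t. (c - t)\<^sup>2 * f t)) S w
     = (\<Sum>s\<in>S. \<Sum>t\<in>S. ((c - s) * w s) * ((c - t) * w t) * divided_diff f s t
         - w t * (w s * ((c - s) * f s)) - w s * (w t * ((c - t) * f t)))"
    unfolding kform_def
    by (intro sum.cong refl, subst divided_diff_shift_sq[OF C1]) (use S in \<open>auto simp: algebra_simps\<close>)
  also have "\<dots> = kform (divided_diff f) S (\<lambda>t. (c - t) * w t)"
    unfolding kform_def sum_subtractf sum_distrib_left[symmetric] sum_distrib_right[symmetric] w by simp
  finally show "0 \<le> kform (divided_diff (\<lambda>t. (c - t)\<^sup>2 * f t)) S w"
    using psd S unfolding psd_on_def by auto
qed

section \<open>Growth of the function forced by positivity of order two\<close>

lemma psd_on_2_deriv: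
  assumes psd: "psd_on J 2 f" and s: "s \<in> J" and t: "t \<in> J"
  shows "0 \<le> deriv f s" and "(divided_diff f s t)\<^sup>2 \<le> deriv f s * deriv f t"
proof -
  have pos: "0 \<le> deriv f s" if "s \<in> J" for s
    using psd[unfolded psd_on_def, rule_format, of "{s}" "\<lambda>_. 1"] that
    by (simp add: kform_def divided_diff_def)
  then show "0 \<le> deriv f s" using s .
  show "(divided_diff f s t)\<^sup>2 \<le> deriv f s * deriv f t"
  proof (cases "s = t")
    case True
    then show ?thesis by (simp add: divided_diff_def power2_eq_square)
  next
    case False
    define K where "K = divided_diff f s t"
    have form: "0 \<le> x\<^sup>2 * deriv f s + 2 * x * y * K + y\<^sup>2 * deriv f t" for x y
    proof -
      have "0 \<le> kform (divided_diff f) {s,t} (\<lambda>v. if v = s then x else y)"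
        using psd s t False unfolding psd_on_def by (auto simp: card_insert_if)
      also have "\<dots> = x\<^sup>2 * deriv f s + 2 * x * y * K + y\<^sup>2 * deriv f t"
        using False divided_diff_commute[of f s t]
        by (simp add: kform_def K_def power2_eq_square) (simp add: divided_diff_def)
      finally show ?thesis .
    qed
    have "K\<^sup>2 \<le> deriv f s * deriv f t"
    proof (cases "deriv f s = 0")
      case True
      have "K = 0"
      proof (rule ccontr)
        assume "K \<noteq> 0"
        \<comment> \<open>If \<open>deriv f s = 0\<close>, the form with \<open>y = 1\<close> is
          affine in \<open>x\<close>, and this choice of \<open>x\<close> gives it the value
          \<open>-1\<close>.\<close>
        then show False using form[of "- (deriv f t + 1) / (2 * K)" 1] True by (simp add: field_simps)
      qed
      then show ?thesis using True by simp
    next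
      case False
      then have fs: "deriv f s > 0" using pos[OF s] by simp
      \<comment> \<open>The vector \<open>(K, - deriv f s)\<close> turns the form into
        \<open>deriv f s\<close> times the determinant.\<close>
      have "0 \<le> deriv f s * (deriv f s * deriv f t - K\<^sup>2)"
        using form[of K "- deriv f s"] by (simp add: power2_eq_square algebra_simps)
      then show ?thesis using fs by (simp add: zero_le_mult_iff)
    qed
    then show ?thesis by (simp add: K_def)
  qed
qed

lemma psd_on_2_mono:
  assumes C1: "C1_on {a<..<b} f" and psd: "psd_on {a<..<b} 2 f"
    and "a < s" "s \<le> t" "t < b"
  shows "f s \<le> f t"
proof (rule DERIV_nonneg_imp_nondecreasing[of s t f])
  show "\<exists>y. (f has_real_derivative y) (at x) \<and> 0 \<le> y" if "s \<le> x" "x \<le> t" for x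
    using C1_onD[OF C1, of x] psd_on_2_deriv(1)[OF psd, of x x] that assms by auto
qed fact

text \<open>For \<open>h = f - f s\<close> and \<open>c = deriv f s\<close> the determinant
  inequality reads \<open>h^2 \<le> c h' (x - s)^2\<close>, so where \<open>h\<close> and
  \<open>c\<close> are positive, \<open>1 / h - 1 / (c (x - s))\<close> is nonincreasing. A
  violation of the claim at \<open>t\<close> would force \<open>1 / h\<close> below 0 near
  \<open>b\<close>, although \<open>h\<close> stays positive there. The extremal functions are
  hyperbolas with a pole at \<open>b\<close>.\<close>

lemma psd_on_2_growth:
  assumes C1: "C1_on {a<..<b} f" and psd: "psd_on {a<..<b} 2 f"
    and s: "a < s" and st: "s < t" and t: "t < b"
  shows "(f t - f s) * (b - t) \<le> deriv f s * (t - s) * (b - s)"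
proof (rule ccontr)
  assume neg: "\<not> ?thesis"
  define h where "h = (\<lambda>x. f x - f s)"
  define c where "c = deriv f s"
  have c0: "c \<ge> 0" using psd_on_2_deriv(1)[OF psd, of s s] assms by (simp add: c_def)
  have K2: "(h x)\<^sup>2 \<le> c * deriv f x * (x - s)\<^sup>2" if "s < x" "x < b" for x
  proof -
    have "(divided_diff f x s)\<^sup>2 * (x - s)\<^sup>2 \<le> deriv f x * deriv f s * (x - s)\<^sup>2"
      using psd_on_2_deriv(2)[OF psd, of x s] that s by (intro mult_right_mono) auto
    then show ?thesis using divided_diff_mult[of f x s]
      by (simp add: h_def c_def power_mult_distrib[symmetric] mult.commute)
  qed
  have gt: "c * (t - s) * (b - s) < h t * (b - t)" using neg by (simp add: h_def c_def)
  moreover have "0 \<le> c * (t - s) * (b - s)" using c0 st t by auto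
  ultimately have "0 < h t * (b - t)" by linarith
  then have ht: "h t > 0" using t by (simp add: zero_less_mult_iff)
  have c: "c > 0"
  proof (rule ccontr)
    assume "\<not> c > 0"
    then have "(h t)\<^sup>2 \<le> 0" using K2[OF st t] c0 by simp
    then show False using ht by simp
  qed
  have hpos: "h x > 0" if "t \<le> x" "x < b" for x
    using psd_on_2_mono[OF C1 psd, of t x] that ht s st by (simp add: h_def)
  define W where "W = (\<lambda>x. 1 / h x - 1 / (c * (x - s)))"
  have mono: "W x \<le> W t" if x: "t \<le> x" "x < b" for x
  proof (rule DERIV_nonpos_imp_nonincreasing[of t x W])
    show "t \<le> x" by fact
    fix z assume z: "t \<le> z" "z \<le> x"
    have zz: "s < z" "z < b" "a < z" using z x st s by auto
    have hz: "h z > 0" by (rule hpos) (use z x in auto)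
    show "\<exists>y. (W has_real_derivative y) (at z) \<and> y \<le> 0"
    proof (intro exI conjI)
      have "(h has_real_derivative deriv f z) (at z)"
        unfolding h_def using C1_onD[OF C1, of z] zz by (auto intro!: derivative_eq_intros)
      then show "(W has_real_derivative - (deriv f z / (h z)\<^sup>2) + 1 / (c * (z - s)\<^sup>2)) (at z)"
        using DERIV_diff[OF DERIV_inverse_fun[of h "deriv f z" z UNIV]
            DERIV_inverse_fun[of "\<lambda>x. c * (x - s)" c z UNIV]] hz zz c
        unfolding W_def by (auto simp: inverse_eq_divide power2_eq_square intro!: derivative_eq_intros)
      have "1 / (c * (z - s)\<^sup>2) \<le> deriv f z / (h z)\<^sup>2"
        using K2[OF zz(1,2)] hz zz c by (simp add: field_simps)
      then show "- (deriv f z / (h z)\<^sup>2) + 1 / (c * (z - s)\<^sup>2) \<le> 0" by simp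
    qed
  qed
  have "c * (t - s) * ((b - s) / (b - t)) < h t" using gt t by (simp add: field_simps)
  moreover have "0 < c * (t - s) * ((b - s) / (b - t))" using c st t by simp
  ultimately have "1 / h t < 1 / (c * (t - s) * ((b - s) / (b - t)))"
    by (intro divide_strict_left_mono mult_pos_pos[OF ht]) (simp_all only: zero_less_one)
  also have "\<dots> = 1 / (c * (t - s)) - 1 / (c * (b - s))"
  proof -
    have "1 / (c * p * (q / (q - p))) = 1 / (c * p) - 1 / (c * q)"
      if "p \<noteq> 0" "q \<noteq> 0" "q - p \<noteq> 0" for p q :: real
      using that c by (simp add: divide_simps)
    from this[of "t - s" "b - s"] show ?thesis using st t by simp
  qed
  finally have Wt: "W t < - 1 / (c * (b - s))" by (simp add: W_def)
  have "((\<lambda>x. 1 / (c * (x - s)) + W t) \<longlongrightarrow> 1 / (c * (b - s)) + W t) (at_left b)"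
    using c st t by (intro tendsto_intros) auto
  then have "\<forall>\<^sub>F x in at_left b. 1 / (c * (x - s)) + W t < 0"
    by (rule order_tendstoD) (use Wt in simp)
  moreover have "\<forall>\<^sub>F x in at_left b. t < x \<and> x < b"
    using t by (intro eventually_at_leftI[of t b]) auto
  ultimately have "\<forall>\<^sub>F x in at_left b. 1 / (c * (x - s)) + W t < 0 \<and> t < x \<and> x < b"
    by eventually_elim auto
  from eventually_happens[OF this]
  obtain x where x: "1 / (c * (x - s)) + W t < 0" "t < x" "x < b"
    by auto
  have "1 / h x > 0" using hpos[of x] x by simp
  moreover have "1 / h x \<le> 1 / (c * (x - s)) + W t" using mono[of x] x by (simp add: W_def)
  ultimately show False using x(1) by linarith
qed

lemma psd_on_2_bound:
  assumes C1: "C1_on {a<..<b} f" and psd: "psd_on {a<..<b} 2 f" and ab: "a < b"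
  obtains C where "\<And>t. (a + b) / 2 < t \<Longrightarrow> t < b \<Longrightarrow> (b - t) * f t \<le> C"
proof (rule that)
  fix t assume t: "(a + b) / 2 < t" "t < b"
  define s where "s = (a + b) / 2"
  have s: "a < s" "s < t" using ab t by (auto simp: s_def)
  have d0: "0 \<le> deriv f s" using psd_on_2_deriv(1)[OF psd, of s s] s t by auto
  have "(f t - f s) * (b - t) \<le> deriv f s * (t - s) * (b - s)"
    by (rule psd_on_2_growth[OF C1 psd s t(2)])
  also have "\<dots> \<le> deriv f s * (b - a) * (b - a)"
    using d0 s t by (intro mult_mono) auto
  finally have "(b - t) * f t \<le> (b - t) * f s + deriv f s * (b - a) * (b - a)"
    by (simp add: algebra_simps)
  moreover have "(b - t) * f s \<le> (b - t) * \<bar>f s\<bar>" "(b - t) * \<bar>f s\<bar> \<le> (b - a) * \<bar>f s\<bar>"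
    using s t by (auto intro: mult_left_mono mult_right_mono)
  ultimately show "(b - t) * f t \<le> (b - a) * \<bar>f ((a + b) / 2)\<bar> + deriv f ((a + b) / 2) * (b - a) * (b - a)"
    unfolding s_def by linarith
qed

text \<open>Here \<open>H t = (t-a)^2 f t\<close> and the weights \<open>w t * (b-t)\<close>, which satisfy
  \<open>\<Sum>t. w t * (b-t) / (t-b) = 0\<close>, so that the possible pole of \<open>H\<close> at \<open>b\<close> is cancelled.\<close>
lemma cpd_on_mixed:
  assumes ab: "a < b" and C1: "C1_on {a<..<b} f" and n: "n \<ge> 1"
    and cpd: "cpd_on {a<..<b} (Suc n) (\<lambda>t. (t - a)\<^sup>2 * f t)"
    and fa: "\<And>e. e > 0 \<Longrightarrow> \<exists>\<^sub>F t in at_right a. - e < (t - a)\<^sup>2 * f t"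
    and fb: "\<forall>\<^sub>F t in at_left b. (b - t) * f t \<le> C"
  shows "cpd_on {a<..<b} n (\<lambda>t. - ((t - a) * (b - t) * f t))"
  unfolding cpd_on_def
proof (intro allI impI, elim conjE)
  fix S w assume S: "finite S" "S \<subseteq> {a<..<b}" "card S \<le> n" and w: "sum w S = (0::real)"
  \<comment> \<open>With this \<open>m\<close> one has \<open>H t = (t - a) m t\<close>, and the
    target function is \<open>- (b - t) m t\<close>. As \<open>t - a = (b - a) - (b - t)\<close>,
    both kernels reduce to that of \<open>m\<close>.\<close>
  define m where "m = (\<lambda>t. (t - a) * f t)"
  define H where "H = (\<lambda>t. (t - a)\<^sup>2 * f t)"
  have Hm: "H = (\<lambda>t. (b - a) * m t - (b - t) * m t)"
    by (auto simp: H_def m_def power2_eq_square algebra_simps)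
  have C1m: "C1_on {a<..<b} m" and C1H: "C1_on {a<..<b} H"
    unfolding m_def H_def using C1 by (auto intro!: C1_on_poly_mult)
  have aS: "a \<notin> S" and bS: "b \<notin> S" using S by auto
  define y where "y = (\<lambda>t. w t * (b - t))"
  have yb: "y t / (t - b) = - w t" if "t \<in> S" for t
  proof -
    have "t - b \<noteq> 0" using that bS by auto
    moreover have "y t = - w t * (t - b)" by (simp add: y_def algebra_simps)
    ultimately show ?thesis by simp
  qed
  have y0: "(\<Sum>t\<in>S. y t / (t - b)) = 0"
    using w by (simp add: yb sum_negf cong: sum.cong)
  have le: "phi0 H S y a \<le> phi0 H S y b"
  proof (rule phi0_le[OF C1H _ n S ab])
    show "cpd_on {a<..<b} (Suc n) H" using cpd by (simp add: H_def)
    fix e :: real assume e: "e > 0"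
    let ?A = "\<lambda>s. (\<Sum>t\<in>S. y t / (t - s))\<^sup>2"
    have "(?A \<longlongrightarrow> ?A a) (at_right a)"
      by (intro tendsto_intros tendsto_weight_sum S aS)
    then have ev: "\<forall>\<^sub>F s in at_right a. ?A s < ?A a + 1"
      by (rule order_tendstoD) simp
    define K where "K = ?A a + 1"
    have K: "K > 0" unfolding K_def by (intro add_nonneg_pos) auto
    then have eK: "e / K > 0" using e by simp
    from frequently_eventually_frequently[OF fa[OF eK] ev]
    show "\<exists>\<^sub>F s in at_right a. - e < H s * ?A s"
    proof (rule frequently_elim1)
      fix s assume s: "- (e / K) < (s - a)\<^sup>2 * f s \<and> ?A s < ?A a + 1"
      show "- e < H s * ?A s"
      proof (cases "H s \<ge> 0")
        case True
        then have "0 \<le> H s * ?A s" by simp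
        then show ?thesis using e by linarith
      next
        case False
        then have "(- H s) * ?A s \<le> (- H s) * K"
          using s by (intro mult_left_mono) (auto simp: K_def)
        also have "\<dots> < e"
        proof -
          have "- H s < e / K" using s unfolding H_def by linarith
          then show ?thesis using K by (simp only: pos_less_divide_eq)
        qed
        finally show ?thesis by simp
      qed
    qed
  next
    fix e :: real assume e: "e > 0"
    let ?A = "\<lambda>s. (\<Sum>t\<in>S. y t / (t - s))\<^sup>2"
    \<comment> \<open>Because \<open>y0\<close> makes the weighted sum vanish at \<open>b\<close>,
      it contains the factor \<open>s - b\<close>. Its square supplies \<open>(b - s)^2\<close>: one
      factor compensates the possible simple pole of \<open>f\<close>, the other tends to 0.\<close>
    define D where "D = (\<lambda>s. \<Sum>t\<in>S. y t / (t - s) / (t - b))"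
    have A: "(\<Sum>t\<in>S. y t / (t - s)) = (s - b) * D s" if "s \<notin> S" for s
    proof -
      have "(\<Sum>t\<in>S. y t / (t - s)) = (\<Sum>t\<in>S. y t / (t - s)) - (\<Sum>t\<in>S. y t / (t - b))"
        by (simp add: y0)
      also have "\<dots> = (\<Sum>t\<in>S. (s - b) * (y t / (t - s) / (t - b)))"
        unfolding sum_subtractf[symmetric]
      proof (intro sum.cong refl)
        fix t assume "t \<in> S"
        then have "t - s \<noteq> 0" "t - b \<noteq> 0" using that bS by auto
        then show "y t / (t - s) - y t / (t - b) = (s - b) * (y t / (t - s) / (t - b))"
          by (simp add: divide_simps) (simp add: algebra_simps)
      qed
      also have "\<dots> = (s - b) * D s" by (simp add: D_def sum_distrib_left)
      finally show ?thesis .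
    qed
    have "((\<lambda>s. \<bar>C\<bar> * (s - a)\<^sup>2 * (b - s) * (D s)\<^sup>2) \<longlongrightarrow> \<bar>C\<bar> * (b - a)\<^sup>2 * (b - b) * (D b)\<^sup>2) (at_left b)"
      unfolding D_def using bS S(1) by (intro tendsto_intros) auto
    then have "\<forall>\<^sub>F s in at_left b. \<bar>C\<bar> * (s - a)\<^sup>2 * (b - s) * (D s)\<^sup>2 < e"
      by (rule order_tendstoD) (use e in simp)
    \<comment> \<open>Points to the right of this maximum lie outside \<open>S\<close>; inserting
      \<open>a\<close> keeps the maximum defined when \<open>S\<close> is empty.\<close>
    moreover have "\<forall>\<^sub>F s in at_left b. Max (insert a S) < s \<and> s < b"
      by (rule eventually_at_leftI[of "Max (insert a S)" b]) (use S ab in auto)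
    ultimately have "\<forall>\<^sub>F s in at_left b. H s * ?A s < e"
      using fb
    proof eventually_elim
      case (elim s)
      have sS: "s \<notin> S" using elim(2) S(1) by auto
      have "H s * ?A s = ((b - s) * f s) * ((s - a)\<^sup>2 * (b - s) * (D s)\<^sup>2)"
        unfolding A[OF sS] H_def by (simp add: power2_eq_square algebra_simps)
      also have "\<dots> \<le> \<bar>C\<bar> * ((s - a)\<^sup>2 * (b - s) * (D s)\<^sup>2)"
        using elim by (intro mult_right_mono) auto
      also have "\<dots> < e" using elim(1) by (simp add: mult.assoc)
      finally show ?case .
    qed
    then show "\<exists>\<^sub>F s in at_left b. H s * ?A s < e"
      by (rule eventually_frequently[rotated]) simp
  qed
  have dH: "divided_diff H t u = (b - a) * divided_diff m t u - ((b - u) * divided_diff m t u - m t)"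
    if "t \<in> S" "u \<in> S" for t u
  proof -
    have t: "t \<in> {a<..<b}" using that S by auto
    have "divided_diff H t u = (b - a) * divided_diff m t u - divided_diff (\<lambda>t. (b - t) * m t) t u"
    proof (cases "t = u")
      case True
      have "((\<lambda>t. (b - a) * m t - (b - t) * m t) has_real_derivative
          (b - a) * deriv m t - deriv (\<lambda>t. (b - t) * m t) t) (at t)"
        by (intro DERIV_diff DERIV_cmult C1_onD[OF C1m t] C1_onD[OF C1_on_poly_mult(1)[OF _ C1m] t]) simp
      then show ?thesis using True by (simp add: divided_diff_def Hm DERIV_imp_deriv)
    next
      case False
      then show ?thesis unfolding divided_diff_def Hm
        by (simp add: divide_simps) (simp add: algebra_simps)
    qed
    then show ?thesis by (simp add: divided_diff_shift[OF C1m t])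
  qed
  \<comment> \<open>The value of \<open>phi0\<close> at \<open>a\<close> is \<open>P\<close>, and at
    \<open>b\<close> it is \<open>P - (b - a) * Q\<close>. Hence \<open>le\<close> says that
    \<open>Q\<close> is nonpositive, and the wanted form is \<open>- Q\<close>, since its
    one-variable terms vanish under \<open>sum w S = 0\<close>.\<close>
  define Q where "Q = (\<Sum>t\<in>S. \<Sum>u\<in>S. y t * w u * divided_diff m t u)"
  define P where "P = kform (divided_diff m) S y"
  have pa: "phi0 H S y a = P"
    unfolding phi0_def P_def kform_def
  proof (intro sum.cong refl)
    fix t u assume tu: "t \<in> S" "u \<in> S"
    then have nz: "t - a \<noteq> 0" "u - a \<noteq> 0" using aS by auto
    define K where "K = divided_diff m t u"
    have mt: "m t = m u + K * (t - u)" using divided_diff_mult[of m t u] by (simp add: K_def)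
    have Ht: "H t = (t - a) * m t" by (simp add: H_def m_def power2_eq_square)
    have d: "divided_diff H t u = (b - a) * K - ((b - u) * K - m t)" using dH[OF tu] by (simp add: K_def)
    have "divided_diff H t u / (u - a) - H t / ((t - a) * (u - a)) = K"
      unfolding d Ht mt using nz by (simp add: divide_simps) (simp add: algebra_simps)
    then show "y t * y u * (divided_diff H t u / (u - a) - H t / ((t - a) * (u - a))) = y t * y u * divided_diff m t u"
      by (simp add: K_def)
  qed
  have pb: "phi0 H S y b = P - (b - a) * Q"
  proof -
    have "phi0 H S y b = (\<Sum>t\<in>S. \<Sum>u\<in>S. y t * y u * divided_diff m t u
        - (b - a) * (y t * w u * divided_diff m t u) - y t * m t * w u - y t / (t - b) * H t * (y u / (u - b)))"
      unfolding phi0_def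
    proof (intro sum.cong refl)
      fix t u assume tu: "t \<in> S" "u \<in> S"
      then have nz: "t - b \<noteq> 0" "u - b \<noteq> 0" using bS by auto
      define K where "K = divided_diff m t u"
      have d: "divided_diff H t u = (b - a) * K - ((b - u) * K - m t)" using dH[OF tu] by (simp add: K_def)
      have "y t * y u * (divided_diff H t u / (u - b) - H t / ((t - b) * (u - b)))
        = y t * K * (b - a) * (y u / (u - b)) + y t * y u * K + y t * m t * (y u / (u - b))
          - y t / (t - b) * H t * (y u / (u - b))"
        unfolding d using nz by (simp add: divide_simps) (simp add: algebra_simps)
      then show "y t * y u * (divided_diff H t u / (u - b) - H t / ((t - b) * (u - b)))
        = y t * y u * divided_diff m t u
        - (b - a) * (y t * w u * divided_diff m t u) - y t * m t * w u - y t / (t - b) * H t * (y u / (u - b))"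
        unfolding yb[OF tu(2)] K_def by (simp add: algebra_simps)
    qed
    also have "\<dots> = P - (b - a) * Q"
      unfolding sum_subtractf P_def Q_def kform_def sum_distrib_left[symmetric] w y0 by simp
    finally show ?thesis .
  qed
  have "Q \<le> 0" using le ab unfolding pa pb by (simp add: mult_le_0_iff)
  have "kform (divided_diff (\<lambda>t. - ((t - a) * (b - t) * f t))) S w
    = (\<Sum>t\<in>S. \<Sum>u\<in>S. w t * m t * w u - w t * y u * divided_diff m t u)"
    unfolding kform_def
  proof (intro sum.cong refl)
    fix t u assume tu: "t \<in> S" "u \<in> S"
    have t: "t \<in> {a<..<b}" using tu S by auto
    have "(\<lambda>t. - ((t - a) * (b - t) * f t)) = (\<lambda>t. - ((b - t) * m t))" by (auto simp: m_def)
    then have "divided_diff (\<lambda>t. - ((t - a) * (b - t) * f t)) t u = - ((b - u) * divided_diff m t u - m t)"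
      using divided_diff_minus[OF C1_on_poly_mult(1)[OF _ C1m] t, of b u] divided_diff_shift[OF C1m t] by simp
    then show "w t * w u * divided_diff (\<lambda>t. - ((t - a) * (b - t) * f t)) t u
       = w t * m t * w u - w t * y u * divided_diff m t u"
      by (simp only:) (simp add: y_def algebra_simps)
  qed
  also have "\<dots> = - (\<Sum>t\<in>S. \<Sum>u\<in>S. w t * y u * divided_diff m t u)"
    unfolding sum_subtractf by (simp add: sum_distrib_left[symmetric] w)
  also have "(\<Sum>t\<in>S. \<Sum>u\<in>S. w t * y u * divided_diff m t u) = Q"
    unfolding Q_def by (subst sum.swap) (simp add: divided_diff_commute[of m] mult.commute)
  finally show "0 \<le> kform (divided_diff (\<lambda>t. - ((t - a) * (b - t) * f t))) S w" using \<open>Q \<le> 0\<close> by simp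
qed

section \<open>Passing to the limit at the right end point\<close>

lemma deriv_bounded_near_right_end:
  fixes g :: "real \<Rightarrow> real"
  assumes cv: "convex_on {a<..<b} (deriv g)" and ab: "a < b"
    and fr: "\<exists>\<^sub>F t in at_left b. deriv g t \<le> N"
  obtains M c where "c < b" "a < c" "\<And>t. c < t \<Longrightarrow> t < b \<Longrightarrow> \<bar>deriv g t\<bar> \<le> M"
proof -
  define m where "m = (2 * a + b) / 3"
  define c where "c = (a + 2 * b) / 3"
  have o: "a < m" "m < c" "c < b" using ab by (auto simp: m_def c_def)
  \<comment> \<open>A convex function on \<open>{c..r}\<close> is at most the larger of its end
    values; the frequent bound provides a suitable \<open>r\<close> beyond every
    \<open>t\<close>.\<close>
  have up: "deriv g t \<le> \<bar>deriv g c\<bar> + \<bar>N\<bar>" if t: "c < t" "t < b" for t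
  proof -
    obtain r where r: "t < r" "r < b" "deriv g r \<le> N"
      using fr t unfolding frequently_at_left_iff by blast
    have "deriv g t \<le> max (deriv g c) (deriv g r)"
      by (rule convex_on_le_max[OF convex_on_subset[OF cv, of "{c..r}"]]) (use r t o in auto)
    then show ?thesis using r(3) by linarith
  qed
  \<comment> \<open>The chord over \<open>{m..c}\<close>, prolonged beyond \<open>c\<close>, lies
    below a convex function and so gives the lower bound.\<close>
  define k where "k = (deriv g c - deriv g m) / (c - m)"
  have dn: "deriv g c - \<bar>k\<bar> * (b - a) \<le> deriv g t" if t: "c < t" "t < b" for t
  proof -
    have "k \<le> (deriv g t - deriv g c) / (t - c)"
    proof -
      have "(deriv g m - deriv g c) / (m - c) \<le> (deriv g c - deriv g t) / (c - t)"
        using convex_on_slope_le[OF cv, of m t c] o t by auto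
      then show ?thesis
        using minus_divide_divide[of "deriv g c - deriv g m" "c - m"]
          minus_divide_divide[of "deriv g t - deriv g c" "t - c"] unfolding k_def by simp
    qed
    then have "k * (t - c) \<le> deriv g t - deriv g c" using t by (simp add: pos_le_divide_eq)
    moreover have "- (\<bar>k\<bar> * (b - a)) \<le> k * (t - c)"
    proof -
      have "\<bar>k * (t - c)\<bar> \<le> \<bar>k\<bar> * (b - a)"
        unfolding abs_mult using t o by (intro mult_left_mono) auto
      then show ?thesis by linarith
    qed
    ultimately show ?thesis by linarith
  qed
  show thesis
  proof (rule that[of c])
    fix t assume t: "c < t" "t < b"
    show "\<bar>deriv g t\<bar> \<le> \<bar>deriv g c\<bar> + \<bar>N\<bar> + \<bar>k\<bar> * (b - a)"
      using up[OF t] dn[OF t] ab mult_nonneg_nonneg[of "\<bar>k\<bar>" "b - a"] by linarith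
  qed (use o in auto)
qed

text \<open>If \<open>deriv g\<close> exceeded \<open>e\<close> throughout a left neighbourhood of
  \<open>b\<close>, integrating up to points where \<open>g\<close> is nearly nonpositive would give
  \<open>g s \<le> - e (b - s)\<close>, against the first bound. So \<open>deriv g\<close> is
  frequently small; by convexity it is then bounded near \<open>b\<close>, and for a Lipschitz
  function the frequent bounds already determine the limit.\<close>

lemma right_end_behaviour:
  assumes C1: "C1_on {a<..<b} g" and cv: "convex_on {a<..<b} (deriv g)" and ab: "a < b"
    and f1: "\<And>e. e > 0 \<Longrightarrow> \<exists>\<^sub>F t in at_left b. - e * (b - t) < g t"
    and f2: "\<And>e. e > 0 \<Longrightarrow> \<exists>\<^sub>F t in at_left b. g t < e"
  shows "\<And>e. e > 0 \<Longrightarrow> \<exists>\<^sub>F t in at_left b. deriv g t \<le> e" and "(g \<longlongrightarrow> 0) (at_left b)"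
proof -
  show fr: "\<exists>\<^sub>F t in at_left b. deriv g t \<le> e" if e: "e > 0" for e
    unfolding frequently_at_left_iff
  proof (intro allI impI, rule ccontr)
    fix m assume m: "m < b" and no: "\<not> (\<exists>s>m. s < b \<and> deriv g s \<le> e)"
    define m' where "m' = max a m"
    have big: "deriv g s > e" if "m' < s" "s < b" for s using no that by (force simp: m'_def)
    have m': "m' < b" using m ab by (simp add: m'_def)
    have le: "g s \<le> - e * (b - s)" if s: "m' < s" "s < b" for s
    proof (rule field_le_epsilon)
      fix w :: real assume w: "w > 0"
      \<comment> \<open>Beyond this point \<open>e * (b - r) < w / 2\<close>, so moving the end of
        integration from \<open>r\<close> to \<open>b\<close> costs less than half of
        \<open>w\<close>.\<close>
      define q where "q = max s (b - w / 2 / e)"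
      have "q < b" using s w e by (simp add: q_def)
      then obtain r where r: "q < r" "r < b" "g r < w / 2"
        using f2[of "w / 2"] w unfolding frequently_at_left_iff by auto
      have "(\<lambda>x. g x - e * x) s \<le> (\<lambda>x. g x - e * x) r"
      proof (rule DERIV_nonneg_imp_nondecreasing[of s r "\<lambda>x. g x - e * x"])
        show "s \<le> r" using r by (simp add: q_def)
        fix x assume x: "s \<le> x" "x \<le> r"
        then have xx: "x \<in> {a<..<b}" "m' < x" "x < b" using s r by (auto simp: m'_def)
        show "\<exists>y. ((\<lambda>x. g x - e * x) has_real_derivative y) (at x) \<and> 0 \<le> y"
          using big[OF xx(2,3)]
          by (intro exI[of _ "deriv g x - e"] conjI)
            (auto intro!: derivative_eq_intros C1_onD[OF C1 xx(1)])
      qed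
      moreover have "b - r < w / 2 / e" using r(1) by (simp add: q_def)
      then have "e * (b - r) < w / 2" using e by (simp add: pos_less_divide_eq mult_ac)
      ultimately show "g s \<le> - e * (b - s) + w" using r(3) by (simp add: algebra_simps)
    qed
    obtain s where s: "m' < s" "s < b" "- e * (b - s) < g s"
      using f1[OF e] m' unfolding frequently_at_left_iff by blast
    then show False using le[OF s(1,2)] by linarith
  qed
  obtain M c where c: "c < b" "a < c" and M: "\<And>t. c < t \<Longrightarrow> t < b \<Longrightarrow> \<bar>deriv g t\<bar> \<le> M"
    by (rule deriv_bounded_near_right_end[OF cv ab fr[of 1]]) auto
  have M0: "0 \<le> M" using M[of "(b + c) / 2"] c by (auto intro: order_trans[OF abs_ge_zero])
  have lip: "\<bar>g r - g s\<bar> \<le> M * (r - s)" if "c < s" "s < r" "r < b" for r s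
  proof -
    have "\<exists>z>s. z < r \<and> g r - g s = (r - s) * deriv g z"
      by (rule MVT2) (use that c in \<open>auto intro!: C1_onD[OF C1]\<close>)
    then obtain z where z: "s < z" "z < r" "g r - g s = (r - s) * deriv g z" by blast
    have "\<bar>g r - g s\<bar> = \<bar>deriv g z\<bar> * (r - s)" unfolding z(3) using that by (simp add: abs_mult)
    also have "\<dots> \<le> M * (r - s)" using M[of z] z that by (intro mult_right_mono) auto
    finally show ?thesis .
  qed
  have bd: "\<bar>g s\<bar> \<le> M * (b - s)" if s: "c < s" "s < b" for s
  proof (rule field_le_epsilon)
    fix w :: real assume w: "w > 0"
    obtain r1 where r1: "s < r1" "r1 < b" "g r1 < w"
      using f2[OF w] s unfolding frequently_at_left_iff by blast
    \<comment> \<open>With the slope \<open>w / (b - s)\<close> the lower bound at any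
      \<open>r2\<close> in \<open>(s, b)\<close> is at least \<open>- w\<close>.\<close>
    have wb: "w / (b - s) > 0" using w s by simp
    obtain r2 where r2: "s < r2" "r2 < b" "- (w / (b - s)) * (b - r2) < g r2"
      using f1[OF wb] s unfolding frequently_at_left_iff by blast
    have "w / (b - s) * (b - r2) \<le> w / (b - s) * (b - s)"
      using wb r2 by (intro mult_left_mono) auto
    then have "- w < g r2" using r2(3) s by simp
    moreover have "M * (r1 - s) \<le> M * (b - s)" "M * (r2 - s) \<le> M * (b - s)"
      using M0 r1 r2 by (auto intro: mult_left_mono)
    ultimately show "\<bar>g s\<bar> \<le> M * (b - s) + w"
      using lip[of s r1] lip[of s r2] r1 r2 s by linarith
  qed
  show "(g \<longlongrightarrow> 0) (at_left b)"
  proof (rule Lim_null_comparison)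
    show "\<forall>\<^sub>F s in at_left b. norm (g s) \<le> M * (b - s)"
      using bd c by (intro eventually_at_leftI[of c b]) auto
    have "((\<lambda>s. M * (b - s)) \<longlongrightarrow> M * (b - b)) (at_left b)" by (intro tendsto_intros)
    then show "((\<lambda>s. M * (b - s)) \<longlongrightarrow> 0) (at_left b)" by simp
  qed
qed

text \<open>The kernel inequality with added point \<open>s\<close> contains \<open>s\<close> only
  through \<open>g s\<close> and \<open>deriv g s\<close>. The two end conditions give
  \<open>g s\<close> the limit 0 and make \<open>deriv g s\<close> frequently at most any positive
  number. As \<open>deriv g s\<close> has a nonnegative coefficient, an upper bound for it suffices
  in the limit.\<close>

lemma psd_on_from_right_end:
  assumes ab: "a < b" and C1: "C1_on {a<..<b} f" and n: "n \<ge> 1"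
    and cpd: "cpd_on {a<..<b} (Suc n) (\<lambda>t. (b - t)\<^sup>2 * f t)"
    and f1: "\<And>e. e > 0 \<Longrightarrow> \<exists>\<^sub>F t in at_left b. - e < (b - t) * f t"
    and f2: "\<And>e. e > 0 \<Longrightarrow> \<exists>\<^sub>F t in at_left b. (b - t)\<^sup>2 * f t < e"
  shows "psd_on {a<..<b} n f"
  unfolding psd_on_def
proof (intro allI impI, elim conjE)
  fix S w assume S: "finite S" "S \<subseteq> {a<..<b}" "card S \<le> n"
  define g where "g = (\<lambda>t. (b - t)\<^sup>2 * f t)"
  have C1g: "C1_on {a<..<b} g" unfolding g_def by (intro C1_on_poly_mult C1) auto
  have cpdg: "cpd_on {a<..<b} (Suc n) g" using cpd by (simp add: g_def)
  have cv: "convex_on {a<..<b} (deriv g)"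
    by (rule cpd_on_imp_convex_deriv[OF C1g cpd_on_mono[OF cpdg]]) (use n in simp)
  have g1: "\<exists>\<^sub>F t in at_left b. - e * (b - t) < g t" if "e > 0" for e
  proof -
    have "\<forall>\<^sub>F t in at_left b. t < b" by (simp add: eventually_at_filter)
    from frequently_eventually_frequently[OF f1[OF that] this]
    show ?thesis
    proof (rule frequently_elim1)
      fix t assume t: "- e < (b - t) * f t \<and> t < b"
      then have "- e * (b - t) < (b - t) * f t * (b - t)" by (intro mult_strict_right_mono) auto
      then show "- e * (b - t) < g t" by (simp add: g_def power2_eq_square mult_ac)
    qed
  qed
  have g2: "\<exists>\<^sub>F t in at_left b. g t < e" if "e > 0" for e
    using f2[OF that] by (simp add: g_def)
  have rb1: "\<exists>\<^sub>F t in at_left b. deriv g t \<le> e" if "e > 0" for e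
    by (rule right_end_behaviour(1)[OF C1g cv ab _ _ that]) (fact g1, fact g2)
  have rb2: "(g \<longlongrightarrow> 0) (at_left b)"
    by (rule right_end_behaviour(2)[OF C1g cv ab]) (fact g1, fact g2)
  have bS: "b \<notin> S" using S by auto
  \<comment> \<open>In the limit the kernel is \<open>(b - t) (b - u) f[t,u]\<close>; dividing the
    weights by \<open>b - t\<close> cancels the two factors.\<close>
  define X where "X = (\<lambda>t. w t / (b - t))"
  define r where "r = (sum X S)\<^sup>2"
  define q where "q = (\<lambda>s. \<Sum>t\<in>S. \<Sum>u\<in>S. X t * X u *
     (divided_diff g t u - (g t - g s) / (t - s) - (g u - g s) / (u - s)))"
  have "(q \<longlongrightarrow> (\<Sum>t\<in>S. \<Sum>u\<in>S. X t * X u *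
     (divided_diff g t u - (g t - 0) / (t - b) - (g u - 0) / (u - b)))) (at_left b)"
    unfolding q_def using bS by (intro tendsto_intros rb2) auto
  also have "(\<Sum>t\<in>S. \<Sum>u\<in>S. X t * X u *
     (divided_diff g t u - (g t - 0) / (t - b) - (g u - 0) / (u - b))) = kform (divided_diff f) S w"
    unfolding kform_def
  proof (intro sum.cong refl)
    fix t u assume tu: "t \<in> S" "u \<in> S"
    then have nz: "b - t \<noteq> 0" "b - u \<noteq> 0" using bS by auto
    have t: "t \<in> {a<..<b}" using tu S by auto
    have *: "(g v - 0) / (v - b) = - ((b - v) * f v)" if "b - v \<noteq> 0" for v
    proof -
      have "g v - 0 = - ((b - v) * f v) * (v - b)" by (simp add: g_def power2_eq_square algebra_simps)
      moreover have "v - b \<noteq> 0" using that by simp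
      ultimately show ?thesis by (metis nonzero_mult_div_cancel_right)
    qed
    have "divided_diff g t u - (g t - 0) / (t - b) - (g u - 0) / (u - b)
       = (b - t) * (b - u) * divided_diff f t u"
      unfolding *[OF nz(1)] *[OF nz(2)] unfolding g_def divided_diff_shift_sq[OF C1 t] by simp
    then have "X t * X u * (divided_diff g t u - (g t - 0) / (t - b) - (g u - 0) / (u - b))
      = (X t * (b - t)) * (X u * (b - u)) * divided_diff f t u" by (simp only: mult_ac)
    then show "X t * X u * (divided_diff g t u - (g t - 0) / (t - b) - (g u - 0) / (u - b))
      = w t * w u * divided_diff f t u" unfolding X_def using nz by simp
  qed
  finally have lim: "(q \<longlongrightarrow> kform (divided_diff f) S w) (at_left b)" .
  have "0 \<le> kform (divided_diff f) S w + e" if e: "e > 0" for e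
  proof -
    \<comment> \<open>Dividing by \<open>r + 1\<close> instead of \<open>r\<close> covers the case
      that the weights \<open>X\<close> have sum zero.\<close>
    have e1: "e / 2 > 0" and e2: "e / 2 / (r + 1) > 0" using e by (auto simp: r_def add_nonneg_pos)
    have "\<forall>\<^sub>F s in at_left b. q s < kform (divided_diff f) S w + e / 2"
      by (rule order_tendstoD[OF lim]) (use e in simp)
    moreover have "\<forall>\<^sub>F s in at_left b. Max (insert a S) < s \<and> s < b"
      by (rule eventually_at_leftI[of "Max (insert a S)" b]) (use S ab in auto)
    ultimately have "\<forall>\<^sub>F s in at_left b. q s < kform (divided_diff f) S w + e / 2 \<and> s \<in> {a<..<b} \<and> s \<notin> S"
      by eventually_elim (use S(1) in auto)
    from frequently_ex[OF frequently_eventually_frequently[OF rb1[OF e2] this]]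
    obtain s where s: "deriv g s \<le> e / 2 / (r + 1)" "q s < kform (divided_diff f) S w + e / 2"
      "s \<in> {a<..<b}" "s \<notin> S" by auto
    have "0 \<le> (\<Sum>t\<in>S. \<Sum>u\<in>S. X t * X u *
      (divided_diff g t u - divided_diff g t s - divided_diff g u s + deriv g s))"
      by (rule cpd_on_insert[OF cpdg S s(3,4)])
    also have "\<dots> = (\<Sum>t\<in>S. \<Sum>u\<in>S. X t * X u *
     (divided_diff g t u - (g t - g s) / (t - s) - (g u - g s) / (u - s)) + X t * X u * deriv g s)"
    proof (intro sum.cong refl)
      fix t u assume "t \<in> S" "u \<in> S"
      then have "t \<noteq> s" "u \<noteq> s" using s(4) by auto
      then show "X t * X u * (divided_diff g t u - divided_diff g t s - divided_diff g u s + deriv g s)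
        = X t * X u * (divided_diff g t u - (g t - g s) / (t - s) - (g u - g s) / (u - s)) + X t * X u * deriv g s"
        by (simp only: divided_diff_def[of g _ s] if_False distrib_left)
    qed
    also have "\<dots> = q s + r * deriv g s"
      unfolding sum.distrib q_def r_def power2_eq_square sum_product by (simp only: sum_distrib_right)
    also have "r * deriv g s \<le> e / 2"
    proof -
      have "r * deriv g s \<le> r * (e / 2 / (r + 1))" by (intro mult_left_mono s) (simp add: r_def)
      also have "\<dots> \<le> (r + 1) * (e / 2 / (r + 1))" using e2 by (intro mult_right_mono) auto
      also have "\<dots> = e / 2"
      proof -
        have "r + 1 \<noteq> 0" using zero_le_power2[of "sum X S"] unfolding r_def by linarith
        then show ?thesis by (rule nonzero_mult_div_cancel_left[of "r + 1" "e / 2", unfolded times_divide_eq_right[symmetric]])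
      qed
      finally show ?thesis .
    qed
    finally show ?thesis using s(2) by simp
  qed
  then show "0 \<le> kform (divided_diff f) S w" by (rule field_le_epsilon)
qed

section \<open>Reflection, and forms indexed by lists\<close>

lemma frequently_at_right_iff:
  "(\<exists>\<^sub>F s in at_right a. P s) \<longleftrightarrow> (\<forall>m>a. \<exists>s>a. s < m \<and> P s)" for a :: real
  unfolding frequently_def eventually_at_right_field by blast

lemma frequently_at_left_reflect:
  fixes a b :: real
  assumes "\<exists>\<^sub>F s in at_right a. P s"
  shows "\<exists>\<^sub>F s in at_left b. P (a + b - s)"
  unfolding frequently_at_left_iff
proof (intro allI impI)
  fix m assume "m < b"
  then have "a < a + b - m" by simp
  then obtain s where "a < s" "s < a + b - m" "P s"
    using assms unfolding frequently_at_right_iff by blast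
  then show "\<exists>s>m. s < b \<and> P (a + b - s)" by (intro exI[of _ "a + b - s"]) auto
qed

text \<open>The reflection exchanges the two end points when \<open>c = a + b\<close>, and its outer
  sign preserves Loewner kernels. It sends the multiplier \<open>(t - a)^2\<close> to
  \<open>(b - t)^2\<close>, so statements about the left end follow from those about the right
  end.\<close>

definition refl_fun :: "real \<Rightarrow> (real \<Rightarrow> real) \<Rightarrow> real \<Rightarrow> real" where
  "refl_fun c f = (\<lambda>t. - f (c - t))"

lemma refl_fun_refl_fun [simp]: "refl_fun c (refl_fun c f) = f"
  by (simp add: refl_fun_def)

lemma refl_fun_has_derivative:
  assumes "C1_on {a<..<b} f" "t \<in> {a<..<b}"
  shows "(refl_fun (a + b) f has_real_derivative deriv f (a + b - t)) (at t)"
proof -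
  have "(f has_real_derivative deriv f (a + b - t)) (at (a + b - t))"
    by (rule C1_onD[OF assms(1)]) (use assms(2) in auto)
  moreover have "((\<lambda>t. a + b - t) has_real_derivative - 1) (at t)"
    by (auto intro!: derivative_eq_intros)
  ultimately have "((\<lambda>t. f (a + b - t)) has_real_derivative deriv f (a + b - t) * - 1) (at t)"
    by (rule DERIV_chain2)
  from DERIV_minus[OF this] show ?thesis by (simp add: refl_fun_def)
qed

lemma C1_on_refl_fun:
  assumes "C1_on {a<..<b} f"
  shows "C1_on {a<..<b} (refl_fun (a + b) f)"
proof (rule C1_onI)
  show "(refl_fun (a + b) f has_real_derivative deriv f (a + b - t)) (at t)" if "t \<in> {a<..<b}" for t
    by (rule refl_fun_has_derivative[OF assms that])
  show "continuous_on {a<..<b} (\<lambda>t. deriv f (a + b - t))"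
    by (rule continuous_on_compose2[of "{a<..<b}" "deriv f"])
      (use assms in \<open>auto simp: C1_on_def intro!: continuous_intros\<close>)
qed simp

lemma divided_diff_refl_fun:
  assumes "C1_on {a<..<b} f" "s \<in> {a<..<b}"
  shows "divided_diff (refl_fun (a + b) f) s t = divided_diff f (a + b - s) (a + b - t)"
proof (cases "s = t")
  case True
  then show ?thesis
    using DERIV_imp_deriv[OF refl_fun_has_derivative[OF assms]] by (simp add: divided_diff_def)
next
  case False
  have "(f (a + b - s) - f (a + b - t)) / ((a + b - s) - (a + b - t)) = (f (a + b - t) - f (a + b - s)) / (s - t)"
    using minus_divide_divide[of "f (a + b - t) - f (a + b - s)" "s - t"] by simp
  with False show ?thesis by (simp add: divided_diff_def refl_fun_def)
qed

lemma kform_refl_fun: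
  assumes "C1_on {a<..<b} f" "S \<subseteq> {a<..<b}"
  shows "kform (divided_diff (refl_fun (a + b) f)) S w
     = kform (divided_diff f) ((-) (a + b) ` S) (\<lambda>t. w (a + b - t))"
proof -
  have inj: "inj_on ((-) (a + b)) S" by (auto intro: inj_onI)
  show ?thesis unfolding kform_def sum.reindex[OF inj] o_def
    by (intro sum.cong refl, subst divided_diff_refl_fun[OF assms(1)]) (use assms(2) in auto)
qed

lemma reflect_points:
  fixes a b :: real
  assumes "finite S" "S \<subseteq> {a<..<b}" "card S \<le> n"
  shows "finite ((-) (a + b) ` S)" "(-) (a + b) ` S \<subseteq> {a<..<b}" "card ((-) (a + b) ` S) \<le> n"
    "sum (\<lambda>t. w (a + b - t)) ((-) (a + b) ` S) = sum w S"
proof -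
  have inj: "inj_on ((-) (a + b)) S" by (auto intro: inj_onI)
  show "finite ((-) (a + b) ` S)" "(-) (a + b) ` S \<subseteq> {a<..<b}" "card ((-) (a + b) ` S) \<le> n"
    using assms card_image[OF inj] by auto
  show "sum (\<lambda>t. w (a + b - t)) ((-) (a + b) ` S) = sum w S"
    by (simp add: sum.reindex[OF inj])
qed

lemma psd_on_refl_fun:
  assumes C1: "C1_on {a<..<b} f" and psd: "psd_on {a<..<b} n f"
  shows "psd_on {a<..<b} n (refl_fun (a + b) f)"
  unfolding psd_on_def
proof (intro allI impI, elim conjE)
  fix S w assume S: "finite S" "S \<subseteq> {a<..<b}" "card S \<le> n"
  show "0 \<le> kform (divided_diff (refl_fun (a + b) f)) S w"
    unfolding kform_refl_fun[OF C1 S(2)] using psd reflect_points(1-3)[OF S] unfolding psd_on_def by blast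
qed

lemma cpd_on_refl_fun:
  assumes C1: "C1_on {a<..<b} f" and cpd: "cpd_on {a<..<b} n f"
  shows "cpd_on {a<..<b} n (refl_fun (a + b) f)"
  unfolding cpd_on_def
proof (intro allI impI, elim conjE)
  fix S w assume S: "finite S" "S \<subseteq> {a<..<b}" "card S \<le> n" and w: "sum w S = (0::real)"
  show "0 \<le> kform (divided_diff (refl_fun (a + b) f)) S w"
    unfolding kform_refl_fun[OF C1 S(2)]
    using cpd reflect_points(1-3)[OF S] reflect_points(4)[OF S, of w] w unfolding cpd_on_def by auto
qed

lemma psd_on_from_left_end:
  assumes ab: "a < b" and C1: "C1_on {a<..<b} f" and n: "n \<ge> 1"
    and cpd: "cpd_on {a<..<b} (Suc n) (\<lambda>t. (t - a)\<^sup>2 * f t)"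
    and f1: "\<And>e. e > 0 \<Longrightarrow> \<exists>\<^sub>F t in at_right a. (t - a) * f t < e"
    and f2: "\<And>e. e > 0 \<Longrightarrow> \<exists>\<^sub>F t in at_right a. - e < (t - a)\<^sup>2 * f t"
  shows "psd_on {a<..<b} n f"
proof -
  define g where "g = refl_fun (a + b) f"
  have C1g: "C1_on {a<..<b} g" unfolding g_def by (rule C1_on_refl_fun[OF C1])
  have "psd_on {a<..<b} n g"
  proof (rule psd_on_from_right_end[OF ab C1g n])
    have "C1_on {a<..<b} (\<lambda>t. (t - a)\<^sup>2 * f t)" by (rule C1_on_poly_mult(4)[OF _ C1]) simp
    from cpd_on_refl_fun[OF this cpd]
    show "cpd_on {a<..<b} (Suc n) (\<lambda>t. (b - t)\<^sup>2 * g t)"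
      by (simp add: refl_fun_def g_def)
    fix e :: real assume e: "e > 0"
    show "\<exists>\<^sub>F t in at_left b. - e < (b - t) * g t"
      using frequently_at_left_reflect[OF f1[OF e], of b]
      by (rule frequently_elim1) (simp add: g_def refl_fun_def)
    show "\<exists>\<^sub>F t in at_left b. (b - t)\<^sup>2 * g t < e"
      using frequently_at_left_reflect[OF f2[OF e], of b]
      by (rule frequently_elim1) (simp add: g_def refl_fun_def)
  qed
  from psd_on_refl_fun[OF C1g this] show ?thesis by (simp add: g_def)
qed

lemma psd_on_2_bound_left:
  assumes C1: "C1_on {a<..<b} f" and psd: "psd_on {a<..<b} 2 f" and ab: "a < b"
  obtains C where "\<And>t. a < t \<Longrightarrow> t < (a + b) / 2 \<Longrightarrow> C \<le> (t - a) * f t"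
proof -
  obtain C where C: "\<And>t. (a + b) / 2 < t \<Longrightarrow> t < b \<Longrightarrow> (b - t) * refl_fun (a + b) f t \<le> C"
    using psd_on_2_bound[OF C1_on_refl_fun[OF C1] psd_on_refl_fun[OF C1 psd] ab] by blast
  show thesis
  proof (rule that[of "- C"])
    fix t assume "a < t" "t < (a + b) / 2"
    then show "- C \<le> (t - a) * f t" using C[of "a + b - t"] by (simp add: refl_fun_def)
  qed
qed

section \<open>Weighted point sets and lists of points\<close>

lemma double_sum_eq_kform:
  assumes "\<And>\<phi>. (\<Sum>i<n. x i * \<phi> (t i)) = (\<Sum>s\<in>S. w s * \<phi> s)"
  shows "(\<Sum>i<n. \<Sum>j<n. x i * x j * K (t i) (t j)) = kform K S w"
proof -
  have "(\<Sum>i<n. \<Sum>j<n. x i * x j * K (t i) (t j)) = (\<Sum>i<n. x i * (\<Sum>j<n. x j * K (t i) (t j)))"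
    by (simp add: sum_distrib_left mult.assoc)
  \<comment> \<open>The assumption says that both weighted families define the same discrete
    measure. It is used once in each variable of the kernel, here in the second one.\<close>
  also have "\<dots> = (\<Sum>i<n. x i * (\<Sum>u\<in>S. w u * K (t i) u))"
    using assms[of "K _"] by simp
  also have "\<dots> = (\<Sum>s\<in>S. w s * (\<Sum>u\<in>S. w u * K s u))"
    using assms[of "\<lambda>s. \<Sum>u\<in>S. w u * K s u"] by simp
  also have "\<dots> = kform K S w" by (simp add: kform_def sum_distrib_left mult.assoc)
  finally show ?thesis .
qed

lemma points_of_indexed:
  fixes t :: "nat \<Rightarrow> real" and x :: "nat \<Rightarrow> real"
  shows "\<exists>w. \<forall>\<phi>. (\<Sum>i<n. x i * \<phi> (t i)) = (\<Sum>s\<in>t ` {..<n}. w s * \<phi> s)"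
proof (intro exI allI)
  fix \<phi> :: "real \<Rightarrow> real"
  have "(\<Sum>i<n. x i * \<phi> (t i)) = (\<Sum>s\<in>t ` {..<n}. \<Sum>i\<in>{i \<in> {..<n}. t i = s}. x i * \<phi> (t i))"
    by (rule sum.image_gen) simp
  also have "\<dots> = (\<Sum>s\<in>t ` {..<n}. (\<lambda>s. \<Sum>i\<in>{i \<in> {..<n}. t i = s}. x i) s * \<phi> s)"
    by (intro sum.cong refl) (simp add: sum_distrib_right)
  finally show "(\<Sum>i<n. x i * \<phi> (t i)) = (\<Sum>s\<in>t ` {..<n}. (\<lambda>s. \<Sum>i\<in>{i \<in> {..<n}. t i = s}. x i) s * \<phi> s)" .
qed

lemma indexed_of_points:
  fixes S :: "real set"
  assumes S: "finite S" "S \<subseteq> J" "card S \<le> n" and c: "c \<in> J"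
  shows "\<exists>ts x. length ts = n \<and> set ts \<subseteq> J \<and>
    (\<forall>\<phi>. (\<Sum>i<n. x i * \<phi> (ts ! i)) = (\<Sum>s\<in>S. w s * \<phi> s :: real))"
proof -
  define xs where "xs = sorted_list_of_set S"
  have xs: "set xs = S" "distinct xs" "length xs = card S" using S(1) by (auto simp: xs_def)
  \<comment> \<open>The conditions of the theorem ask for lists of length exactly \<open>n\<close>;
    missing points are filled with copies of \<open>c\<close> of weight 0.\<close>
  define ts where "ts = xs @ replicate (n - card S) c"
  define x where "x = (\<lambda>i. if i < card S then w (ts ! i) else 0)"
  show ?thesis
  proof (intro exI[of _ ts] exI[of _ x] conjI allI)
    show "length ts = n" using S xs by (simp add: ts_def)
    show "set ts \<subseteq> J" using S xs c by (auto simp: ts_def)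
    fix \<phi> :: "real \<Rightarrow> real"
    have "(\<Sum>i<n. x i * \<phi> (ts ! i)) = (\<Sum>i<card S. x i * \<phi> (ts ! i))"
      by (rule sum.mono_neutral_right) (use S in \<open>auto simp: x_def\<close>)
    also have "\<dots> = (\<Sum>i<card S. w (xs ! i) * \<phi> (xs ! i))"
      by (intro sum.cong refl) (simp add: x_def ts_def nth_append xs)
    also have "\<dots> = (\<Sum>s\<in>S. w s * \<phi> s)"
      by (rule sum.reindex_bij_betw[OF bij_betw_nth[OF xs(2)]]) (use xs in auto)
    finally show "(\<Sum>i<n. x i * \<phi> (ts ! i)) = (\<Sum>s\<in>S. w s * \<phi> s)" .
  qed
qed

lemma psd_on_indexed:
  assumes "psd_on J n f" "\<And>i. i < n \<Longrightarrow> t i \<in> J"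
  shows "0 \<le> (\<Sum>i<n. \<Sum>j<n. x i * x j * divided_diff f (t i) (t j))"
proof -
  obtain w where "\<forall>\<phi>. (\<Sum>i<n. x i * \<phi> (t i)) = (\<Sum>s\<in>t ` {..<n}. w s * \<phi> s)"
    using points_of_indexed[where n = n and x = x and t = t] by blast
  then have w: "(\<Sum>i<n. x i * \<phi> (t i)) = (\<Sum>s\<in>t ` {..<n}. w s * \<phi> s)" for \<phi> by blast
  from double_sum_eq_kform[where n = n and x = x and t = t and w = w and K = "divided_diff f", OF w] show ?thesis
    using assms card_image_le[of "{..<n}" t] unfolding psd_on_def by auto
qed

section \<open>Complex vectors and Loewner matrices\<close>

lemma quadratic_form_eq:
  fixes A :: "complex mat"
  assumes "A \<in> carrier_mat n n" "x \<in> carrier_vec n"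
  shows "(A *\<^sub>v x) \<bullet>c x = (\<Sum>i<n. \<Sum>j<n. A $$ (i,j) * vec_index x j * cnj (vec_index x i))"
proof -
  have "(A *\<^sub>v x) \<bullet>c x = (\<Sum>i<n. vec_index (A *\<^sub>v x) i * cnj (vec_index x i))"
    using assms by (simp add: scalar_prod_def atLeast0LessThan)
  also have "\<dots> = (\<Sum>i<n. \<Sum>j<n. A $$ (i,j) * vec_index x j * cnj (vec_index x i))"
    by (intro sum.cong refl) (use assms in \<open>simp add: scalar_prod_def atLeast0LessThan sum_distrib_right\<close>)
  finally show ?thesis .
qed

text \<open>The cross terms between real and imaginary parts cancel by symmetry, so a complex form
  splits into two real ones.\<close>

lemma real_symmetric_form:
  fixes k :: "nat \<Rightarrow> nat \<Rightarrow> real" and x :: "nat \<Rightarrow> complex"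
  assumes "\<And>i j. k i j = k j i"
  shows "(\<Sum>i<n. \<Sum>j<n. complex_of_real (k i j) * x j * cnj (x i))
    = of_real ((\<Sum>i<n. \<Sum>j<n. Re (x i) * Re (x j) * k i j) + (\<Sum>i<n. \<Sum>j<n. Im (x i) * Im (x j) * k i j))"
proof (rule complex_eqI)
  have re: "Re (complex_of_real (k i j) * x j * cnj (x i)) = Re (x i) * Re (x j) * k i j + Im (x i) * Im (x j) * k i j"
    and im: "Im (complex_of_real (k i j) * x j * cnj (x i)) = k i j * Im (x j) * Re (x i) - k i j * Re (x j) * Im (x i)"
    for i j by (simp_all add: algebra_simps)
  show "Re (\<Sum>i<n. \<Sum>j<n. complex_of_real (k i j) * x j * cnj (x i))
    = Re (of_real ((\<Sum>i<n. \<Sum>j<n. Re (x i) * Re (x j) * k i j) + (\<Sum>i<n. \<Sum>j<n. Im (x i) * Im (x j) * k i j)))"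
    by (simp only: Re_sum re Re_complex_of_real sum.distrib)
  have "(\<Sum>i<n. \<Sum>j<n. k i j * Im (x j) * Re (x i)) = (\<Sum>j<n. \<Sum>i<n. k i j * Im (x j) * Re (x i))"
    by (rule sum.swap)
  also have "\<dots> = (\<Sum>i<n. \<Sum>j<n. k i j * Re (x j) * Im (x i))"
  proof (intro sum.cong refl)
    fix i j
    show "k j i * Im (x i) * Re (x j) = k i j * Re (x j) * Im (x i)" using assms[of j i] by simp
  qed
  finally show "Im (\<Sum>i<n. \<Sum>j<n. complex_of_real (k i j) * x j * cnj (x i))
    = Im (of_real ((\<Sum>i<n. \<Sum>j<n. Re (x i) * Re (x j) * k i j) + (\<Sum>i<n. \<Sum>j<n. Im (x i) * Im (x j) * k i j)))"
    by (simp only: Im_sum im Im_complex_of_real sum_subtractf diff_self)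
qed

lemma hermitianI:
  assumes "A \<in> carrier_mat n n" "\<And>i j. i < n \<Longrightarrow> j < n \<Longrightarrow> A $$ (i,j) = cnj (A $$ (j,i))"
  shows "hermitian A"
  unfolding hermitian_def
proof (rule eq_matI)
  show "mat_adjoint A $$ (i, j) = A $$ (i, j)" if "i < dim_row A" "j < dim_col A" for i j
    using that assms(1) assms(2)[of i j, symmetric] by (simp add: mat_adjoint_def mat_of_rows_def)
qed (use assms(1) in \<open>auto simp: mat_adjoint_def\<close>)

text \<open>From matrices to point sets, a point of the nonempty \<open>J\<close> pads the list.
  Conversely, the real and the imaginary part of a vector with sum zero both have sum zero, so each
  contributes a nonnegative real form.\<close>

lemma cond_pos_def_loewner_iff:
  assumes "J \<noteq> {}"
  shows "(\<forall>ts. length ts = n \<and> set ts \<subseteq> J \<longrightarrow> cond_pos_def (loewner_mat g ts)) \<longleftrightarrow> cpd_on J n g"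
proof
  assume L: "\<forall>ts. length ts = n \<and> set ts \<subseteq> J \<longrightarrow> cond_pos_def (loewner_mat g ts)"
  show "cpd_on J n g"
    unfolding cpd_on_def
  proof (intro allI impI, elim conjE)
    fix S w assume S: "finite S" "S \<subseteq> J" "card S \<le> n" and w: "sum w S = (0::real)"
    obtain c where c: "c \<in> J" using assms by blast
    obtain ts x where ts: "length ts = n" "set ts \<subseteq> J"
      and x': "\<forall>\<phi>. (\<Sum>i<n. x i * \<phi> (ts ! i)) = (\<Sum>s\<in>S. w s * \<phi> s)"
      using indexed_of_points[OF S c, of w] by blast
    have x: "(\<Sum>i<n. x i * \<phi> (ts ! i)) = (\<Sum>s\<in>S. w s * \<phi> s)" for \<phi> using x' by blast
    define v where "v = vec n (\<lambda>i. complex_of_real (x i))"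
    have v: "v \<in> carrier_vec n" by (simp add: v_def)
    have "(\<Sum>i<n. vec_index v i) = 0"
      using x[of "\<lambda>_. 1"] w by (simp add: v_def flip: of_real_sum)
    then have "0 \<le> (loewner_mat g ts *\<^sub>v v) \<bullet>c v"
      using L ts v unfolding cond_pos_def_def by (auto simp: loewner_mat_def)
    also have "\<dots> = (\<Sum>i<n. \<Sum>j<n. complex_of_real (divided_diff g (ts ! i) (ts ! j)) * vec_index v j * cnj (vec_index v i))"
      using quadratic_form_eq[OF _ v, of "loewner_mat g ts"] ts by (simp add: loewner_mat_def)
    also have "\<dots> = of_real (\<Sum>i<n. \<Sum>j<n. x i * x j * divided_diff g (ts ! i) (ts ! j))"
      by (subst real_symmetric_form) (rule divided_diff_commute, simp add: v_def)
    finally show "0 \<le> kform (divided_diff g) S w"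
      by (subst (asm) double_sum_eq_kform[where n = n and x = x and t = "(!) ts" and w = w and S = S, OF x]) (simp add: less_eq_complex_def)
  qed
next
  assume C: "cpd_on J n g"
  show "\<forall>ts. length ts = n \<and> set ts \<subseteq> J \<longrightarrow> cond_pos_def (loewner_mat g ts)"
  proof (intro allI impI, elim conjE)
    fix ts assume ts: "length ts = n" "set ts \<subseteq> J"
    have L: "loewner_mat g ts \<in> carrier_mat n n" using ts by (simp add: loewner_mat_def)
    have pos: "0 \<le> (\<Sum>i<n. \<Sum>j<n. x i * x j * divided_diff g (ts ! i) (ts ! j))"
      if "(\<Sum>i<n. x i) = 0" for x :: "nat \<Rightarrow> real"
    proof -
      obtain w where w': "\<forall>\<phi>. (\<Sum>i<n. x i * \<phi> (ts ! i)) = (\<Sum>s\<in>(!) ts ` {..<n}. w s * \<phi> s)"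
        using points_of_indexed[where n = n and x = x and t = "(!) ts"] by blast
      have w: "(\<Sum>i<n. x i * \<phi> (ts ! i)) = (\<Sum>s\<in>(!) ts ` {..<n}. w s * \<phi> s)" for \<phi> using w' by blast
      have "sum w ((!) ts ` {..<n}) = 0" using w[of "\<lambda>_. 1"] that by simp
      moreover have "(!) ts ` {..<n} \<subseteq> J" using ts by auto
      ultimately show ?thesis
        unfolding double_sum_eq_kform[where n = n and x = x and t = "(!) ts" and w = w and K = "divided_diff g", OF w]
        using C card_image_le[of "{..<n}" "(!) ts"] unfolding cpd_on_def by auto
    qed
    show "cond_pos_def (loewner_mat g ts)"
      unfolding cond_pos_def_def
    proof (intro conjI ballI impI)
      show "hermitian (loewner_mat g ts)"
      proof (rule hermitianI[OF L])
        fix i j assume "i < n" "j < n"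
        then show "loewner_mat g ts $$ (i, j) = cnj (loewner_mat g ts $$ (j, i))"
          using ts divided_diff_commute[of g "ts ! i" "ts ! j"] by (simp add: loewner_mat_def)
      qed
      fix x :: "complex Matrix.vec" assume x: "x \<in> carrier_vec (dim_row (loewner_mat g ts))"
        and "(\<Sum>i<dim_row (loewner_mat g ts). vec_index x i) = 0"
      then have x: "x \<in> carrier_vec n" and 0: "(\<Sum>i<n. vec_index x i) = 0" using L by auto
      have "(\<Sum>i<n. Re (vec_index x i)) = 0" "(\<Sum>i<n. Im (vec_index x i)) = 0"
        using 0 by (simp_all flip: Re_sum Im_sum)
      note p = pos[OF this(1)] pos[OF this(2)]
      have "(loewner_mat g ts *\<^sub>v x) \<bullet>c x
        = (\<Sum>i<n. \<Sum>j<n. complex_of_real (divided_diff g (ts ! i) (ts ! j)) * vec_index x j * cnj (vec_index x i))"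
        unfolding quadratic_form_eq[OF L x] using ts by (simp add: loewner_mat_def)
      also have "0 \<le> \<dots>"
        by (subst real_symmetric_form, rule divided_diff_commute) (use p in \<open>auto simp: less_eq_complex_def\<close>)
      finally show "0 \<le> (loewner_mat g ts *\<^sub>v x) \<bullet>c x" .
    qed
  qed
qed

lemma cond_neg_def_loewner_iff:
  assumes "J \<noteq> {}" "C1_on J g"
  shows "(\<forall>ts. length ts = n \<and> set ts \<subseteq> J \<longrightarrow> cond_neg_def (loewner_mat g ts)) \<longleftrightarrow> cpd_on J n (\<lambda>t. - g t)"
proof -
  have "- loewner_mat g ts = loewner_mat (\<lambda>t. - g t) ts" if "set ts \<subseteq> J" for ts
  proof (rule eq_matI)
    fix i j assume "i < dim_row (loewner_mat (\<lambda>t. - g t) ts)" "j < dim_col (loewner_mat (\<lambda>t. - g t) ts)"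
    then have ij: "i < length ts" "j < length ts" by (auto simp: loewner_mat_def)
    then have "ts ! i \<in> J" using that nth_mem by blast
    from divided_diff_minus[OF assms(2) this] ij
    show "(- loewner_mat g ts) $$ (i, j) = loewner_mat (\<lambda>t. - g t) ts $$ (i, j)"
      by (simp add: loewner_mat_def)
  qed (auto simp: loewner_mat_def)
  then show ?thesis unfolding cond_neg_def_def cond_pos_def_loewner_iff[OF assms(1), symmetric] by auto
qed

section \<open>Diagonalization of Hermitian matrices\<close>

lemma index_mult_mat_sum:
  assumes "A \<in> carrier_mat n m" "B \<in> carrier_mat m p" "i < n" "j < p"
  shows "(A * B) $$ (i,j) = (\<Sum>k<m. A $$ (i,k) * B $$ (k,j))"
  using assms by (simp add: scalar_prod_def atLeast0LessThan)

lemma mat_adjoint_carrier: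
  "A \<in> carrier_mat n m \<Longrightarrow> mat_adjoint A \<in> carrier_mat m n"
  by (auto simp: mat_adjoint_def)

lemma index_mat_adjoint:
  "i < dim_col A \<Longrightarrow> j < dim_row A \<Longrightarrow> mat_adjoint A $$ (i,j) = cnj (A $$ (j,i))"
  by (simp add: mat_adjoint_def mat_of_rows_def)

lemma mat_adjoint_adjoint [simp]: "mat_adjoint (mat_adjoint A) = (A :: complex mat)"
  by (rule eq_matI) (auto simp: index_mat_adjoint mat_adjoint_def mat_of_rows_def)

lemma mat_adjoint_mult:
  fixes A B :: "complex mat"
  assumes A: "A \<in> carrier_mat n m" and B: "B \<in> carrier_mat m p"
  shows "mat_adjoint (A * B) = mat_adjoint B * mat_adjoint A"
proof (rule eq_matI)
  have AB: "A * B \<in> carrier_mat n p" using A B by simp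
  have BA: "mat_adjoint B * mat_adjoint A \<in> carrier_mat p n"
    by (rule mult_carrier_mat[OF mat_adjoint_carrier[OF B] mat_adjoint_carrier[OF A]])
  show "dim_row (mat_adjoint (A * B)) = dim_row (mat_adjoint B * mat_adjoint A)"
    "dim_col (mat_adjoint (A * B)) = dim_col (mat_adjoint B * mat_adjoint A)"
    using mat_adjoint_carrier[OF AB] BA by (metis carrier_matD)+
  fix i j assume "i < dim_row (mat_adjoint B * mat_adjoint A)" "j < dim_col (mat_adjoint B * mat_adjoint A)"
  then have ij: "i < p" "j < n" using BA by auto
  show "mat_adjoint (A * B) $$ (i, j) = (mat_adjoint B * mat_adjoint A) $$ (i, j)"
    using ij A B AB
    by (simp add: index_mat_adjoint index_mult_mat_sum[OF A B]
        index_mult_mat_sum[OF mat_adjoint_carrier[OF B] mat_adjoint_carrier[OF A]] mult.commute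
        del: index_mult_mat(1))
qed

lemma index_unitary_conj:
  fixes U :: "complex mat"
  assumes U: "U \<in> carrier_mat n n" and ij: "i < n" "j < n"
  shows "(U * mat_diag n f * mat_adjoint U) $$ (i,j) = (\<Sum>k<n. U $$ (i,k) * f k * cnj (U $$ (j,k)))"
proof -
  have UD: "U * mat_diag n f \<in> carrier_mat n n" by (rule mult_carrier_mat[OF U mat_diag_dim])
  have "(U * mat_diag n f) $$ (i,k) = U $$ (i,k) * f k" if "k < n" for k
    unfolding mat_diag_mult_right[OF U] using that ij by simp
  then show ?thesis
    unfolding index_mult_mat_sum[OF UD mat_adjoint_carrier[OF U] ij]
    using U ij by (intro sum.cong refl) (simp add: index_mat_adjoint)
qed

lemma unitary_inverse:
  assumes "U \<in> carrier_mat n n" "mat_adjoint U * U = 1\<^sub>m n"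
  shows "U * mat_adjoint U = 1\<^sub>m n"
  by (rule mat_mult_left_right_inverse[OF mat_adjoint_carrier[OF assms(1)] assms])

lemma unitary_sum:
  fixes U :: "complex mat"
  assumes U: "U \<in> carrier_mat n n" and UU: "mat_adjoint U * U = 1\<^sub>m n" and ij: "i < n" "j < n"
  shows "(\<Sum>k<n. cnj (U $$ (k,i)) * U $$ (k,j)) = (if i = j then 1 else 0)"
    and "(\<Sum>k<n. U $$ (i,k) * cnj (U $$ (j,k))) = (if i = j then 1 else 0)"
proof -
  have "(mat_adjoint U * U) $$ (i,j) = (\<Sum>k<n. cnj (U $$ (k,i)) * U $$ (k,j))"
    unfolding index_mult_mat_sum[OF mat_adjoint_carrier[OF U] U ij]
    using U ij by (intro sum.cong refl) (simp add: index_mat_adjoint)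
  then show "(\<Sum>k<n. cnj (U $$ (k,i)) * U $$ (k,j)) = (if i = j then 1 else 0)"
    unfolding UU using ij by simp
  have "(U * mat_adjoint U) $$ (i,j) = (\<Sum>k<n. U $$ (i,k) * cnj (U $$ (j,k)))"
    unfolding index_mult_mat_sum[OF U mat_adjoint_carrier[OF U] ij]
    using U ij by (intro sum.cong refl) (simp add: index_mat_adjoint)
  then show "(\<Sum>k<n. U $$ (i,k) * cnj (U $$ (j,k))) = (if i = j then 1 else 0)"
    unfolding unitary_inverse[OF U UU] using ij by simp
qed

text \<open>Completing \<open>v\<close> to a basis and orthogonalising leaves the first vector
  unchanged. \<open>gram_schmidt\<close> does not normalise, so the columns are divided by their
  norms, and \<open>c\<close> is the reciprocal of the norm of \<open>v\<close>.\<close>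

lemma unitary_with_first_column:
  fixes v :: "complex Matrix.vec"
  assumes v: "v \<in> carrier_vec n" "v \<noteq> 0\<^sub>v n"
  obtains W c where "W \<in> carrier_mat n n" "mat_adjoint W * W = 1\<^sub>m n"
    "\<And>i. i < n \<Longrightarrow> W $$ (i,0) = c * vec_index v i"
proof -
  interpret cof_vec_space n "TYPE(complex)" .
  define b where "b = basis_completion v"
  define ws where "ws = gram_schmidt n b"
  from basis_completion[OF v, folded b_def]
  have b: "distinct b" "\<not> lin_dep (set b)" "set b \<subseteq> carrier_vec n" "hd b = v" "length b = n" by auto
  have n: "n > 0"
  proof (rule ccontr)
    assume "\<not> n > 0"
    then have "v = 0\<^sub>v n" using v(1) by (intro eq_vecI) auto
    then show False using v(2) by simp
  qed
  from b(4,5) n obtain vs where bv: "b = v # vs" by (cases b) auto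
  from gram_schmidt_result[OF b(3,1,2) refl, folded ws_def]
  have ws: "set ws \<subseteq> carrier_vec n" "corthogonal ws" "length ws = n" by (auto simp: b(5))
  have hdws: "hd ws = v" unfolding ws_def bv by (rule gram_schmidt_hd[OF v(1)])
  have w0: "ws ! 0 = v" using hdws ws(3) n by (cases ws) auto
  have wc: "ws ! i \<in> carrier_vec n" if "i < n" for i using ws that by auto
  define N where "N = (\<lambda>j. \<Sum>k<n. (cmod (vec_index (ws ! j) k))\<^sup>2)"
  have ip: "(ws ! i) \<bullet>c (ws ! j) = (\<Sum>k<n. vec_index (ws ! i) k * cnj (vec_index (ws ! j) k))"
    if "i < n" "j < n" for i j
    using wc[OF that(1)] wc[OF that(2)] by (simp add: scalar_prod_def atLeast0LessThan)
  have ipN: "(ws ! j) \<bullet>c (ws ! j) = of_real (N j)" if "j < n" for j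
    unfolding ip[OF that that] N_def by (simp only: of_real_sum complex_norm_square)
  have Npos: "N j > 0" if "j < n" for j
  proof -
    have "(ws ! j) \<bullet>c (ws ! j) \<noteq> 0" using corthogonalD[OF ws(2), of j j] that ws(3) by auto
    then have "N j \<noteq> 0" unfolding ipN[OF that] by simp
    moreover have "N j \<ge> 0" unfolding N_def by (intro sum_nonneg) auto
    ultimately show ?thesis by simp
  qed
  define W where "W = Matrix.mat n n (\<lambda>(i,j). vec_index (ws ! j) i / of_real (sqrt (N j)))"
  have W: "W \<in> carrier_mat n n" by (simp add: W_def)
  have "mat_adjoint W * W = 1\<^sub>m n"
  proof (rule eq_matI)
    fix i j assume "i < dim_row (1\<^sub>m n)" "j < dim_col (1\<^sub>m n)"
    then have ij: "i < n" "j < n" by auto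
    have "(mat_adjoint W * W) $$ (i,j) = (\<Sum>k<n. vec_index (ws ! j) k * cnj (vec_index (ws ! i) k)
        / (of_real (sqrt (N i)) * of_real (sqrt (N j))))"
      unfolding index_mult_mat_sum[OF mat_adjoint_carrier[OF W] W ij]
      using ij by (intro sum.cong refl) (simp add: W_def index_mat_adjoint mult.commute)
    also have "\<dots> = (ws ! j) \<bullet>c (ws ! i) / (of_real (sqrt (N i)) * of_real (sqrt (N j)))"
      unfolding ip[OF ij(2,1)] by (rule sum_divide_distrib[symmetric])
    also have "\<dots> = (if i = j then 1 else 0)"
    proof (cases "i = j")
      case True
      have "complex_of_real (sqrt (N j)) * of_real (sqrt (N j)) = of_real (N j)"
        using Npos[OF ij(2)] by (simp flip: of_real_mult)
      then show ?thesis using True Npos[OF ij(2)] by (simp add: ipN[OF ij(2)])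
    next
      case False
      then have "(ws ! j) \<bullet>c (ws ! i) = 0" using corthogonalD[OF ws(2), of j i] ij ws(3) by auto
      then show ?thesis using False by simp
    qed
    finally show "(mat_adjoint W * W) $$ (i,j) = 1\<^sub>m n $$ (i,j)" using ij by simp
  qed (use W in \<open>auto simp: mat_adjoint_def\<close>)
  moreover have "W $$ (i,0) = (1 / of_real (sqrt (N 0))) * vec_index v i" if "i < n" for i
    using that n w0 by (simp add: W_def)
  ultimately show thesis using that W by blast
qed

lemma hermitian_index:
  assumes "A \<in> carrier_mat n n" "hermitian A" "i < n" "j < n"
  shows "A $$ (i,j) = cnj (A $$ (j,i))"
  using assms index_mat_adjoint[of i A j] by (simp add: hermitian_def)

lemma hermitian_unitary_conj:
  assumes A: "A \<in> carrier_mat n n" "hermitian A" and W: "W \<in> carrier_mat n n"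
  shows "hermitian (mat_adjoint W * A * W)"
proof -
  have W': "mat_adjoint W \<in> carrier_mat n n" by (rule mat_adjoint_carrier[OF W])
  have "mat_adjoint (mat_adjoint W * A * W) = mat_adjoint W * (A * W)"
    unfolding mat_adjoint_mult[OF mult_carrier_mat[OF W' A(1)] W] mat_adjoint_mult[OF W' A(1)]
    using A(2) by (simp add: hermitian_def)
  also have "\<dots> = mat_adjoint W * A * W" by (rule assoc_mult_mat[OF W' A(1) W, symmetric])
  finally show ?thesis by (simp add: hermitian_def)
qed

text \<open>Deflation: conjugating by a unitary matrix whose first column is an eigenvector clears
  the first column below the diagonal, and being Hermitian then clears the first row. The remaining
  block of size \<open>n\<close> is diagonalised by induction and bordered by a 1.\<close>

theorem hermitian_diagonalization:
  assumes "A \<in> carrier_mat n n" "hermitian A"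
  shows "\<exists>U d. U \<in> carrier_mat n n \<and> mat_adjoint U * U = 1\<^sub>m n \<and>
    A = U * mat_diag n (\<lambda>i. complex_of_real (d i)) * mat_adjoint U"
  using assms
proof (induction n arbitrary: A)
  case 0
  have eq: "M = N" if "M \<in> carrier_mat 0 0" "N \<in> carrier_mat 0 0" for M N :: "complex mat"
    using that by (intro eq_matI) auto
  have Z: "(0\<^sub>m 0 0 :: complex mat) \<in> carrier_mat 0 0" by simp
  note Z' = mat_adjoint_carrier[OF Z]
  show ?case
    using Z eq[OF mult_carrier_mat[OF Z' Z] one_carrier_mat]
      eq[OF 0(1) mult_carrier_mat[OF mult_carrier_mat[OF Z mat_diag_dim] Z']] by blast
next
  case (Suc n)
  note A = Suc.prems(1) and hA = Suc.prems(2)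
  obtain e where "eigenvalue A e" using spectrum_non_empty[OF A] by (auto simp: spectrum_def)
  then obtain v where v: "v \<in> carrier_vec (Suc n)" "v \<noteq> 0\<^sub>v (Suc n)" and Av: "A *\<^sub>v v = e \<cdot>\<^sub>v v"
    using A by (auto simp: eigenvalue_def eigenvector_def)
  obtain W c where W: "W \<in> carrier_mat (Suc n) (Suc n)" and WW: "mat_adjoint W * W = 1\<^sub>m (Suc n)"
    and Wc: "\<And>i. i < Suc n \<Longrightarrow> W $$ (i,0) = c * vec_index v i"
    by (rule unitary_with_first_column[OF v]) blast
  have W': "mat_adjoint W \<in> carrier_mat (Suc n) (Suc n)" by (rule mat_adjoint_carrier[OF W])
  note WW2 = unitary_inverse[OF W WW]
  define A' where "A' = mat_adjoint W * A * W"
  have A': "A' \<in> carrier_mat (Suc n) (Suc n)"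
    unfolding A'_def by (rule mult_carrier_mat[OF mult_carrier_mat[OF W' A] W])
  have hA': "hermitian A'" unfolding A'_def by (rule hermitian_unitary_conj[OF A hA W])
  have AW: "A * W \<in> carrier_mat (Suc n) (Suc n)" by (rule mult_carrier_mat[OF A W])
  have AWk: "(A * W) $$ (k,0) = e * W $$ (k,0)" if k: "k < Suc n" for k
  proof -
    have "(A * W) $$ (k,0) = c * (\<Sum>l<Suc n. A $$ (k,l) * vec_index v l)"
      unfolding index_mult_mat_sum[OF A W k zero_less_Suc] sum_distrib_left
      by (intro sum.cong refl) (simp add: Wc)
    also have "(\<Sum>l<Suc n. A $$ (k,l) * vec_index v l) = vec_index (A *\<^sub>v v) k"
      using A v k by (simp add: scalar_prod_def atLeast0LessThan)
    also have "\<dots> = e * vec_index v k" unfolding Av using v k by simp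
    finally show ?thesis using Wc[OF k] by simp
  qed
  have col0: "A' $$ (i,0) = (if i = 0 then e else 0)" if i: "i < Suc n" for i
  proof -
    have "A' $$ (i,0) = (mat_adjoint W * (A * W)) $$ (i,0)"
      unfolding A'_def by (subst assoc_mult_mat[OF W' A W]) (rule refl)
    also have "\<dots> = (\<Sum>k<Suc n. mat_adjoint W $$ (i,k) * (A * W) $$ (k,0))"
      by (rule index_mult_mat_sum[OF W' AW i zero_less_Suc])
    also have "\<dots> = (\<Sum>k<Suc n. e * (mat_adjoint W $$ (i,k) * W $$ (k,0)))"
      by (intro sum.cong refl) (simp add: AWk del: index_mult_mat)
    also have "\<dots> = e * (mat_adjoint W * W) $$ (i,0)"
      unfolding index_mult_mat_sum[OF W' W i zero_less_Suc] by (rule sum_distrib_left[symmetric])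
    finally show ?thesis unfolding WW using i by simp
  qed
  define A3 where "A3 = Matrix.mat n n (\<lambda>(i,j). A' $$ (Suc i, Suc j))"
  have A3: "A3 \<in> carrier_mat n n" by (simp add: A3_def)
  have "hermitian A3"
  proof (rule hermitianI[OF A3])
    fix i j assume "i < n" "j < n"
    then show "A3 $$ (i,j) = cnj (A3 $$ (j,i))"
      using hermitian_index[OF A' hA', of "Suc i" "Suc j"] by (simp add: A3_def)
  qed
  from Suc.IH[OF A3 this] obtain U3 d3 where U3: "U3 \<in> carrier_mat n n"
    and UU3: "mat_adjoint U3 * U3 = 1\<^sub>m n"
    and A3e: "A3 = U3 * mat_diag n (\<lambda>i. complex_of_real (d3 i)) * mat_adjoint U3" by blast
  define V where "V = Matrix.mat (Suc n) (Suc n)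
    (\<lambda>(i,j). case i of 0 \<Rightarrow> (case j of 0 \<Rightarrow> 1 | Suc _ \<Rightarrow> 0) | Suc i' \<Rightarrow> (case j of 0 \<Rightarrow> 0 | Suc j' \<Rightarrow> U3 $$ (i',j')))"
  have V: "V \<in> carrier_mat (Suc n) (Suc n)" by (simp add: V_def)
  have V': "mat_adjoint V \<in> carrier_mat (Suc n) (Suc n)" by (rule mat_adjoint_carrier[OF V])
  define d where "d = (\<lambda>i. case i of 0 \<Rightarrow> Re e | Suc i' \<Rightarrow> d3 i')"
  have Vi: "V $$ (0,0) = 1" "j < n \<Longrightarrow> V $$ (0,Suc j) = 0" "i < n \<Longrightarrow> V $$ (Suc i,0) = 0"
    "i < n \<Longrightarrow> j < n \<Longrightarrow> V $$ (Suc i,Suc j) = U3 $$ (i,j)" for i j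
    by (auto simp: V_def)
  have VV: "mat_adjoint V * V = 1\<^sub>m (Suc n)"
  proof (rule eq_matI)
    fix i j assume "i < dim_row (1\<^sub>m (Suc n))" "j < dim_col (1\<^sub>m (Suc n))"
    then have ij: "i < Suc n" "j < Suc n" by auto
    have "(mat_adjoint V * V) $$ (i,j) = (\<Sum>k<Suc n. cnj (V $$ (k,i)) * V $$ (k,j))"
      unfolding index_mult_mat_sum[OF V' V ij] using V ij by (intro sum.cong refl) (simp add: index_mat_adjoint)
    also have "\<dots> = (if i = j then 1 else 0)"
      unfolding sum.lessThan_Suc_shift
      by (cases i; cases j) (use ij in \<open>auto simp: Vi unitary_sum[OF U3 UU3]\<close>)
    finally show "(mat_adjoint V * V) $$ (i,j) = 1\<^sub>m (Suc n) $$ (i,j)" using ij by simp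
  qed (use V in \<open>auto simp: mat_adjoint_def\<close>)
  define D where "D = mat_diag (Suc n) (\<lambda>i. complex_of_real (d i))"
  have D: "D \<in> carrier_mat (Suc n) (Suc n)" by (simp add: D_def)
  \<comment> \<open>The eigenvalue appears as a diagonal entry of a Hermitian matrix and is
    therefore real.\<close>
  have e: "e = of_real (Re e)"
    using hermitian_index[OF A' hA', of 0 0] col0[of 0] by (simp add: complex_eq_iff)
  have A'e: "A' = V * D * mat_adjoint V"
  proof (rule eq_matI)
    fix i j assume "i < dim_row (V * D * mat_adjoint V)" "j < dim_col (V * D * mat_adjoint V)"
    then have ij: "i < Suc n" "j < Suc n" using V V' D by auto
    have "(V * D * mat_adjoint V) $$ (i,j) = (\<Sum>k<Suc n. V $$ (i,k) * of_real (d k) * cnj (V $$ (j,k)))"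
      unfolding D_def by (rule index_unitary_conj[OF V ij])
    also have "\<dots> = A' $$ (i,j)"
    proof (cases i)
      case 0
      show ?thesis
      proof (cases j)
        case 0
        then show ?thesis using \<open>i = 0\<close> e col0[of 0] unfolding sum.lessThan_Suc_shift
          by (simp add: Vi d_def)
      next
        case (Suc j')
        then have "A' $$ (i,j) = 0"
          using \<open>i = 0\<close> hermitian_index[OF A' hA', of 0 j] col0[of j] ij by simp
        then show ?thesis using Suc \<open>i = 0\<close> ij unfolding sum.lessThan_Suc_shift
          by (simp add: Vi)
      qed
    next
      case (Suc i')
      show ?thesis
      proof (cases j)
        case 0
        then show ?thesis using \<open>i = Suc i'\<close> col0[of i] ij unfolding sum.lessThan_Suc_shift
          by (simp add: Vi)
      next
        case (Suc j')
        have ij': "i' < n" "j' < n" using ij \<open>i = Suc i'\<close> Suc by auto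
        have "A' $$ (i,j) = A3 $$ (i',j')" using ij' \<open>i = Suc i'\<close> Suc by (simp add: A3_def)
        also have "\<dots> = (\<Sum>k<n. U3 $$ (i',k) * of_real (d3 k) * cnj (U3 $$ (j',k)))"
          unfolding A3e by (rule index_unitary_conj[OF U3 ij'])
        finally show ?thesis using ij' \<open>i = Suc i'\<close> Suc unfolding sum.lessThan_Suc_shift
          by (simp add: Vi d_def)
      qed
    qed
    finally show "A' $$ (i,j) = (V * D * mat_adjoint V) $$ (i,j)" by simp
  qed (use A' V V' D in auto)
  have "A = (W * mat_adjoint W) * A * (W * mat_adjoint W)" unfolding WW2 using A by simp
  also have "\<dots> = W * A' * mat_adjoint W"
    unfolding A'_def using A W W' by (simp add: assoc_mult_mat[of _ "Suc n" "Suc n" _ "Suc n" _ "Suc n"])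
  also have "\<dots> = (W * V) * D * mat_adjoint (W * V)"
    unfolding A'e mat_adjoint_mult[OF W V]
    using W W' V V' D by (simp add: assoc_mult_mat[of _ "Suc n" "Suc n" _ "Suc n" _ "Suc n"])
  finally have 1: "A = (W * V) * D * mat_adjoint (W * V)" .
  have "mat_adjoint (W * V) * (W * V) = mat_adjoint V * (mat_adjoint W * W) * V"
    unfolding mat_adjoint_mult[OF W V]
    using W W' V V' by (simp add: assoc_mult_mat[of _ "Suc n" "Suc n" _ "Suc n" _ "Suc n"])
  also have "\<dots> = 1\<^sub>m (Suc n)" unfolding WW using V' VV by simp
  finally show ?case using 1 W V unfolding D_def by (intro exI[of _ "W * V"] exI[of _ d]) auto
qed

section \<open>Functional calculus and spectra in an eigenbasis\<close>

definition diagonalizes :: "nat \<Rightarrow> complex mat \<Rightarrow> complex mat \<Rightarrow> (nat \<Rightarrow> real) \<Rightarrow> bool" where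
  "diagonalizes n A U d \<longleftrightarrow> U \<in> carrier_mat n n \<and> mat_adjoint U * U = 1\<^sub>m n \<and>
     A = U * mat_diag n (\<lambda>i. complex_of_real (d i)) * mat_adjoint U"

definition coef :: "complex mat \<Rightarrow> nat \<Rightarrow> complex Matrix.vec \<Rightarrow> nat \<Rightarrow> complex" where
  "coef U n x k = (\<Sum>i<n. cnj (U $$ (i,k)) * vec_index x i)"

lemma diagonalizes_carrier:
  assumes "diagonalizes n A U d"
  shows "A \<in> carrier_mat n n"
proof -
  have U: "U \<in> carrier_mat n n" using assms by (simp add: diagonalizes_def)
  show ?thesis using assms
      mult_carrier_mat[OF mult_carrier_mat[OF U mat_diag_dim] mat_adjoint_carrier[OF U]]
    unfolding diagonalizes_def by simp
qed

lemma diagonalizes_index: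
  assumes "diagonalizes n A U d" "i < n" "j < n"
  shows "A $$ (i,j) = (\<Sum>k<n. U $$ (i,k) * of_real (d k) * cnj (U $$ (j,k)))"
  using assms index_unitary_conj[of U n i j] unfolding diagonalizes_def by simp

lemma diagonalizes_hermitian:
  assumes "diagonalizes n A U d"
  shows "hermitian A"
proof (rule hermitianI[OF diagonalizes_carrier[OF assms]])
  fix i j assume "i < n" "j < n"
  then show "A $$ (i,j) = cnj (A $$ (j,i))"
    by (simp add: diagonalizes_index[OF assms] mult_ac)
qed

lemma fun_calc_diagonalizes:
  assumes "diagonalizes n A U d"
  shows "fun_calc f A = U * mat_diag n (\<lambda>i. complex_of_real (f (d i))) * mat_adjoint U"
    and "diagonalizes n (fun_calc f A) U (\<lambda>i. f (d i))"
proof -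
  have "is_fun_calc f A (U * mat_diag n (\<lambda>i. complex_of_real (f (d i))) * mat_adjoint U)"
    using assms diagonalizes_carrier[OF assms] unfolding is_fun_calc_def diagonalizes_def
    by (intro exI[of _ U] exI[of _ d]) auto
  then show 1: "fun_calc f A = U * mat_diag n (\<lambda>i. complex_of_real (f (d i))) * mat_adjoint U"
    by (rule fun_calc_eqI)
  show "diagonalizes n (fun_calc f A) U (\<lambda>i. f (d i))"
    unfolding 1 using assms by (simp add: diagonalizes_def)
qed

lemma diagonalizes_form:
  assumes dg: "diagonalizes n A U d" and x: "x \<in> carrier_vec n"
  shows "(A *\<^sub>v x) \<bullet>c x = of_real (\<Sum>k<n. d k * (cmod (coef U n x k))\<^sup>2)"
proof -
  have "(A *\<^sub>v x) \<bullet>c x = (\<Sum>i<n. \<Sum>j<n. \<Sum>k<n. of_real (d k) *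
      ((U $$ (i,k) * cnj (vec_index x i)) * (cnj (U $$ (j,k)) * vec_index x j)))"
    unfolding quadratic_form_eq[OF diagonalizes_carrier[OF dg] x]
    by (intro sum.cong refl) (simp add: diagonalizes_index[OF dg] sum_distrib_left sum_distrib_right mult_ac)
  also have "\<dots> = (\<Sum>i<n. \<Sum>k<n. \<Sum>j<n. of_real (d k) *
      ((U $$ (i,k) * cnj (vec_index x i)) * (cnj (U $$ (j,k)) * vec_index x j)))"
    by (intro sum.cong refl sum.swap)
  also have "\<dots> = (\<Sum>k<n. \<Sum>i<n. \<Sum>j<n. of_real (d k) *
      ((U $$ (i,k) * cnj (vec_index x i)) * (cnj (U $$ (j,k)) * vec_index x j)))"
    by (rule sum.swap)
  also have "\<dots> = (\<Sum>k<n. of_real (d k) * (cnj (coef U n x k) * coef U n x k))"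
    unfolding coef_def cnj_sum sum_product
    by (intro sum.cong refl) (simp add: sum_distrib_left)
  also have "\<dots> = of_real (\<Sum>k<n. d k * (cmod (coef U n x k))\<^sup>2)"
    unfolding of_real_sum
    by (intro sum.cong refl) (simp only: of_real_mult complex_norm_square mult.commute)
  finally show ?thesis .
qed

lemma diag_diagonalizes: "diagonalizes n (mat_diag n (\<lambda>i. complex_of_real (t i))) (1\<^sub>m n) t"
proof -
  have "mat_adjoint (1\<^sub>m n) = (1\<^sub>m n :: complex mat)"
    using hermitianI[of "1\<^sub>m n :: complex mat" n] by (auto simp: hermitian_def)
  moreover have "1\<^sub>m n * mat_diag n (\<lambda>i. complex_of_real (t i)) * 1\<^sub>m n = mat_diag n (\<lambda>i. complex_of_real (t i))"
    for t
    by (simp only: left_mult_one_mat[OF mat_diag_dim] right_mult_one_mat[OF mat_diag_dim])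
  ultimately show "diagonalizes n (mat_diag n (\<lambda>i. complex_of_real (t i))) (1\<^sub>m n) t"
    by (auto simp: diagonalizes_def)
qed

lemma coef_norm:
  assumes U: "U \<in> carrier_mat n n" "mat_adjoint U * U = 1\<^sub>m n" and x: "x \<in> carrier_vec n"
  shows "(\<Sum>k<n. (cmod (coef U n x k))\<^sup>2) = (\<Sum>i<n. (cmod (vec_index x i))\<^sup>2)"
proof -
  have "diagonalizes n (1\<^sub>m n) U (\<lambda>_. 1)"
    using U unitary_inverse[OF U] by (simp add: diagonalizes_def)
  from diagonalizes_form[OF this x]
  have "(1\<^sub>m n *\<^sub>v x) \<bullet>c x = of_real (\<Sum>k<n. (cmod (coef U n x k))\<^sup>2)" by simp
  moreover have "(1\<^sub>m n *\<^sub>v x) \<bullet>c x = of_real (\<Sum>i<n. (cmod (vec_index x i))\<^sup>2)"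
    using x by (simp add: scalar_prod_def atLeast0LessThan complex_norm_square[symmetric] del: of_real_power)
  ultimately show ?thesis by (metis of_real_eq_iff)
qed

lemma diagonalizes_eigen:
  assumes dg: "diagonalizes n A U d" and ik: "i < n" "k < n"
  shows "(\<Sum>l<n. A $$ (i,l) * U $$ (l,k)) = of_real (d k) * U $$ (i,k)"
    and "(\<Sum>l<n. cnj (U $$ (l,k)) * A $$ (l,i)) = of_real (d k) * cnj (U $$ (i,k))"
proof -
  have U: "U \<in> carrier_mat n n" "mat_adjoint U * U = 1\<^sub>m n" using dg by (auto simp: diagonalizes_def)
  have E: "(\<Sum>l<n. A $$ (i,l) * U $$ (l,k)) = of_real (d k) * U $$ (i,k)" if "i < n" for i
  proof -
    have "(\<Sum>l<n. A $$ (i,l) * U $$ (l,k)) = (\<Sum>l<n. \<Sum>m<n. U $$ (i,m) * of_real (d m) * (cnj (U $$ (l,m)) * U $$ (l,k)))"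
      by (intro sum.cong refl) (simp add: diagonalizes_index[OF dg that] sum_distrib_right mult.assoc)
    also have "\<dots> = (\<Sum>m<n. \<Sum>l<n. U $$ (i,m) * of_real (d m) * (cnj (U $$ (l,m)) * U $$ (l,k)))"
      by (rule sum.swap)
    also have "\<dots> = (\<Sum>m<n. U $$ (i,m) * of_real (d m) * (if m = k then 1 else 0))"
      unfolding sum_distrib_left[symmetric]
      by (intro sum.cong refl) (simp add: unitary_sum(1)[OF U _ ik(2)])
    also have "\<dots> = of_real (d k) * U $$ (i,k)"
      using ik by (simp add: if_distrib[of "(*) _"] sum.delta cong: if_cong)
    finally show ?thesis .
  qed
  show "(\<Sum>l<n. A $$ (i,l) * U $$ (l,k)) = of_real (d k) * U $$ (i,k)" by (rule E[OF ik(1)])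
  have "(\<Sum>l<n. cnj (U $$ (l,k)) * A $$ (l,i)) = cnj (\<Sum>l<n. A $$ (i,l) * U $$ (l,k))"
    unfolding cnj_sum
  proof (intro sum.cong refl)
    fix l assume "l \<in> {..<n}"
    then show "cnj (U $$ (l,k)) * A $$ (l,i) = cnj (A $$ (i,l) * U $$ (l,k))"
      using hermitian_index[OF diagonalizes_carrier[OF dg] diagonalizes_hermitian[OF dg] _ ik(1), of l] by simp
  qed
  then show "(\<Sum>l<n. cnj (U $$ (l,k)) * A $$ (l,i)) = of_real (d k) * cnj (U $$ (i,k))"
    unfolding E[OF ik(1)] by simp
qed

lemma coef_column:
  assumes "U \<in> carrier_mat n n" "mat_adjoint U * U = 1\<^sub>m n" "j < n" "k < n"
  shows "coef U n (col U k) j = (if j = k then 1 else 0)"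
proof -
  have "coef U n (col U k) j = (\<Sum>i<n. cnj (U $$ (i,j)) * U $$ (i,k))"
    unfolding coef_def using assms(1,4) by (intro sum.cong refl) simp
  then show ?thesis using unitary_sum(1)[OF assms] by simp
qed

lemma spectrum_diagonalizes:
  assumes dg: "diagonalizes n A U d"
  shows "spectrum A = (\<lambda>k. complex_of_real (d k)) ` {..<n}"
proof (intro equalityI subsetI)
  have U: "U \<in> carrier_mat n n" "mat_adjoint U * U = 1\<^sub>m n" using dg by (auto simp: diagonalizes_def)
  note A = diagonalizes_carrier[OF dg]
  fix ev assume "ev \<in> spectrum A"
  then obtain x where x: "x \<in> carrier_vec n" "x \<noteq> 0\<^sub>v n" "A *\<^sub>v x = ev \<cdot>\<^sub>v x"
    using A by (auto simp: spectrum_def eigenvalue_def eigenvector_def)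
  have c: "ev * coef U n x k = of_real (d k) * coef U n x k" if k: "k < n" for k
  proof -
    have "ev * coef U n x k = (\<Sum>l<n. cnj (U $$ (l,k)) * vec_index (ev \<cdot>\<^sub>v x) l)"
      unfolding coef_def sum_distrib_left using x(1) by (intro sum.cong refl) simp
    also have "\<dots> = (\<Sum>l<n. \<Sum>i<n. (cnj (U $$ (l,k)) * A $$ (l,i)) * vec_index x i)"
      unfolding x(3)[symmetric] using A x(1)
      by (intro sum.cong refl) (simp add: scalar_prod_def atLeast0LessThan sum_distrib_left mult.assoc)
    also have "\<dots> = (\<Sum>i<n. \<Sum>l<n. (cnj (U $$ (l,k)) * A $$ (l,i)) * vec_index x i)"
      by (rule sum.swap)
    also have "\<dots> = of_real (d k) * coef U n x k"
      unfolding sum_distrib_right[symmetric] coef_def sum_distrib_left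
      by (intro sum.cong refl) (simp add: diagonalizes_eigen(2)[OF dg _ k] mult.assoc)
    finally show ?thesis .
  qed
  have "\<exists>k<n. coef U n x k \<noteq> 0"
  proof (rule ccontr)
    assume "\<not> (\<exists>k<n. coef U n x k \<noteq> 0)"
    then have "(\<Sum>i<n. (cmod (vec_index x i))\<^sup>2) = 0"
      unfolding coef_norm[OF U x(1), symmetric] by simp
    then have "\<forall>i<n. vec_index x i = 0" by (simp add: sum_nonneg_eq_0_iff)
    then have "x = 0\<^sub>v n" using x(1) by (intro eq_vecI) auto
    then show False using x(2) by simp
  qed
  then show "ev \<in> (\<lambda>k. complex_of_real (d k)) ` {..<n}" using c by force
next
  have U: "U \<in> carrier_mat n n" "mat_adjoint U * U = 1\<^sub>m n" using dg by (auto simp: diagonalizes_def)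
  note A = diagonalizes_carrier[OF dg]
  fix ev assume "ev \<in> (\<lambda>k. complex_of_real (d k)) ` {..<n}"
  then obtain k where k: "k < n" and l: "ev = of_real (d k)" by auto
  have c: "col U k \<in> carrier_vec n" using U(1) k by auto
  have "A *\<^sub>v col U k = ev \<cdot>\<^sub>v col U k"
  proof (rule eq_vecI)
    fix i assume "i < dim_vec (ev \<cdot>\<^sub>v col U k)"
    then have i: "i < n" using U(1) by simp
    have "vec_index (A *\<^sub>v col U k) i = (\<Sum>l<n. A $$ (i,l) * U $$ (l,k))"
      using A U(1) i k by (simp add: scalar_prod_def atLeast0LessThan)
    then show "vec_index (A *\<^sub>v col U k) i = vec_index (ev \<cdot>\<^sub>v col U k) i"
      unfolding diagonalizes_eigen(1)[OF dg i k] using l U(1) i k by simp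
  qed (use A U(1) in auto)
  moreover have "col U k \<noteq> 0\<^sub>v n"
  proof
    assume "col U k = 0\<^sub>v n"
    then have "coef U n (col U k) k = 0" by (simp add: coef_def)
    then show False using coef_column[OF U k k] by simp
  qed
  ultimately show "ev \<in> spectrum A"
    using c A by (auto simp: spectrum_def eigenvalue_def eigenvector_def)
qed

lemma eigenvalue_bounds:
  assumes dg: "diagonalizes n A U d" and k: "k < n"
    and form: "\<And>x. x \<in> carrier_vec n \<Longrightarrow> \<alpha> * (\<Sum>i<n. (cmod (vec_index x i))\<^sup>2) \<le> Re ((A *\<^sub>v x) \<bullet>c x) \<and>
      Re ((A *\<^sub>v x) \<bullet>c x) \<le> \<beta> * (\<Sum>i<n. (cmod (vec_index x i))\<^sup>2)"
  shows "d k \<in> {\<alpha>..\<beta>}"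
proof -
  have U: "U \<in> carrier_mat n n" "mat_adjoint U * U = 1\<^sub>m n" using dg by (auto simp: diagonalizes_def)
  have c: "col U k \<in> carrier_vec n" using U(1) k by auto
  have "(\<Sum>j<n. (cmod (coef U n (col U k) j))\<^sup>2) = (\<Sum>j<n. if j = k then 1 else 0)"
    by (intro sum.cong refl) (simp add: coef_column[OF U _ k])
  then have 1: "(\<Sum>i<n. (cmod (vec_index (col U k) i))\<^sup>2) = 1"
    unfolding coef_norm[OF U c] using k by simp
  have "(\<Sum>j<n. d j * (cmod (coef U n (col U k) j))\<^sup>2) = (\<Sum>j<n. if j = k then d k else 0)"
    by (intro sum.cong refl) (simp add: coef_column[OF U _ k])
  then have 2: "Re ((A *\<^sub>v col U k) \<bullet>c col U k) = d k"
    unfolding diagonalizes_form[OF dg c] using k by simp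
  show ?thesis using form[OF c] unfolding 1 2 by simp
qed

lemma form_bounds:
  assumes dg: "diagonalizes n A U d" and d: "\<And>k. k < n \<Longrightarrow> d k \<in> {\<alpha>..\<beta>}" and x: "x \<in> carrier_vec n"
  shows "\<alpha> * (\<Sum>i<n. (cmod (vec_index x i))\<^sup>2) \<le> Re ((A *\<^sub>v x) \<bullet>c x)"
    "Re ((A *\<^sub>v x) \<bullet>c x) \<le> \<beta> * (\<Sum>i<n. (cmod (vec_index x i))\<^sup>2)"
proof -
  have U: "U \<in> carrier_mat n n" "mat_adjoint U * U = 1\<^sub>m n" using dg by (auto simp: diagonalizes_def)
  show "\<alpha> * (\<Sum>i<n. (cmod (vec_index x i))\<^sup>2) \<le> Re ((A *\<^sub>v x) \<bullet>c x)"
    "Re ((A *\<^sub>v x) \<bullet>c x) \<le> \<beta> * (\<Sum>i<n. (cmod (vec_index x i))\<^sup>2)"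
    unfolding diagonalizes_form[OF dg x] coef_norm[OF U x, symmetric] sum_distrib_left Re_complex_of_real
    using d by (auto intro!: sum_mono mult_right_mono)
qed

text \<open>A finite difference formula in two eigenbases, with \<open>c\<close> the matrix of
  overlaps and \<open>h\<close> the direction of the perturbation. Each
  \<open>f (d k) - f (e j)\<close> is the divided difference times \<open>d k - e j\<close>, and
  \<open>rel\<close> trades \<open>c j k * (d k - e j)\<close> for entries of the increment. Being
  exact, it presupposes no continuity of the eigenvectors.\<close>

lemma perturbation_identity:
  fixes c h :: "nat \<Rightarrow> nat \<Rightarrow> complex" and d e :: "nat \<Rightarrow> real" and s :: real
  assumes z: "\<And>j. j < n \<Longrightarrow> z j = (\<Sum>k<n. c j k * y k)"
    and y: "\<And>k. k < n \<Longrightarrow> y k = (\<Sum>j<n. cnj (c j k) * z j)"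
    and rel: "\<And>j k. j < n \<Longrightarrow> k < n \<Longrightarrow>
      of_real s * (\<Sum>m<n. h j m * c m k) = c j k * of_real (d k - e j)"
  shows "of_real ((\<Sum>k<n. f (d k) * (cmod (y k))\<^sup>2) - (\<Sum>j<n. f (e j) * (cmod (z j))\<^sup>2))
    = of_real s * (\<Sum>j<n. \<Sum>k<n. \<Sum>m<n. of_real (divided_diff f (e j) (d k)) * (c m k * y k) * (h j m * cnj (z j)))"
proof -
  have 1: "of_real (\<Sum>k<n. f (d k) * (cmod (y k))\<^sup>2) = (\<Sum>j<n. \<Sum>k<n. of_real (f (d k)) * (c j k * y k * cnj (z j)))"
  proof -
    have "of_real (\<Sum>k<n. f (d k) * (cmod (y k))\<^sup>2) = (\<Sum>k<n. of_real (f (d k)) * (y k * cnj (y k)))"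
      unfolding of_real_sum by (intro sum.cong refl) (simp only: of_real_mult complex_norm_square)
    also have "\<dots> = (\<Sum>k<n. \<Sum>j<n. of_real (f (d k)) * (c j k * y k * cnj (z j)))"
    proof (intro sum.cong refl)
      fix k assume "k \<in> {..<n}"
      then have "cnj (y k) = (\<Sum>j<n. c j k * cnj (z j))" using y[of k] by simp
      then show "of_real (f (d k)) * (y k * cnj (y k)) = (\<Sum>j<n. of_real (f (d k)) * (c j k * y k * cnj (z j)))"
        by (simp add: sum_distrib_left mult_ac)
    qed
    also have "\<dots> = (\<Sum>j<n. \<Sum>k<n. of_real (f (d k)) * (c j k * y k * cnj (z j)))" by (rule sum.swap)
    finally show ?thesis .
  qed
  have 2: "of_real (\<Sum>j<n. f (e j) * (cmod (z j))\<^sup>2) = (\<Sum>j<n. \<Sum>k<n. of_real (f (e j)) * (c j k * y k * cnj (z j)))"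
    unfolding of_real_sum
  proof (intro sum.cong refl)
    fix j assume "j \<in> {..<n}"
    have "of_real (f (e j) * (cmod (z j))\<^sup>2) = of_real (f (e j)) * (z j * cnj (z j))"
      by (simp only: of_real_mult complex_norm_square)
    also have "\<dots> = of_real (f (e j)) * ((\<Sum>k<n. c j k * y k) * cnj (z j))" using z[of j] \<open>j \<in> {..<n}\<close> by simp
    finally show "of_real (f (e j) * (cmod (z j))\<^sup>2) = (\<Sum>k<n. of_real (f (e j)) * (c j k * y k * cnj (z j)))"
      by (simp add: sum_distrib_left sum_distrib_right)
  qed
  have 3: "of_real (f (d k)) * (c j k * y k * cnj (z j)) - of_real (f (e j)) * (c j k * y k * cnj (z j))
      = of_real s * (\<Sum>m<n. of_real (divided_diff f (e j) (d k)) * (c m k * y k) * (h j m * cnj (z j)))"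
    if "j < n" "k < n" for j k
  proof -
    have "f (d k) - f (e j) = divided_diff f (e j) (d k) * (d k - e j)"
      using divided_diff_mult[of f "e j" "d k"] by (simp add: algebra_simps)
    then have "of_real (f (d k)) - of_real (f (e j)) = (of_real (divided_diff f (e j) (d k)) * of_real (d k - e j) :: complex)"
      by (metis of_real_diff of_real_mult)
    then have "of_real (f (d k)) * (c j k * y k * cnj (z j)) - of_real (f (e j)) * (c j k * y k * cnj (z j))
      = of_real (divided_diff f (e j) (d k)) * (c j k * of_real (d k - e j)) * y k * cnj (z j)"
      unfolding left_diff_distrib[symmetric] by simp
    also have "\<dots> = of_real (divided_diff f (e j) (d k)) * (of_real s * (\<Sum>m<n. h j m * c m k)) * y k * cnj (z j)"
      unfolding rel[OF that] ..
    also have "\<dots> = of_real s * (\<Sum>m<n. of_real (divided_diff f (e j) (d k)) * (c m k * y k) * (h j m * cnj (z j)))"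
      by (simp add: sum_distrib_left sum_distrib_right mult_ac)
    finally show ?thesis .
  qed
  have "(\<Sum>j<n. \<Sum>k<n. of_real (f (d k)) * (c j k * y k * cnj (z j)))
      - (\<Sum>j<n. \<Sum>k<n. of_real (f (e j)) * (c j k * y k * cnj (z j)))
    = (\<Sum>j<n. \<Sum>k<n. of_real s * (\<Sum>m<n. of_real (divided_diff f (e j) (d k)) * (c m k * y k) * (h j m * cnj (z j))))"
    unfolding sum_subtractf[symmetric] by (intro sum.cong refl 3) auto
  then show ?thesis
    unfolding of_real_diff 1 2 by (simp add: sum_distrib_left)
qed

text \<open>The eigenvalue \<open>d s\<close> and its eigenvector are chosen separately for every
  \<open>s\<close>, so \<open>d s\<close> need not tend to \<open>e\<close>. But the overlap
  \<open>c s\<close> is small whenever \<open>d s\<close> stays away from \<open>e\<close>; thus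
  either \<open>F (d s)\<close> is close to \<open>F e\<close> or the factor \<open>c s\<close> is
  negligible.\<close>

lemma perturbation_limit:
  fixes c :: "real \<Rightarrow> complex" and d F :: "real \<Rightarrow> real"
  assumes F: "continuous_on {\<alpha>..\<beta>} F" and e: "e \<in> {\<alpha>..\<beta>}"
    and d: "\<And>s. s \<in> I \<Longrightarrow> d s \<in> {\<alpha>..\<beta>}"
    and Y: "\<And>s. s \<in> I \<Longrightarrow> cmod (c s) \<le> Y"
    and C: "\<And>s. s \<in> I \<Longrightarrow> cmod (c s) * \<bar>d s - e\<bar> \<le> C * \<bar>s - s0\<bar>"
  shows "((\<lambda>s. of_real (F (d s) - F e) * c s) \<longlongrightarrow> 0) (at s0 within I)"
  unfolding tendsto_iff dist_norm diff_0_right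
proof (intro allI impI)
  fix \<epsilon> :: real assume \<epsilon>: "\<epsilon> > 0"
  define Z where "Z = \<bar>Y\<bar> + 1"
  have Z: "Z > 0" by (simp add: Z_def)
  obtain \<eta> where \<eta>: "\<eta> > 0" "\<And>t. t \<in> {\<alpha>..\<beta>} \<Longrightarrow> \<bar>t - e\<bar> < \<eta> \<Longrightarrow> \<bar>F t - F e\<bar> < \<epsilon> / Z"
    using F e Z \<epsilon> unfolding continuous_on_iff dist_real_def by (metis divide_pos_pos)
  have "compact (F ` {\<alpha>..\<beta>})" by (rule compact_continuous_image[OF F]) simp
  then obtain M where M: "\<And>t. t \<in> {\<alpha>..\<beta>} \<Longrightarrow> \<bar>F t\<bar> \<le> M"
    using compact_imp_bounded bounded_iff by (metis image_eqI real_norm_def)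
  have M0: "M \<ge> 0" using M[OF e] by linarith
  have "((\<lambda>s. 2 * M * (C * \<bar>s - s0\<bar> / \<eta>)) \<longlongrightarrow> 2 * M * (C * \<bar>s0 - s0\<bar> / \<eta>)) (at s0 within I)"
    using \<eta>(1) by (intro tendsto_intros) auto
  then have "\<forall>\<^sub>F s in at s0 within I. 2 * M * (C * \<bar>s - s0\<bar> / \<eta>) < \<epsilon>"
    by (rule order_tendstoD) (use \<epsilon> in simp)
  moreover have "\<forall>\<^sub>F s in at s0 within I. s \<in> I" by (simp add: eventually_at_filter)
  ultimately show "\<forall>\<^sub>F s in at s0 within I. cmod (of_real (F (d s) - F e) * c s) < \<epsilon>"
  proof eventually_elim
    case (elim s)
    note ds = d[OF elim(2)]
    show ?case
    proof (cases "\<bar>d s - e\<bar> < \<eta>")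
      case True
      have "\<bar>F (d s) - F e\<bar> * cmod (c s) \<le> (\<epsilon> / Z) * \<bar>Y\<bar>"
        using \<eta>(2)[OF ds True] Y[OF elim(2)] Z \<epsilon> by (intro mult_mono) auto
      also have "\<dots> < (\<epsilon> / Z) * Z" using \<epsilon> Z by (intro mult_strict_left_mono) (auto simp: Z_def)
      finally show ?thesis using Z by (simp add: norm_mult del: of_real_diff)
    next
      case False
      have "cmod (c s) * \<eta> \<le> cmod (c s) * \<bar>d s - e\<bar>" using False by (intro mult_left_mono) auto
      then have "cmod (c s) \<le> C * \<bar>s - s0\<bar> / \<eta>"
        using C[OF elim(2)] \<eta>(1) by (simp add: pos_le_divide_eq)
      moreover have "\<bar>F (d s) - F e\<bar> \<le> 2 * M" using M[OF ds] M[OF e] by linarith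
      ultimately have "\<bar>F (d s) - F e\<bar> * cmod (c s) \<le> 2 * M * (C * \<bar>s - s0\<bar> / \<eta>)"
        using M0 by (intro mult_mono) auto
      then show ?thesis using elim(1) by (simp add: norm_mult del: of_real_diff)
    qed
  qed
qed

section \<open>Loewner's theorem\<close>

lemma coef_inverse:
  assumes U: "U \<in> carrier_mat n n" "mat_adjoint U * U = 1\<^sub>m n" and i: "i < n"
  shows "(\<Sum>k<n. U $$ (i,k) * coef U n x k) = vec_index x i"
proof -
  have "(\<Sum>k<n. U $$ (i,k) * coef U n x k) = (\<Sum>k<n. \<Sum>l<n. U $$ (i,k) * cnj (U $$ (l,k)) * vec_index x l)"
    unfolding coef_def sum_distrib_left by (simp add: mult.assoc)
  also have "\<dots> = (\<Sum>l<n. \<Sum>k<n. U $$ (i,k) * cnj (U $$ (l,k)) * vec_index x l)" by (rule sum.swap)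
  also have "\<dots> = (\<Sum>l<n. (if i = l then 1 else 0) * vec_index x l)"
    unfolding sum_distrib_right[symmetric] by (intro sum.cong refl) (simp add: unitary_sum(2)[OF U i])
  also have "\<dots> = vec_index x i" using i by (simp add: if_distrib[of "\<lambda>y. y * _"] sum.delta cong: if_cong)
  finally show ?thesis .
qed

lemma unitary_entry_le:
  fixes U :: "complex mat"
  assumes U: "U \<in> carrier_mat n n" "mat_adjoint U * U = 1\<^sub>m n" and ij: "i < n" "j < n"
  shows "cmod (U $$ (i,j)) \<le> 1"
proof -
  have "of_real (\<Sum>k<n. (cmod (U $$ (k,j)))\<^sup>2) = (1::complex)"
    using unitary_sum(1)[OF U ij(2,2)]
    by (simp add: complex_norm_square mult.commute del: of_real_power)
  then have "(\<Sum>k<n. (cmod (U $$ (k,j)))\<^sup>2) = 1" by (metis of_real_eq_1_iff)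
  moreover have "(cmod (U $$ (i,j)))\<^sup>2 \<le> (\<Sum>k<n. (cmod (U $$ (k,j)))\<^sup>2)"
    using ij by (intro member_le_sum) auto
  ultimately have "(cmod (U $$ (i,j)))\<^sup>2 \<le> 1" by simp
  then show ?thesis by (simp add: power_le_one_iff abs_square_le_1)
qed

text \<open>The first-order formula of Daletskii and Krein for the quadratic form of
  \<open>f (A s)\<close>: in an eigenbasis of \<open>A s0\<close> the derivative is the entrywise
  product of the Loewner matrix with the direction \<open>h\<close>. It holds for any choice of
  diagonalizations along the line.\<close>

lemma form_has_derivative:
  fixes A U :: "real \<Rightarrow> complex mat" and d :: "real \<Rightarrow> nat \<Rightarrow> real" and H :: "nat \<Rightarrow> nat \<Rightarrow> complex"
  assumes dg: "\<And>s. s \<in> I \<Longrightarrow> diagonalizes n (A s) (U s) (d s)"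
    and AH: "\<And>s i j. s \<in> I \<Longrightarrow> i < n \<Longrightarrow> j < n \<Longrightarrow> A s $$ (i,j) = A s0 $$ (i,j) + of_real (s - s0) * H i j"
    and s0: "s0 \<in> I" and rng: "\<And>s k. s \<in> I \<Longrightarrow> k < n \<Longrightarrow> d s k \<in> {\<alpha>..\<beta>}"
    and J: "open J" "C1_on J f" "{\<alpha>..\<beta>} \<subseteq> J"
    and h: "h = (\<lambda>j m. \<Sum>i<n. \<Sum>l<n. cnj (U s0 $$ (i,j)) * H i l * U s0 $$ (l,m))"
    and z: "z = coef (U s0) n x"
  shows "((\<lambda>s. \<Sum>k<n. f (d s k) * (cmod (coef (U s) n x k))\<^sup>2) has_real_derivative
     Re (\<Sum>j<n. \<Sum>m<n. of_real (divided_diff f (d s0 j) (d s0 m)) * z m * cnj (z j) * h j m)) (at s0 within I)"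
proof -
  have U: "U s \<in> carrier_mat n n" "mat_adjoint (U s) * U s = 1\<^sub>m n" if "s \<in> I" for s
    using dg[OF that] by (auto simp: diagonalizes_def)
  define e where "e = d s0"
  define y where "y = (\<lambda>s. coef (U s) n x)"
  \<comment> \<open>The entries of \<open>U(s0)^* U(s)\<close>, which relate the coordinates
    \<open>z\<close> and \<open>y s\<close> of the same vector \<open>x\<close>.\<close>
  define c where "c = (\<lambda>s j k. \<Sum>i<n. cnj (U s0 $$ (i,j)) * U s $$ (i,k))"
  have x0: "vec_index x i = (\<Sum>k<n. U s $$ (i,k) * y s k)" if "s \<in> I" "i < n" for s i
    unfolding y_def using coef_inverse[OF U[OF that(1)] that(2)] by simp
  have zf: "z j = (\<Sum>k<n. c s j k * y s k)" if s: "s \<in> I" and j: "j < n" for s j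
  proof -
    have "z j = (\<Sum>i<n. \<Sum>k<n. cnj (U s0 $$ (i,j)) * U s $$ (i,k) * y s k)"
      unfolding z coef_def using x0[OF s] by (simp add: sum_distrib_left mult.assoc)
    also have "\<dots> = (\<Sum>k<n. \<Sum>i<n. cnj (U s0 $$ (i,j)) * U s $$ (i,k) * y s k)" by (rule sum.swap)
    finally show ?thesis by (simp add: c_def sum_distrib_right)
  qed
  have yf: "y s k = (\<Sum>j<n. cnj (c s j k) * z j)" if s: "s \<in> I" and k: "k < n" for s k
  proof -
    have "y s k = (\<Sum>i<n. cnj (U s $$ (i,k)) * (\<Sum>j<n. U s0 $$ (i,j) * y s0 j))"
      unfolding y_def coef_def[of "U s"]
    proof (intro sum.cong refl)
      fix i assume "i \<in> {..<n}"
      then show "cnj (U s $$ (i,k)) * vec_index x i = cnj (U s $$ (i,k)) * (\<Sum>j<n. U s0 $$ (i,j) * coef (U s0) n x j)"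
        using coef_inverse[OF U[OF s0], of i x] by simp
    qed
    also have "\<dots> = (\<Sum>i<n. \<Sum>j<n. U s0 $$ (i,j) * cnj (U s $$ (i,k)) * z j)"
      by (simp add: sum_distrib_left y_def z mult_ac)
    also have "\<dots> = (\<Sum>j<n. \<Sum>i<n. U s0 $$ (i,j) * cnj (U s $$ (i,k)) * z j)" by (rule sum.swap)
    finally show ?thesis by (simp add: c_def sum_distrib_right)
  qed
  \<comment> \<open>Both sides are entries of \<open>U(s0)^* (A s - A s0) U(s)\<close>: one uses the
    direction \<open>H\<close>, the other the eigenvalue equations of the two matrices.\<close>
  have rel: "of_real (s - s0) * (\<Sum>m<n. h j m * c s m k) = c s j k * of_real (d s k - e j)"
    if s: "s \<in> I" and j: "j < n" and k: "k < n" for s j k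
  proof -
    have Uc: "(\<Sum>m<n. U s0 $$ (l,m) * c s m k) = U s $$ (l,k)" if l: "l < n" for l
    proof -
      have "c s m k = coef (U s0) n (col (U s) k) m" for m
        unfolding c_def coef_def using U(1)[OF s] k by (intro sum.cong refl) simp
      then show ?thesis using coef_inverse[OF U[OF s0] l, of "col (U s) k"] U(1)[OF s] k l by simp
    qed
    have "(\<Sum>m<n. h j m * c s m k)
      = (\<Sum>m<n. \<Sum>i<n. \<Sum>l<n. cnj (U s0 $$ (i,j)) * H i l * (U s0 $$ (l,m) * c s m k))"
      unfolding h by (simp add: sum_distrib_right mult.assoc)
    also have "\<dots> = (\<Sum>i<n. \<Sum>m<n. \<Sum>l<n. cnj (U s0 $$ (i,j)) * H i l * (U s0 $$ (l,m) * c s m k))"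
      by (rule sum.swap)
    also have "\<dots> = (\<Sum>i<n. \<Sum>l<n. \<Sum>m<n. cnj (U s0 $$ (i,j)) * H i l * (U s0 $$ (l,m) * c s m k))"
      by (intro sum.cong refl sum.swap)
    also have "\<dots> = (\<Sum>i<n. \<Sum>l<n. cnj (U s0 $$ (i,j)) * H i l * U s $$ (l,k))"
      unfolding sum_distrib_left[symmetric] by (intro sum.cong refl) (simp add: Uc)
    finally have "of_real (s - s0) * (\<Sum>m<n. h j m * c s m k)
      = (\<Sum>i<n. \<Sum>l<n. cnj (U s0 $$ (i,j)) * (of_real (s - s0) * H i l) * U s $$ (l,k))"
      by (simp add: sum_distrib_left mult_ac)
    also have "\<dots> = (\<Sum>i<n. \<Sum>l<n. cnj (U s0 $$ (i,j)) * (A s $$ (i,l) * U s $$ (l,k))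
        - cnj (U s0 $$ (i,j)) * A s0 $$ (i,l) * U s $$ (l,k))"
    proof (intro sum.cong refl)
      fix i l assume "i \<in> {..<n}" "l \<in> {..<n}"
      then have "of_real (s - s0) * H i l = A s $$ (i,l) - A s0 $$ (i,l)" using AH[OF s, of i l] by simp
      then show "cnj (U s0 $$ (i,j)) * (of_real (s - s0) * H i l) * U s $$ (l,k)
        = cnj (U s0 $$ (i,j)) * (A s $$ (i,l) * U s $$ (l,k)) - cnj (U s0 $$ (i,j)) * A s0 $$ (i,l) * U s $$ (l,k)"
        by (simp only:) (simp add: algebra_simps)
    qed
    also have "\<dots> = (\<Sum>i<n. cnj (U s0 $$ (i,j)) * (\<Sum>l<n. A s $$ (i,l) * U s $$ (l,k)))
        - (\<Sum>l<n. (\<Sum>i<n. cnj (U s0 $$ (i,j)) * A s0 $$ (i,l)) * U s $$ (l,k))"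
      unfolding sum_subtractf sum_distrib_left sum_distrib_right by (subst (2) sum.swap) (rule refl)
    also have "\<dots> = of_real (d s k) * c s j k - of_real (e j) * c s j k"
      unfolding c_def sum_distrib_left e_def
      by (intro arg_cong2[where f = "(-)"] sum.cong refl)
        (simp_all add: diagonalizes_eigen(1)[OF dg[OF s] _ k] diagonalizes_eigen(2)[OF dg[OF s0] _ j]
          sum_distrib_left[symmetric])
    finally show ?thesis by (simp add: algebra_simps)
  qed
  have cb: "cmod (c s j k) \<le> real n" if "s \<in> I" "j < n" "k < n" for s j k
  proof -
    have "cmod (c s j k) \<le> (\<Sum>i<n. cmod (cnj (U s0 $$ (i,j)) * U s $$ (i,k)))" unfolding c_def by (rule norm_sum)
    also have "\<dots> \<le> (\<Sum>i<n. 1)"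
      using unitary_entry_le[OF U[OF s0]] unitary_entry_le[OF U[OF that(1)]] that
      by (intro sum_mono) (auto simp: norm_mult intro!: mult_le_one)
    finally show ?thesis by simp
  qed
  define X where "X = (\<Sum>i<n. cmod (vec_index x i))"
  have yb: "cmod (y s k) \<le> X" if "s \<in> I" "k < n" for s k
  proof -
    have "cmod (y s k) \<le> (\<Sum>i<n. cmod (cnj (U s $$ (i,k)) * vec_index x i))" unfolding y_def coef_def by (rule norm_sum)
    also have "\<dots> \<le> X" unfolding X_def
      using unitary_entry_le[OF U[OF that(1)]] that
      by (intro sum_mono) (auto simp: norm_mult intro!: mult_left_le_one_le)
    finally show ?thesis .
  qed
  have X0: "X \<ge> 0" unfolding X_def by (intro sum_nonneg) auto
  define F where "F = (\<lambda>j. divided_diff f (e j))"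
  define T where "T = (\<lambda>s. \<Sum>j<n. \<Sum>k<n. \<Sum>m<n. of_real (F j (d s k)) * (c s m k * y s k) * (h j m * cnj (z j)))"
  define L where "L = (\<Sum>j<n. \<Sum>m<n. of_real (F j (e m)) * z m * cnj (z j) * h j m)"
  \<comment> \<open>The error made when the eigenvalue \<open>d s k\<close> is replaced by
    \<open>e m\<close>. After the replacement the sum over \<open>k\<close> rebuilds
    \<open>z m\<close> and leaves the constant \<open>L\<close>.\<close>
  define R where "R = (\<lambda>s. \<Sum>j<n. \<Sum>k<n. \<Sum>m<n. of_real (F j (d s k) - F j (e m)) * (c s m k * y s k) * (h j m * cnj (z j)))"
  have TR: "T s = L + R s" if s: "s \<in> I" for s
  proof -
    have "(\<Sum>j<n. \<Sum>k<n. \<Sum>m<n. of_real (F j (e m)) * (c s m k * y s k) * (h j m * cnj (z j)))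
      = (\<Sum>j<n. \<Sum>m<n. \<Sum>k<n. of_real (F j (e m)) * (c s m k * y s k) * (h j m * cnj (z j)))"
      by (intro sum.cong refl sum.swap)
    also have "\<dots> = L"
      unfolding L_def sum_distrib_right[symmetric] sum_distrib_left[symmetric]
      by (intro sum.cong refl) (simp add: zf[OF s, symmetric])
    finally have "L + R s = (\<Sum>j<n. \<Sum>k<n. \<Sum>m<n. of_real (F j (e m)) * (c s m k * y s k) * (h j m * cnj (z j)))
       + R s" by simp
    also have "\<dots> = T s" unfolding R_def T_def sum.distrib[symmetric]
      by (intro sum.cong refl) (simp add: algebra_simps)
    finally show ?thesis by simp
  qed
  have ej: "e j \<in> {\<alpha>..\<beta>}" if "j < n" for j using rng[OF s0 that] by (simp add: e_def)
  have "((\<lambda>s. of_real (F j (d s k) - F j (e m)) * (c s m k * y s k)) \<longlongrightarrow> 0) (at s0 within I)"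
    if jkm: "j < n" "k < n" "m < n" for j k m
  proof (rule perturbation_limit[where F = "F j" and e = "e m" and d = "\<lambda>s. d s k" and Y = "real n * X"
        and c = "\<lambda>s. c s m k * y s k" and C = "(\<Sum>p<n. cmod (h m p) * real n) * X"])
    show "continuous_on {\<alpha>..\<beta>} (F j)"
    proof (rule continuous_at_imp_continuous_on, intro ballI)
      fix t assume "t \<in> {\<alpha>..\<beta>}"
      then show "isCont (F j) t" unfolding F_def
        using isCont_divided_diff[OF J(1,2), of "e j" t] ej[OF jkm(1)] J(3) by blast
    qed
    show "e m \<in> {\<alpha>..\<beta>}" by (rule ej[OF jkm(3)])
    fix s assume s: "s \<in> I"
    show "d s k \<in> {\<alpha>..\<beta>}" by (rule rng[OF s jkm(2)])
    show "cmod (c s m k * y s k) \<le> real n * X"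
      unfolding norm_mult using cb[OF s jkm(3,2)] yb[OF s jkm(2)] X0 by (intro mult_mono) auto
    have "cmod (c s m k) * \<bar>d s k - e m\<bar> = \<bar>s - s0\<bar> * cmod (\<Sum>p<n. h m p * c s p k)"
      using arg_cong[OF rel[OF s jkm(3,2)], of cmod] by (simp add: norm_mult del: of_real_diff)
    also have "\<dots> \<le> \<bar>s - s0\<bar> * (\<Sum>p<n. cmod (h m p) * real n)"
      by (intro mult_left_mono order_trans[OF norm_sum] sum_mono)
        (auto simp: norm_mult intro!: mult_left_mono cb[OF s _ jkm(2)])
    finally have "(cmod (c s m k) * \<bar>d s k - e m\<bar>) * cmod (y s k)
        \<le> (\<bar>s - s0\<bar> * (\<Sum>p<n. cmod (h m p) * real n)) * X"
      by (rule mult_mono[OF _ yb[OF s jkm(2)]]) (auto intro!: mult_nonneg_nonneg sum_nonneg)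
    then show "cmod (c s m k * y s k) * \<bar>d s k - e m\<bar> \<le> ((\<Sum>p<n. cmod (h m p) * real n) * X) * \<bar>s - s0\<bar>"
      by (simp add: norm_mult mult_ac)
  qed
  then have "(R \<longlongrightarrow> (\<Sum>j<n. \<Sum>k<n. \<Sum>m<n. 0 * (h j m * cnj (z j)))) (at s0 within I)"
    unfolding R_def by (intro tendsto_sum tendsto_mult tendsto_const) auto
  then have "((\<lambda>s. Re (L + R s)) \<longlongrightarrow> Re (L + 0)) (at s0 within I)"
    by (intro tendsto_Re tendsto_add tendsto_const) simp
  then have lim: "((\<lambda>s. Re (L + R s)) \<longlongrightarrow> Re L) (at s0 within I)" by simp
  define \<phi> where "\<phi> = (\<lambda>s. \<Sum>k<n. f (d s k) * (cmod (coef (U s) n x k))\<^sup>2)"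
  have quot: "Re (L + R s) = (\<phi> s - \<phi> s0) / (s - s0)" if s: "s \<in> I" "s \<noteq> s0" for s
  proof -
    have "of_real (\<phi> s - \<phi> s0) = of_real (s - s0) * T s"
      using perturbation_identity[of n z "c s" "y s" "s - s0" h "d s" e f, OF zf[OF s(1)] yf[OF s(1)] rel[OF s(1)]]
      unfolding T_def F_def \<phi>_def y_def z e_def by simp
    from arg_cong[OF this, of Re] have "\<phi> s - \<phi> s0 = (s - s0) * Re (T s)" by simp
    then show ?thesis using s(2) TR[OF s(1)] by simp
  qed
  have "\<forall>\<^sub>F s in at s0 within I. Re (L + R s) = (\<phi> s - \<phi> s0) / (s - s0)"
    using quot by (simp add: eventually_at_filter)
  from Lim_transform_eventually[OF lim this]
  show ?thesis unfolding has_field_derivative_iff \<phi>_def L_def F_def e_def .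
qed

section \<open>Positive differences and segments of Hermitian matrices\<close>

lemma form_diff:
  fixes A B :: "complex mat"
  assumes A: "A \<in> carrier_mat n n" and B: "B \<in> carrier_mat n n" and x: "x \<in> carrier_vec n"
  shows "((A - B) *\<^sub>v x) \<bullet>c x = (A *\<^sub>v x) \<bullet>c x - (B *\<^sub>v x) \<bullet>c x"
proof -
  have "A - B \<in> carrier_mat n n" using B by (rule minus_carrier_mat)
  then show ?thesis
    unfolding quadratic_form_eq[OF A x] quadratic_form_eq[OF B x] quadratic_form_eq[OF \<open>A - B \<in> _\<close> x]
      sum_subtractf[symmetric]
    using A B by (intro sum.cong refl) (simp add: algebra_simps)
qed

lemma hermitian_diff:
  assumes A: "A \<in> carrier_mat n n" "hermitian A" and B: "B \<in> carrier_mat n n" "hermitian B"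
  shows "hermitian (A - B)"
proof (rule hermitianI[OF minus_carrier_mat[OF B(1)]])
  fix i j assume "i < n" "j < n"
  then show "(A - B) $$ (i, j) = cnj ((A - B) $$ (j, i))"
    using hermitian_index[OF A, of i j] hermitian_index[OF B, of i j] A(1) B(1) by simp
qed

lemma pos_semidef_fun_calc_diff_iff:
  assumes A: "diagonalizes n A U d" and B: "diagonalizes n B V e"
  shows "pos_semidef (fun_calc f A - fun_calc f B) \<longleftrightarrow>
    (\<forall>x\<in>carrier_vec n. (\<Sum>k<n. f (e k) * (cmod (coef V n x k))\<^sup>2) \<le> (\<Sum>k<n. f (d k) * (cmod (coef U n x k))\<^sup>2))"
proof -
  note fA = fun_calc_diagonalizes(2)[OF A, of f] and fB = fun_calc_diagonalizes(2)[OF B, of f]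
  note cA = diagonalizes_carrier[OF fA] and cB = diagonalizes_carrier[OF fB]
  have h: "hermitian (fun_calc f A - fun_calc f B)"
    by (rule hermitian_diff[OF cA diagonalizes_hermitian[OF fA] cB diagonalizes_hermitian[OF fB]])
  have dim: "dim_row (fun_calc f A - fun_calc f B) = n" using cB by simp
  have "((fun_calc f A - fun_calc f B) *\<^sub>v x) \<bullet>c x = of_real ((\<Sum>k<n. f (d k) * (cmod (coef U n x k))\<^sup>2)
      - (\<Sum>k<n. f (e k) * (cmod (coef V n x k))\<^sup>2))" if "x \<in> carrier_vec n" for x
    unfolding form_diff[OF cA cB that] diagonalizes_form[OF fA that] diagonalizes_form[OF fB that] by simp
  then show ?thesis unfolding pos_semidef_def dim using h by (auto simp: less_eq_complex_def)
qed

lemma pos_semidef_eigenvalues: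
  assumes dg: "diagonalizes n A U d" and p: "pos_semidef A" and k: "k < n"
  shows "0 \<le> d k"
proof -
  have U: "U \<in> carrier_mat n n" "mat_adjoint U * U = 1\<^sub>m n" using dg by (auto simp: diagonalizes_def)
  have c: "col U k \<in> carrier_vec n" using U(1) k by auto
  have "(\<Sum>j<n. d j * (cmod (coef U n (col U k) j))\<^sup>2) = (\<Sum>j<n. if j = k then d k else 0)"
    by (intro sum.cong refl) (simp add: coef_column[OF U _ k])
  then have "(A *\<^sub>v col U k) \<bullet>c col U k = of_real (d k)"
    unfolding diagonalizes_form[OF dg c] using k by simp
  moreover have "0 \<le> (A *\<^sub>v col U k) \<bullet>c col U k"
    using p c diagonalizes_carrier[OF dg] unfolding pos_semidef_def by auto
  ultimately show ?thesis by (simp add: less_eq_complex_def)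
qed

lemma line_diagonalizes:
  fixes B :: "complex mat" and H :: "nat \<Rightarrow> nat \<Rightarrow> complex"
  assumes B: "B \<in> carrier_mat n n" "hermitian B"
    and H: "\<And>i j. i < n \<Longrightarrow> j < n \<Longrightarrow> H i j = cnj (H j i)"
    and A: "A = (\<lambda>s::real. Matrix.mat n n (\<lambda>(i,j). B $$ (i,j) + of_real s * H i j))"
  obtains U d where "\<And>s. diagonalizes n (A s) (U s) (d s)"
proof -
  have "\<exists>U d. diagonalizes n (A s) U d" for s
  proof -
    have As: "A s \<in> carrier_mat n n" by (simp add: A)
    have "hermitian (A s)"
    proof (rule hermitianI[OF As])
      fix i j assume "i < n" "j < n"
      then show "A s $$ (i,j) = cnj (A s $$ (j,i))"
        using hermitian_index[OF B, of i j] H[of i j] by (simp add: A)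
    qed
    from hermitian_diagonalization[OF As this] show ?thesis unfolding diagonalizes_def by blast
  qed
  then show thesis using that by metis
qed

lemma form_line:
  fixes B :: "complex mat"
  assumes B: "B \<in> carrier_mat n n" and x: "x \<in> carrier_vec n"
    and A: "A = (\<lambda>s::real. Matrix.mat n n (\<lambda>(i,j). B $$ (i,j) + of_real s * H i j))"
  shows "(A s *\<^sub>v x) \<bullet>c x = (B *\<^sub>v x) \<bullet>c x
    + of_real s * (\<Sum>i<n. \<Sum>j<n. H i j * vec_index x j * cnj (vec_index x i))"
proof -
  have As: "A s \<in> carrier_mat n n" by (simp add: A)
  show ?thesis
    unfolding quadratic_form_eq[OF B x] quadratic_form_eq[OF As x] sum_distrib_left sum.distrib[symmetric]
    by (intro sum.cong refl) (simp add: A algebra_simps)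
qed

text \<open>Schur's product theorem, applied to the Loewner matrix of \<open>f\<close> and to \<open>H\<close> in an eigenbasis.\<close>
lemma loewner_schur_nonneg:
  assumes psd: "psd_on J n f" and e: "\<And>j. j < n \<Longrightarrow> e j \<in> J"
    and H: "diagonalizes n H V g" and g: "\<And>p. p < n \<Longrightarrow> 0 \<le> g p"
  shows "0 \<le> Re (\<Sum>j<n. \<Sum>m<n. of_real (divided_diff f (e j) (e m)) * z m * cnj (z j) *
    (\<Sum>i<n. \<Sum>l<n. cnj (U $$ (i,j)) * H $$ (i,l) * U $$ (l,m)))"
proof -
  \<comment> \<open>In the basis \<open>U\<close> the matrix \<open>H\<close> is a sum of rank-one
    terms \<open>a j p * cnj (a m p)\<close> with coefficients \<open>g p\<close>. For each
    \<open>p\<close> the factors are absorbed into the vector, which leaves a Loewner form.\<close>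
  define a where "a = (\<lambda>j p. \<Sum>i<n. cnj (U $$ (i,j)) * V $$ (i,p))"
  have h: "(\<Sum>i<n. \<Sum>l<n. cnj (U $$ (i,j)) * H $$ (i,l) * U $$ (l,m)) = (\<Sum>p<n. of_real (g p) * (a j p * cnj (a m p)))"
    for j m
  proof -
    have "(\<Sum>i<n. \<Sum>l<n. cnj (U $$ (i,j)) * H $$ (i,l) * U $$ (l,m))
      = (\<Sum>i<n. \<Sum>l<n. \<Sum>p<n. of_real (g p) * ((cnj (U $$ (i,j)) * V $$ (i,p)) * (cnj (V $$ (l,p)) * U $$ (l,m))))"
      by (intro sum.cong refl) (simp add: diagonalizes_index[OF H] sum_distrib_left sum_distrib_right mult_ac)
    also have "\<dots> = (\<Sum>i<n. \<Sum>p<n. \<Sum>l<n. of_real (g p) * ((cnj (U $$ (i,j)) * V $$ (i,p)) * (cnj (V $$ (l,p)) * U $$ (l,m))))"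
      by (intro sum.cong refl sum.swap)
    also have "\<dots> = (\<Sum>p<n. \<Sum>i<n. \<Sum>l<n. of_real (g p) * ((cnj (U $$ (i,j)) * V $$ (i,p)) * (cnj (V $$ (l,p)) * U $$ (l,m))))"
      by (rule sum.swap)
    also have "\<dots> = (\<Sum>p<n. of_real (g p) * (a j p * cnj (a m p)))"
      unfolding a_def cnj_sum sum_product by (intro sum.cong refl) (simp add: sum_distrib_left mult_ac)
    finally show ?thesis .
  qed
  have "(\<Sum>j<n. \<Sum>m<n. of_real (divided_diff f (e j) (e m)) * z m * cnj (z j) *
      (\<Sum>i<n. \<Sum>l<n. cnj (U $$ (i,j)) * H $$ (i,l) * U $$ (l,m)))
    = (\<Sum>j<n. \<Sum>m<n. \<Sum>p<n. of_real (g p) * (of_real (divided_diff f (e j) (e m)) *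
        (cnj (a m p) * z m) * cnj (cnj (a j p) * z j)))"
    unfolding h by (intro sum.cong refl) (simp add: sum_distrib_left mult_ac)
  also have "\<dots> = (\<Sum>j<n. \<Sum>p<n. \<Sum>m<n. of_real (g p) * (of_real (divided_diff f (e j) (e m)) *
        (cnj (a m p) * z m) * cnj (cnj (a j p) * z j)))"
    by (intro sum.cong refl sum.swap)
  also have "\<dots> = (\<Sum>p<n. \<Sum>j<n. \<Sum>m<n. of_real (g p) * (of_real (divided_diff f (e j) (e m)) *
        (cnj (a m p) * z m) * cnj (cnj (a j p) * z j)))"
    by (rule sum.swap)
  also have "\<dots> = (\<Sum>p<n. of_real (g p) * (\<Sum>j<n. \<Sum>m<n. of_real (divided_diff f (e j) (e m)) *
        (cnj (a m p) * z m) * cnj (cnj (a j p) * z j)))"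
    by (simp only: sum_distrib_left)
  also have "\<dots> = of_real (\<Sum>p<n. g p *
      ((\<Sum>j<n. \<Sum>m<n. Re (cnj (a j p) * z j) * Re (cnj (a m p) * z m) * divided_diff f (e j) (e m))
      + (\<Sum>j<n. \<Sum>m<n. Im (cnj (a j p) * z j) * Im (cnj (a m p) * z m) * divided_diff f (e j) (e m))))"
    unfolding of_real_sum of_real_mult
    by (intro sum.cong refl arg_cong2[where f = "(*)"] real_symmetric_form[of "\<lambda>j m. divided_diff f (e j) (e m)"])
      (rule divided_diff_commute)
  finally show ?thesis
    by (simp only: Re_complex_of_real) (auto intro!: sum_nonneg mult_nonneg_nonneg add_nonneg_nonneg g psd_on_indexed[OF psd e])
qed

text \<open>Along the segment from \<open>B\<close> to \<open>A\<close> the form of \<open>f\<close>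
  at a fixed vector has a nonnegative derivative, because its direction \<open>A - B\<close> is
  positive semidefinite and Schur's theorem applies. Integrating over the segment gives the order
  relation.\<close>

theorem psd_on_imp_n_monotone:
  assumes C1: "C1_on {a<..<b} f" and psd: "psd_on {a<..<b} n f"
  shows "n_monotone_on n {a<..<b} f"
  unfolding n_monotone_on_def
proof (intro conjI ballI impI)
  show "continuous_on {a<..<b} f" by (rule C1_on_continuous[OF C1])
  fix A B assume A: "A \<in> carrier_mat n n" and B: "B \<in> carrier_mat n n"
    and *: "hermitian A \<and> hermitian B \<and> spectrum A \<subseteq> complex_of_real ` {a<..<b} \<and>
      spectrum B \<subseteq> complex_of_real ` {a<..<b} \<and> pos_semidef (A - B)"
  have hA: "hermitian A" and hB: "hermitian B"
    and sA: "spectrum A \<subseteq> complex_of_real ` {a<..<b}" and sB: "spectrum B \<subseteq> complex_of_real ` {a<..<b}"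
    and AB: "pos_semidef (A - B)" using * by auto
  obtain UA dA where dA: "diagonalizes n A UA dA"
    using hermitian_diagonalization[OF A hA] unfolding diagonalizes_def by blast
  obtain UB dB where dB: "diagonalizes n B UB dB"
    using hermitian_diagonalization[OF B hB] unfolding diagonalizes_def by blast
  have cAB: "A - B \<in> carrier_mat n n" by (rule minus_carrier_mat[OF B])
  have hAB: "hermitian (A - B)" by (rule hermitian_diff[OF A hA B hB])
  obtain V g where H: "diagonalizes n (A - B) V g"
    using hermitian_diagonalization[OF cAB hAB] unfolding diagonalizes_def by blast
  have dAJ: "dA k \<in> {a<..<b}" and dBJ: "dB k \<in> {a<..<b}" if "k < n" for k
    using sA sB that unfolding spectrum_diagonalizes[OF dA] spectrum_diagonalizes[OF dB] by force+
  define D where "D = dA ` {..<n} \<union> dB ` {..<n}"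
  have D: "finite D" "D \<subseteq> {a<..<b}" using dAJ dBJ by (auto simp: D_def)
  define \<alpha> where "\<alpha> = Min D"
  define \<beta> where "\<beta> = Max D"
  have rAB: "dA k \<in> {\<alpha>..\<beta>}" "dB k \<in> {\<alpha>..\<beta>}" if "k < n" for k
    using D(1) that by (auto simp: \<alpha>_def \<beta>_def D_def)
  define M where "M = (\<lambda>s::real. Matrix.mat n n (\<lambda>(i,j). B $$ (i,j) + of_real s * (A - B) $$ (i,j)))"
  obtain U d where dg: "\<And>s. diagonalizes n (M s) (U s) (d s)"
    using line_diagonalizes[OF B hB hermitian_index[OF cAB hAB] M_def] by blast
  have M0: "M 0 = B" and M1: "M 1 = A"
    using A B by (auto simp: M_def intro!: eq_matI)
  show "pos_semidef (fun_calc f A - fun_calc f B)"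
    unfolding pos_semidef_fun_calc_diff_iff[OF dg[of 1, unfolded M1] dg[of 0, unfolded M0]]
  proof
    fix x :: "complex Matrix.vec" assume x: "x \<in> carrier_vec n"
    show "(\<Sum>k<n. f (d 0 k) * (cmod (coef (U 0) n x k))\<^sup>2) \<le> (\<Sum>k<n. f (d 1 k) * (cmod (coef (U 1) n x k))\<^sup>2)"
    proof (cases "n = 0")
      case True
      then show ?thesis by simp
    next
      case False
      then have D0: "D \<noteq> {}" by (auto simp: D_def)
      then have "\<alpha> \<in> D" "\<beta> \<in> D" using D(1) by (auto simp: \<alpha>_def \<beta>_def)
      then have "\<alpha> \<in> {a<..<b}" "\<beta> \<in> {a<..<b}" using D(2) by auto
      then have ab: "{\<alpha>..\<beta>} \<subseteq> {a<..<b}" by auto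
      \<comment> \<open>A form bounded by \<open>\<alpha>\<close> and \<open>\<beta>\<close> times
        the squared norm at both ends of the segment has the same bounds between them, so no
        eigenvalue leaves the interval.\<close>
      have rng: "d s k \<in> {\<alpha>..\<beta>}" if s: "s \<in> {0..1}" and k: "k < n" for s k
      proof (rule eigenvalue_bounds[OF dg k])
        fix v :: "complex Matrix.vec" assume v: "v \<in> carrier_vec n"
        define N where "N = (\<Sum>i<n. (cmod (vec_index v i))\<^sup>2)"
        have q: "Re ((M s *\<^sub>v v) \<bullet>c v) = (1 - s) * Re ((B *\<^sub>v v) \<bullet>c v) + s * Re ((A *\<^sub>v v) \<bullet>c v)"
          using form_line[OF B v M_def, of s] form_line[OF B v M_def, of 1] unfolding M1
          by (simp add: algebra_simps)
        have "(1 - s) * (\<alpha> * N) + s * (\<alpha> * N) \<le> (1 - s) * Re ((B *\<^sub>v v) \<bullet>c v) + s * Re ((A *\<^sub>v v) \<bullet>c v)"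
          "(1 - s) * Re ((B *\<^sub>v v) \<bullet>c v) + s * Re ((A *\<^sub>v v) \<bullet>c v) \<le> (1 - s) * (\<beta> * N) + s * (\<beta> * N)"
          unfolding N_def using s form_bounds[OF dA rAB(1) v] form_bounds[OF dB rAB(2) v]
          by (auto intro!: add_mono mult_left_mono)
        then show "\<alpha> * (\<Sum>i<n. (cmod (vec_index v i))\<^sup>2) \<le> Re ((M s *\<^sub>v v) \<bullet>c v) \<and>
            Re ((M s *\<^sub>v v) \<bullet>c v) \<le> \<beta> * (\<Sum>i<n. (cmod (vec_index v i))\<^sup>2)"
          unfolding q N_def[symmetric] by (simp add: algebra_simps)
      qed
      define \<phi> where "\<phi> = (\<lambda>s. \<Sum>k<n. f (d s k) * (cmod (coef (U s) n x k))\<^sup>2)"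
      have der: "\<exists>y\<ge>0. (\<phi> has_real_derivative y) (at s0 within {0..1})" if s0: "s0 \<in> {0..1}" for s0
      proof -
        have AH: "M s $$ (i,j) = M s0 $$ (i,j) + of_real (s - s0) * (A - B) $$ (i,j)"
          if "i < n" "j < n" for s i j
          using that A B by (simp add: M_def algebra_simps)
        have N: "d s0 j \<in> {a<..<b}" if "j < n" for j using rng[OF s0 that] ab by blast
        note F = form_has_derivative[where A = M and U = U and d = d and I = "{0..1}" and n = n
            and H = "\<lambda>i j. (A - B) $$ (i,j)" and J = "{a<..<b}" and x = x, OF dg AH s0 rng open_greaterThanLessThan C1 ab refl refl]
        show ?thesis unfolding \<phi>_def
          by (rule exI, rule conjI[rotated], rule F, assumption+,
              rule loewner_schur_nonneg[OF psd N H pos_semidef_eigenvalues[OF H AB]])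
      qed
      have "continuous_on {0..1} \<phi>"
        unfolding continuous_on_eq_continuous_within
      proof
        fix s :: real assume "s \<in> {0..1}"
        then show "continuous (at s within {0..1}) \<phi>"
          using der[of s] DERIV_continuous by blast
      qed
      moreover have "\<exists>y. (\<phi> has_real_derivative y) (at s) \<and> 0 \<le> y" if "0 < s" "s < 1" for s
        using der[of s] that by (auto simp: at_within_Icc_at)
      ultimately have "\<phi> 0 \<le> \<phi> 1"
        by (intro DERIV_nonneg_imp_increasing_open[of 0 1 \<phi>]) auto
      then show ?thesis by (simp add: \<phi>_def)
    qed
  qed
qed

text \<open>The diagonal matrix of the points is perturbed by a positive multiple of the all-ones
  matrix, which is positive semidefinite. The entrywise product of the Loewner matrix with the
  all-ones matrix is the Loewner matrix itself, so the derivative at 0 is the wanted form up to the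
  factor \<open>\<epsilon>\<close>.\<close>

theorem n_monotone_imp_psd_on:
  assumes C1: "C1_on {a<..<b} f" and mono: "n_monotone_on n {a<..<b} f" and ab: "a < b"
  shows "psd_on {a<..<b} n f"
  unfolding psd_on_def
proof (intro allI impI, elim conjE)
  fix S w assume S: "finite S" "S \<subseteq> {a<..<b}" "card S \<le> n"
  show "0 \<le> kform (divided_diff f) S w"
  proof (cases "n = 0")
    case True
    then show ?thesis using S by (simp add: kform_def)
  next
    case False
    have c: "(a + b) / 2 \<in> {a<..<b}" using ab by auto
    obtain ts r where ts: "length ts = n" "set ts \<subseteq> {a<..<b}"
      and r: "\<forall>\<phi>. (\<Sum>i<n. r i * \<phi> (ts ! i)) = (\<Sum>s\<in>S. w s * \<phi> s)"
      using indexed_of_points[OF S c, of w] by blast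
    define t where "t = (\<lambda>i. ts ! i)"
    have tJ: "t i \<in> {a<..<b}" if "i < n" for i using ts that unfolding t_def by (meson nth_mem subsetD)
    define x where "x = vec n (\<lambda>i. complex_of_real (r i))"
    have x: "x \<in> carrier_vec n" by (simp add: x_def)
    define \<alpha> where "\<alpha> = Min (t ` {..<n})"
    define \<mu> where "\<mu> = Max (t ` {..<n})"
    have \<alpha>\<mu>: "\<alpha> \<in> {a<..<b}" "\<mu> \<in> {a<..<b}" "\<And>i. i < n \<Longrightarrow> t i \<in> {\<alpha>..\<mu>}"
    proof -
      have ne: "t ` {..<n} \<noteq> {}" using False by auto
      show "\<alpha> \<in> {a<..<b}" "\<mu> \<in> {a<..<b}"
        using Min_in[OF _ ne] Max_in[OF _ ne] tJ unfolding \<alpha>_def \<mu>_def by auto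
      show "t i \<in> {\<alpha>..\<mu>}" if "i < n" for i using that by (auto simp: \<alpha>_def \<mu>_def)
    qed
    \<comment> \<open>The all-ones matrix has norm \<open>n\<close>, so eigenvalues move up by at
      most \<open>\<epsilon> * n\<close>, half of the distance from the largest point to
      \<open>b\<close>.\<close>
    define \<epsilon> where "\<epsilon> = (b - \<mu>) / (2 * real n)"
    have \<epsilon>: "\<epsilon> > 0" using \<alpha>\<mu>(2) False by (simp add: \<epsilon>_def)
    define \<beta> where "\<beta> = \<mu> + \<epsilon> * real n"
    have "\<epsilon> * real n = (b - \<mu>) / 2" using False by (simp add: \<epsilon>_def)
    then have sub: "{\<alpha>..\<beta>} \<subseteq> {a<..<b}" using \<alpha>\<mu>(1,2) by (auto simp: \<beta>_def)
    define B where "B = mat_diag n (\<lambda>i. complex_of_real (t i))"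
    have dB: "diagonalizes n B (1\<^sub>m n) t" unfolding B_def by (rule diag_diagonalizes)
    note cB = diagonalizes_carrier[OF dB] and hB = diagonalizes_hermitian[OF dB]
    define M where "M = (\<lambda>s::real. Matrix.mat n n (\<lambda>(i,j). B $$ (i,j) + of_real s * complex_of_real \<epsilon>))"
    obtain U' d' where dg': "\<And>s. diagonalizes n (M s) (U' s) (d' s)"
      using line_diagonalizes[OF cB hB _ M_def] by auto
    have M0: "M 0 = B" using cB by (auto simp: M_def intro!: eq_matI)
    \<comment> \<open>At \<open>s = 0\<close> the chosen diagonalization is replaced by the standard
      basis with eigenvalues \<open>t\<close>, so that the derivative formula produces the Loewner
      matrix of the given points in their given order.\<close>
    define U where "U = (\<lambda>s::real. if s = 0 then 1\<^sub>m n else U' s)"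
    define d where "d = (\<lambda>s::real. if s = 0 then t else d' s)"
    have dg: "diagonalizes n (M s) (U s) (d s)" for s
      using dg'[of s] dB M0 by (simp add: U_def d_def)
    have form: "(M s *\<^sub>v v) \<bullet>c v = (B *\<^sub>v v) \<bullet>c v + of_real (s * \<epsilon> * (cmod (\<Sum>i<n. vec_index v i))\<^sup>2)"
      if v: "v \<in> carrier_vec n" for s v
    proof -
      have "(\<Sum>i<n. \<Sum>j<n. complex_of_real \<epsilon> * vec_index v j * cnj (vec_index v i))
        = of_real \<epsilon> * ((\<Sum>j<n. vec_index v j) * cnj (\<Sum>i<n. vec_index v i))"
        unfolding cnj_sum by (subst mult.commute[of "sum _ _"], subst sum_product) (simp add: sum_distrib_left mult_ac)
      also have "\<dots> = of_real (\<epsilon> * (cmod (\<Sum>i<n. vec_index v i))\<^sup>2)"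
        by (simp only: complex_norm_square of_real_mult)
      finally show ?thesis using form_line[OF cB v M_def, of s] by (simp add: mult.assoc)
    qed
    have cs: "(cmod (\<Sum>i<n. vec_index v i))\<^sup>2 \<le> real n * (\<Sum>i<n. (cmod (vec_index v i))\<^sup>2)" for v :: "complex Matrix.vec"
    proof -
      have "(cmod (\<Sum>i<n. vec_index v i))\<^sup>2 \<le> (\<Sum>i<n. cmod (vec_index v i))\<^sup>2"
        by (intro power_mono norm_sum) auto
      also have "\<dots> \<le> (\<Sum>i<n. (cmod (vec_index v i))\<^sup>2) * card {..<n}"
        by (rule sum_squared_le_sum_of_squares)
      finally show ?thesis by (simp add: mult.commute)
    qed
    have rng: "d s k \<in> {\<alpha>..\<beta>}" if s: "s \<in> {0..1}" and k: "k < n" for s k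
    proof (rule eigenvalue_bounds[OF dg k])
      fix v :: "complex Matrix.vec" assume v: "v \<in> carrier_vec n"
      define N where "N = (\<Sum>i<n. (cmod (vec_index v i))\<^sup>2)"
      have "s * \<epsilon> * (cmod (\<Sum>i<n. vec_index v i))\<^sup>2 \<le> 1 * \<epsilon> * (real n * N)"
        unfolding N_def using s \<epsilon> cs by (intro mult_mono) (auto intro!: sum_nonneg)
      moreover have "0 \<le> s * \<epsilon> * (cmod (\<Sum>i<n. vec_index v i))\<^sup>2" using s \<epsilon> by auto
      ultimately show "\<alpha> * (\<Sum>i<n. (cmod (vec_index v i))\<^sup>2) \<le> Re ((M s *\<^sub>v v) \<bullet>c v) \<and>
          Re ((M s *\<^sub>v v) \<bullet>c v) \<le> \<beta> * (\<Sum>i<n. (cmod (vec_index v i))\<^sup>2)"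
        using form_bounds[OF dB \<alpha>\<mu>(3) v] unfolding form[OF v] N_def[symmetric] \<beta>_def
        by (simp add: algebra_simps)
    qed
    define \<phi> where "\<phi> = (\<lambda>s. \<Sum>k<n. f (d s k) * (cmod (coef (U s) n x k))\<^sup>2)"
    have inc: "\<phi> 0 \<le> \<phi> s" if s: "s \<in> {0..1}" for s
    proof -
      have cM: "M s \<in> carrier_mat n n" by (rule diagonalizes_carrier[OF dg])
      have hM: "hermitian (M s)" by (rule diagonalizes_hermitian[OF dg])
      have "pos_semidef (M s - B)"
        unfolding pos_semidef_def
      proof (intro conjI ballI)
        show "hermitian (M s - B)" by (rule hermitian_diff[OF cM hM cB hB])
        fix v :: "complex Matrix.vec" assume "v \<in> carrier_vec (dim_row (M s - B))"
        then have v: "v \<in> carrier_vec n" using cB by simp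
        have "((M s - B) *\<^sub>v v) \<bullet>c v = of_real (s * \<epsilon> * (cmod (\<Sum>i<n. vec_index v i))\<^sup>2)"
          unfolding form_diff[OF cM cB v] form[OF v] by simp
        then show "0 \<le> ((M s - B) *\<^sub>v v) \<bullet>c v" using s \<epsilon> by (simp add: less_eq_complex_def)
      qed
      moreover have "spectrum (M s) \<subseteq> complex_of_real ` {a<..<b}"
        unfolding spectrum_diagonalizes[OF dg] using rng[OF s] sub by blast
      moreover have "spectrum B \<subseteq> complex_of_real ` {a<..<b}"
        unfolding spectrum_diagonalizes[OF dB] using tJ by blast
      ultimately have "pos_semidef (fun_calc f (M s) - fun_calc f B)"
        using mono cM cB hM hB unfolding n_monotone_on_def by blast
      then show ?thesis
        unfolding pos_semidef_fun_calc_diff_iff[OF dg dg[of 0, unfolded M0]] \<phi>_def using x by blast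
    qed
    define L where "L = Re (\<Sum>j<n. \<Sum>m<n. of_real (divided_diff f (t j) (t m)) * coef (1\<^sub>m n) n x m * cnj (coef (1\<^sub>m n) n x j) *
        (\<Sum>i<n. \<Sum>l<n. cnj ((1\<^sub>m n :: complex mat) $$ (i,j)) * complex_of_real \<epsilon> * (1\<^sub>m n :: complex mat) $$ (l,m)))"
    have "(\<phi> has_real_derivative L) (at 0 within {0..1})"
    proof -
      have AH: "M s $$ (i,j) = M 0 $$ (i,j) + of_real (s - 0) * complex_of_real \<epsilon>"
        if "i < n" "j < n" for s i j
        using that by (simp add: M_def)
      have z: "(0::real) \<in> {0..1}" by simp
      note F = form_has_derivative[where A = M and U = U and d = d and I = "{0..1}" and n = n
            and H = "\<lambda>i j. complex_of_real \<epsilon>" and J = "{a<..<b}" and x = x, OF dg AH z rng open_greaterThanLessThan C1 sub refl refl]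
      have U0: "U 0 = 1\<^sub>m n" and d0: "d 0 = t" by (auto simp: U_def d_def)
      show ?thesis using F unfolding U0 d0 \<phi>_def L_def by simp
    qed
    then have "((\<lambda>s. (\<phi> s - \<phi> 0) / (s - 0)) \<longlongrightarrow> L) (at 0 within {0..1})"
      unfolding has_field_derivative_iff .
    moreover have "\<forall>\<^sub>F s in at 0 within {0..1}. 0 \<le> (\<phi> s - \<phi> 0) / (s - 0)"
      using inc by (auto simp: eventually_at_filter)
    moreover have "at (0::real) within {0..1} \<noteq> bot"
      by (simp add: at_within_Icc_at_right)
    ultimately have "0 \<le> L" by (rule tendsto_lowerbound)
    moreover have "L = \<epsilon> * kform (divided_diff f) S w"
    proof -
      have cx: "coef (1\<^sub>m n) n x m = of_real (r m)" if "m < n" for m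
      proof -
        have "coef (1\<^sub>m n) n x m = (\<Sum>i<n. if i = m then of_real (r m) else 0)"
          unfolding coef_def using that by (intro sum.cong refl) (simp add: x_def)
        then show ?thesis using that by simp
      qed
      have one: "(\<Sum>i<n. \<Sum>l<n. cnj ((1\<^sub>m n :: complex mat) $$ (i,j)) * complex_of_real \<epsilon> * (1\<^sub>m n :: complex mat) $$ (l,m)) = of_real \<epsilon>"
        if "j < n" "m < n" for j m
      proof -
        have s1: "(\<Sum>i<n. cnj ((1\<^sub>m n :: complex mat) $$ (i,j))) = 1"
        proof -
          have "(\<Sum>i<n. cnj ((1\<^sub>m n :: complex mat) $$ (i,j))) = (\<Sum>i<n. if i = j then 1 else 0)"
            using that by (intro sum.cong refl) simp
          then show ?thesis using that by simp
        qed
        have s2: "(\<Sum>l<n. (1\<^sub>m n :: complex mat) $$ (l,m)) = 1"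
        proof -
          have "(\<Sum>l<n. (1\<^sub>m n :: complex mat) $$ (l,m)) = (\<Sum>l<n. if l = m then 1 else 0)"
            using that by (intro sum.cong refl) simp
          then show ?thesis using that by simp
        qed
        have "(\<Sum>i<n. \<Sum>l<n. cnj ((1\<^sub>m n :: complex mat) $$ (i,j)) * complex_of_real \<epsilon> * (1\<^sub>m n :: complex mat) $$ (l,m))
          = (\<Sum>i<n. cnj ((1\<^sub>m n :: complex mat) $$ (i,j))) * complex_of_real \<epsilon> * (\<Sum>l<n. (1\<^sub>m n :: complex mat) $$ (l,m))"
          by (simp only: sum_distrib_left sum_distrib_right) (rule sum.swap)
        then show ?thesis unfolding s1 s2 by simp
      qed
      have "L = Re (\<Sum>j<n. \<Sum>m<n. of_real (\<epsilon> * (r j * r m * divided_diff f (t j) (t m))))"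
        unfolding L_def by (intro arg_cong[of _ _ Re] sum.cong refl) (simp add: cx one del: index_one_mat)
      also have "\<dots> = \<epsilon> * (\<Sum>j<n. \<Sum>m<n. r j * r m * divided_diff f (t j) (t m))"
        by (simp only: Re_sum Re_complex_of_real sum_distrib_left)
      also have "(\<Sum>j<n. \<Sum>m<n. r j * r m * divided_diff f (t j) (t m)) = kform (divided_diff f) S w"
        by (rule double_sum_eq_kform) (use r in \<open>simp add: t_def\<close>)
      finally show ?thesis .
    qed
    ultimately show ?thesis using \<epsilon> by (simp add: zero_le_mult_iff)
  qed
qed

section \<open>The implications\<close>

lemma C1_differentiable_on_imp_C1_on:
  assumes "open J" "f C1_differentiable_on J"
  shows "C1_on J f"
proof -
  obtain D where D: "\<And>x. x \<in> J \<Longrightarrow> (f has_vector_derivative D x) (at x)" "continuous_on J D"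
    using assms(2) unfolding C1_differentiable_on_def by blast
  show ?thesis
    by (rule C1_onI[OF assms(1) _ D(2)]) (use D(1) in \<open>simp add: has_real_derivative_iff_has_vector_derivative\<close>)
qed

section \<open>Upper and lower limits as frequent and eventual bounds\<close>

lemma frequently_gt_of_Limsup:
  assumes "ereal c < Limsup F (\<lambda>t. ereal (g t))"
  shows "\<exists>\<^sub>F t in F. c < g t"
proof (rule ccontr)
  assume "\<not> (\<exists>\<^sub>F t in F. c < g t)"
  then have "\<forall>\<^sub>F t in F. ereal (g t) \<le> ereal c" by (simp add: not_frequently not_less)
  then have "Limsup F (\<lambda>t. ereal (g t)) \<le> ereal c" by (rule Limsup_bounded)
  with assms show False by simp
qed

lemma frequently_less_of_Liminf:
  assumes "Liminf F (\<lambda>t. ereal (g t)) < ereal c"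
  shows "\<exists>\<^sub>F t in F. g t < c"
proof (rule ccontr)
  assume "\<not> (\<exists>\<^sub>F t in F. g t < c)"
  then have "\<forall>\<^sub>F t in F. ereal c \<le> ereal (g t)" by (simp add: not_frequently not_less)
  then have "ereal c \<le> Liminf F (\<lambda>t. ereal (g t))" by (rule Liminf_bounded)
  with assms show False by simp
qed

lemma eventually_mult_small_left:
  fixes b C e :: real
  assumes "e > 0"
  shows "\<forall>\<^sub>F t in at_left b. t < b \<and> (b - t) * C < e"
proof -
  have "((\<lambda>t. (b - t) * C) \<longlongrightarrow> (b - b) * C) (at_left b)" by (intro tendsto_intros)
  then have "\<forall>\<^sub>F t in at_left b. (b - t) * C < e" by (rule order_tendstoD) (use assms in simp)
  moreover have "\<forall>\<^sub>F t in at_left b. t < b" by (simp add: eventually_at_filter)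
  ultimately show ?thesis by eventually_elim simp
qed

lemma eventually_mult_small_right:
  fixes a C e :: real
  assumes "e > 0"
  shows "\<forall>\<^sub>F t in at_right a. a < t \<and> (t - a) * C < e"
proof -
  have "((\<lambda>t. (t - a) * C) \<longlongrightarrow> (a - a) * C) (at_right a)" by (intro tendsto_intros)
  then have "\<forall>\<^sub>F t in at_right a. (t - a) * C < e" by (rule order_tendstoD) (use assms in simp)
  moreover have "\<forall>\<^sub>F t in at_right a. a < t" by (simp add: eventually_at_filter)
  ultimately show ?thesis by eventually_elim simp
qed

text \<open>Monotonicity of \<open>f\<close> settles the lower bound at \<open>b\<close> and the
  upper bound at \<open>a\<close>. The two other bounds come from the growth estimate, used at the
  left end in reflected form and with one further factor \<open>t - a\<close>.\<close>

lemma psd_on_2_eventually: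
  assumes C1: "C1_on {a<..<b} f" and psd: "psd_on {a<..<b} 2 f" and ab: "a < b"
  shows "\<exists>C. \<forall>\<^sub>F t in at_left b. (b - t) * f t \<le> C"
    and "\<exists>C. \<forall>\<^sub>F t in at_left b. C \<le> f t"
    and "e > 0 \<Longrightarrow> \<forall>\<^sub>F t in at_right a. (t - a) * f t < e"
    and "e > 0 \<Longrightarrow> \<forall>\<^sub>F t in at_right a. - e < (t - a)\<^sup>2 * f t"
proof -
  define m where "m = (a + b) / 2"
  have m: "a < m" "m < b" using ab by (auto simp: m_def)
  have evb: "\<forall>\<^sub>F t in at_left b. m < t \<and> t < b"
    using m by (intro eventually_at_leftI[of m b]) auto
  have eva: "\<forall>\<^sub>F t in at_right a. a < t \<and> t < m"
    using m by (intro eventually_at_rightI[of a m]) auto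
  obtain C where C: "\<And>t. m < t \<Longrightarrow> t < b \<Longrightarrow> (b - t) * f t \<le> C"
    using psd_on_2_bound[OF C1 psd ab] unfolding m_def by blast
  show "\<exists>C. \<forall>\<^sub>F t in at_left b. (b - t) * f t \<le> C"
    using evb by (intro exI[of _ C]) (auto elim!: eventually_mono intro: C)
  show "\<exists>C. \<forall>\<^sub>F t in at_left b. C \<le> f t"
    using evb m by (intro exI[of _ "f m"]) (auto elim!: eventually_mono intro!: psd_on_2_mono[OF C1 psd])
  show "\<forall>\<^sub>F t in at_right a. (t - a) * f t < e" if "e > 0"
    using eventually_mult_small_right[OF that, of a "f m"] eva
  proof eventually_elim
    case (elim t)
    then have "(t - a) * f t \<le> (t - a) * f m"
      using m by (intro mult_left_mono psd_on_2_mono[OF C1 psd]) auto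
    then show ?case using elim by linarith
  qed
  obtain D where D: "\<And>t. a < t \<Longrightarrow> t < m \<Longrightarrow> D \<le> (t - a) * f t"
    using psd_on_2_bound_left[OF C1 psd ab] unfolding m_def by blast
  show "\<forall>\<^sub>F t in at_right a. - e < (t - a)\<^sup>2 * f t" if "e > 0"
    using eventually_mult_small_right[OF that, of a "- D"] eva
  proof eventually_elim
    case (elim t)
    then have "(t - a) * D \<le> (t - a) * ((t - a) * f t)"
      by (intro mult_left_mono D) auto
    moreover have "- e < (t - a) * D" using elim by simp
    ultimately show ?case unfolding power2_eq_square mult.assoc by linarith
  qed
qed

lemma psd_on_2_limits:
  assumes C1: "C1_on {a<..<b} f" and psd: "psd_on {a<..<b} 2 f" and ab: "a < b"
  shows "Limsup (at_left b) (\<lambda>t. ereal ((b - t) * f t)) < \<infinity>"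
    and "Limsup (at_left b) (\<lambda>t. ereal (f t)) > - \<infinity>"
    and "Liminf (at_right a) (\<lambda>t. ereal ((t - a) * f t)) \<le> 0"
    and "Limsup (at_right a) (\<lambda>t. ereal ((t - a)\<^sup>2 * f t)) \<ge> 0"
proof -
  note ev = psd_on_2_eventually[OF C1 psd ab]
  have le: "Liminf F g \<le> Limsup F g" if "F \<noteq> bot" for F and g :: "real \<Rightarrow> ereal"
    by (rule Liminf_le_Limsup[OF that])
  obtain C where "\<forall>\<^sub>F t in at_left b. (b - t) * f t \<le> C" using ev(1) by blast
  then have "Limsup (at_left b) (\<lambda>t. ereal ((b - t) * f t)) \<le> ereal C"
    by (intro Limsup_bounded) simp
  also have "ereal C < \<infinity>" by simp
  finally show "Limsup (at_left b) (\<lambda>t. ereal ((b - t) * f t)) < \<infinity>" .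
  obtain C where "\<forall>\<^sub>F t in at_left b. C \<le> f t" using ev(2) by blast
  then have "ereal C \<le> Liminf (at_left b) (\<lambda>t. ereal (f t))"
    by (intro Liminf_bounded) simp
  also have "\<dots> \<le> Limsup (at_left b) (\<lambda>t. ereal (f t))" by (rule le) simp
  finally show "Limsup (at_left b) (\<lambda>t. ereal (f t)) > - \<infinity>"
    by (rule order_less_le_trans[rotated]) simp
  show "Liminf (at_right a) (\<lambda>t. ereal ((t - a) * f t)) \<le> 0"
  proof (rule ereal_le_epsilon2)
    fix e :: real assume "e > 0"
    have "Liminf (at_right a) (\<lambda>t. ereal ((t - a) * f t)) \<le> Limsup (at_right a) (\<lambda>t. ereal ((t - a) * f t))"
      by (rule le) simp
    also have "\<dots> \<le> ereal e"
      by (rule Limsup_bounded) (use ev(3)[OF \<open>e > 0\<close>] in \<open>auto elim: eventually_mono\<close>)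
    finally show "Liminf (at_right a) (\<lambda>t. ereal ((t - a) * f t)) \<le> 0 + ereal e" by simp
  qed
  show "Limsup (at_right a) (\<lambda>t. ereal ((t - a)\<^sup>2 * f t)) \<ge> 0"
  proof (rule ereal_le_epsilon2)
    fix e :: real assume "e > 0"
    have "ereal (- e) \<le> Liminf (at_right a) (\<lambda>t. ereal ((t - a)\<^sup>2 * f t))"
      by (rule Liminf_bounded) (use ev(4)[OF \<open>e > 0\<close>] in \<open>auto elim: eventually_mono\<close>)
    also have "\<dots> \<le> Limsup (at_right a) (\<lambda>t. ereal ((t - a)\<^sup>2 * f t))"
      by (rule le) simp
    finally have "ereal (- e) + ereal e \<le> Limsup (at_right a) (\<lambda>t. ereal ((t - a)\<^sup>2 * f t)) + ereal e"
      by (intro add_mono) auto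
    then show "0 \<le> Limsup (at_right a) (\<lambda>t. ereal ((t - a)\<^sup>2 * f t)) + ereal e"
      by (simp add: zero_ereal_def)
  qed
qed

lemma frequently_gt_real_of_Limsup:
  assumes "- \<infinity> < Limsup F (\<lambda>t. ereal (g t))"
  shows "\<exists>M. \<exists>\<^sub>F t in F. M < g t"
  using ereal_dense2[OF assms] frequently_gt_of_Limsup by blast

lemma eventually_less_real_of_Limsup:
  assumes "Limsup F (\<lambda>t. ereal (g t)) < \<infinity>"
  shows "\<exists>M. \<forall>\<^sub>F t in F. g t < M"
proof -
  obtain M where "Limsup F (\<lambda>t. ereal (g t)) < ereal M" using ereal_dense2[OF assms] by blast
  from Limsup_lessD[OF this] show ?thesis by auto
qed

section \<open>The conditions in terms of kernels, and the single implications\<close>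

context
  fixes a b :: real and f :: "real \<Rightarrow> real"
  assumes ab: "a < b" and C1: "C1_on {a<..<b} f"
begin

lemma cond_alpha_iff: "cond_alpha f a b n \<longleftrightarrow> psd_on {a<..<b} n f"
  unfolding cond_alpha_def using psd_on_imp_n_monotone[OF C1] n_monotone_imp_psd_on[OF C1 _ ab] by blast

lemma cond_pos_def_iff:
  "(\<forall>ts. length ts = n \<and> set ts \<subseteq> {a<..<b} \<longrightarrow> cond_pos_def (loewner_mat g ts)) \<longleftrightarrow> cpd_on {a<..<b} n g"
  by (rule cond_pos_def_loewner_iff) (use ab in auto)

lemma cond_neg_def_iff:
  "(\<forall>ts. length ts = n \<and> set ts \<subseteq> {a<..<b} \<longrightarrow>
      cond_neg_def (loewner_mat (\<lambda>t. (t - a) * (b - t) * f t) ts)) \<longleftrightarrow>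
   cpd_on {a<..<b} n (\<lambda>t. - ((t - a) * (b - t) * f t))"
proof (rule cond_neg_def_loewner_iff)
  have "C1_on {a<..<b} (\<lambda>t. (t - a) * ((b - t) * f t))"
    by (intro C1_on_poly_mult C1) auto
  then show "C1_on {a<..<b} (\<lambda>t. (t - a) * (b - t) * f t)" by (simp add: mult.assoc)
qed (use ab in auto)

lemma alpha_imp_beta:
  assumes "n \<ge> 2" "psd_on {a<..<b} n f"
  shows "cond_beta f a b n"
  unfolding cond_beta_def cond_pos_def_iff
  using psd_on_2_limits(1,2)[OF C1 psd_on_mono[OF assms(2,1)] ab] cpd_on_shift_sq[OF C1 assms(2)] by blast

text \<open>Two orders are kept apart because the end conditions rest on positivity of order two,
  whereas \<open>n\<close> may be 1 when \<delta> is derived from \<gamma>.\<close>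

lemma alpha_imp_delta:
  assumes "m \<ge> 2" "psd_on {a<..<b} m f" "n \<le> m"
  shows "cond_delta f a b n"
proof -
  have "cpd_on {a<..<b} n (\<lambda>t. (t - a)\<^sup>2 * f t)"
    using cpd_on_shift_sq[OF C1 psd_on_mono[OF assms(2,3)], of a] by (simp add: power2_commute)
  then show ?thesis
    unfolding cond_delta_def cond_pos_def_iff
    using psd_on_2_limits(3,4)[OF C1 psd_on_mono[OF assms(2,1)] ab] by blast
qed

text \<open>The way leads through the kernel of \<open>(t - a)^2 * f t\<close>, which keeps the
  order \<open>m + 1\<close>; the comparison of \<Phi> at the two ends then costs one point.\<close>

lemma alpha_imp_gamma:
  assumes m: "m \<ge> 1" and psd: "psd_on {a<..<b} (Suc m) f" and n: "n \<le> m"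
  shows "cond_gamma f a b n"
proof -
  have psd2: "psd_on {a<..<b} 2 f" by (rule psd_on_mono[OF psd]) (use m in simp)
  note ev = psd_on_2_eventually[OF C1 psd2 ab]
  obtain C where C: "\<forall>\<^sub>F t in at_left b. (b - t) * f t \<le> C" using ev(1) by blast
  have "cpd_on {a<..<b} m (\<lambda>t. - ((t - a) * (b - t) * f t))"
  proof (rule cpd_on_mixed[OF ab C1 m _ _ C])
    show "cpd_on {a<..<b} (Suc m) (\<lambda>t. (t - a)\<^sup>2 * f t)"
      using cpd_on_shift_sq[OF C1 psd, of a] by (simp add: power2_commute)
    show "\<exists>\<^sub>F t in at_right a. - e < (t - a)\<^sup>2 * f t" if "e > 0" for e
      using ev(4)[OF that] by (rule eventually_frequently[rotated]) simp
  qed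
  then show ?thesis
    unfolding cond_gamma_def cond_neg_def_iff
    using psd_on_2_limits(2,3)[OF C1 psd2 ab] cpd_on_mono[OF _ n] by blast
qed

text \<open>A frequent lower bound \<open>M\<close> for \<open>f\<close> controls
  \<open>(b - t) * f t\<close> from below, as \<open>(b - t) * M\<close> tends to 0. The upper bound
  for \<open>(b - t) * f t\<close> controls \<open>(b - t)^2 * f t\<close> through the additional
  factor \<open>b - t\<close>.\<close>

lemma beta_imp_alpha:
  assumes n: "n \<ge> 1" and beta: "cond_beta f a b m" and m: "Suc n \<le> m"
  shows "psd_on {a<..<b} n f"
proof (rule psd_on_from_right_end[OF ab C1 n])
  show "cpd_on {a<..<b} (Suc n) (\<lambda>t. (b - t)\<^sup>2 * f t)"
    using beta cpd_on_mono[OF _ m] unfolding cond_beta_def cond_pos_def_iff by blast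
  fix e :: real assume e: "e > 0"
  obtain M where M: "\<exists>\<^sub>F t in at_left b. M < f t"
    using beta frequently_gt_real_of_Limsup unfolding cond_beta_def by blast
  from frequently_eventually_frequently[OF M eventually_mult_small_left[OF e, of b "- M"]]
  show "\<exists>\<^sub>F t in at_left b. - e < (b - t) * f t"
  proof (rule frequently_elim1)
    fix t assume t: "M < f t \<and> t < b \<and> (b - t) * - M < e"
    then have "(b - t) * M < (b - t) * f t" by (intro mult_strict_left_mono) auto
    moreover have "- e < (b - t) * M" using t by simp
    ultimately show "- e < (b - t) * f t" by linarith
  qed
  obtain N where N: "\<forall>\<^sub>F t in at_left b. (b - t) * f t < N"
    using beta eventually_less_real_of_Limsup[of "at_left b" "\<lambda>t. (b - t) * f t"]
    unfolding cond_beta_def by blast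
  have "\<forall>\<^sub>F t in at_left b. (b - t)\<^sup>2 * f t < e"
    using eventually_mult_small_left[OF e, of b N] N
  proof eventually_elim
    case (elim t)
    then have "(b - t) * ((b - t) * f t) < (b - t) * N" by (intro mult_strict_left_mono) auto
    then show ?case using elim unfolding power2_eq_square mult.assoc by linarith
  qed
  then show "\<exists>\<^sub>F t in at_left b. (b - t)\<^sup>2 * f t < e"
    by (rule eventually_frequently[rotated]) simp
qed

lemma gamma_imp_alpha:
  assumes n: "n \<ge> 1" and gamma: "cond_gamma f a b m" and m: "Suc n \<le> m"
  shows "psd_on {a<..<b} n f"
proof (rule psd_on_from_mixed[OF ab C1 n])
  show "cpd_on {a<..<b} (Suc n) (\<lambda>t. - ((t - a) * (b - t) * f t))"
    using gamma cpd_on_mono[OF _ m] unfolding cond_gamma_def cond_neg_def_iff by blast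
  show "\<exists>\<^sub>F t in at_right a. (t - a) * f t < e" if e: "e > 0" for e
  proof (rule frequently_less_of_Liminf)
    have "Liminf (at_right a) (\<lambda>t. ereal ((t - a) * f t)) \<le> 0" using gamma by (simp add: cond_gamma_def)
    also have "0 < ereal e" using e by simp
    finally show "Liminf (at_right a) (\<lambda>t. ereal ((t - a) * f t)) < ereal e" .
  qed
  show "\<exists>M. \<exists>\<^sub>F t in at_left b. M < f t"
    using gamma frequently_gt_real_of_Limsup unfolding cond_gamma_def by blast
qed

lemma delta_imp_alpha:
  assumes n: "n \<ge> 1" and delta: "cond_delta f a b m" and m: "Suc n \<le> m"
  shows "psd_on {a<..<b} n f"
proof (rule psd_on_from_left_end[OF ab C1 n])
  show "cpd_on {a<..<b} (Suc n) (\<lambda>t. (t - a)\<^sup>2 * f t)"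
    using delta cpd_on_mono[OF _ m] unfolding cond_delta_def cond_pos_def_iff by blast
  fix e :: real assume e: "e > 0"
  show "\<exists>\<^sub>F t in at_right a. (t - a) * f t < e"
  proof (rule frequently_less_of_Liminf)
    have "Liminf (at_right a) (\<lambda>t. ereal ((t - a) * f t)) \<le> 0" using delta by (simp add: cond_delta_def)
    also have "0 < ereal e" using e by simp
    finally show "Liminf (at_right a) (\<lambda>t. ereal ((t - a) * f t)) < ereal e" .
  qed
  show "\<exists>\<^sub>F t in at_right a. - e < (t - a)\<^sup>2 * f t"
  proof (rule frequently_gt_of_Limsup)
    have "ereal (- e) < 0" using e by simp
    also have "0 \<le> Limsup (at_right a) (\<lambda>t. ereal ((t - a)\<^sup>2 * f t))" using delta by (simp add: cond_delta_def)
    finally show "ereal (- e) < Limsup (at_right a) (\<lambda>t. ereal ((t - a)\<^sup>2 * f t))" .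
  qed
qed

end

theorem theorem4p1:
  fixes f :: "real \<Rightarrow> real" and a b :: real and n :: nat
  assumes "a < b"
    and "f C1_differentiable_on {a<..<b}"
    and "n \<ge> 1"
  shows "(n \<ge> 2 \<longrightarrow> cond_alpha f a b n \<longrightarrow> cond_beta f a b n) \<and>
         (cond_beta f a b (4 * n + 1) \<longrightarrow> cond_alpha f a b n) \<and>
         (cond_alpha f a b (2 * n + 2) \<longrightarrow> cond_gamma f a b n) \<and>
         (cond_gamma f a b (2 * n + 1) \<longrightarrow> cond_alpha f a b n) \<and>
         (n \<ge> 2 \<longrightarrow> cond_alpha f a b n \<longrightarrow> cond_delta f a b n) \<and>
         (cond_gamma f a b (2 * n + 1) \<longrightarrow> cond_delta f a b n) \<and>
         (cond_delta f a b (2 * n + 1) \<longrightarrow> cond_gamma f a b n)"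
proof -
  have C1: "C1_on {a<..<b} f" by (rule C1_differentiable_on_imp_C1_on[OF _ assms(2)]) simp
  note [simp] = cond_alpha_iff[OF assms(1) C1]
  show ?thesis
  proof (intro conjI impI)
    show "cond_beta f a b n" if "n \<ge> 2" "cond_alpha f a b n"
      using alpha_imp_beta[OF assms(1) C1 that(1)] that(2) by simp
    show "cond_alpha f a b n" if "cond_beta f a b (4 * n + 1)"
      using beta_imp_alpha[OF assms(1) C1 assms(3) that] by simp
    show "cond_gamma f a b n" if "cond_alpha f a b (2 * n + 2)"
      using alpha_imp_gamma[OF assms(1) C1, of "2 * n + 1" n] that by simp
    show "cond_alpha f a b n" if "cond_gamma f a b (2 * n + 1)"
      using gamma_imp_alpha[OF assms(1) C1 assms(3) that] by simp
    show "cond_delta f a b n" if "n \<ge> 2" "cond_alpha f a b n"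
      using alpha_imp_delta[OF assms(1) C1 that(1), of n] that(2) by simp
    \<comment> \<open>The detour through \<alpha> of order \<open>2 * n\<close> reaches order at
      least two even for \<open>n = 1\<close>, as the end conditions of \<delta> require.\<close>
    show "cond_delta f a b n" if "cond_gamma f a b (2 * n + 1)"
    proof -
      have p: "psd_on {a<..<b} (2 * n) f"
        by (rule gamma_imp_alpha[OF assms(1) C1 _ that]) (use assms(3) in auto)
      show ?thesis
        by (rule alpha_imp_delta[OF assms(1) C1 _ p]) (use assms(3) in auto)
    qed
    show "cond_gamma f a b n" if "cond_delta f a b (2 * n + 1)"
    proof -
      have "psd_on {a<..<b} (2 * n) f"
        by (rule delta_imp_alpha[OF assms(1) C1 _ that]) (use assms(3) in auto)
      \<comment> \<open>As \<open>n\<close> is at least 1, \<open>2 * n\<close> is a successor and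
        \<open>n \<le> 2 * n - 1\<close>, so giving up one more point still leaves order
        \<open>n\<close>.\<close>
      then have p: "psd_on {a<..<b} (Suc (2 * n - 1)) f" using assms(3) by simp
      show ?thesis
        by (rule alpha_imp_gamma[OF assms(1) C1 _ p]) (use assms(3) in auto)
    qed
  qed
qed

end
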